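(* Let $G$ be a finitely generated discrete group. Assume that there are a finite symmetric generating set $S_1$ of $G$ and constants $K,L>0$, $0\le\gamma<1$ such that the lazy simple random walk $P=P_{S_1}$ satisfies $P^{(n)}(e)\ge Ke^{-Ln^{\gamma}}$ for all $n\ge1$. Assume also that there are a (possibly different) finite symmetric generating set $S_2$ of $G$ and constants $M,N>0$ such that the lazy simple random walk $P=P_{S_2}$ satisfies $$P^{(n)}(g)\ \le\ P^{(n)}(e)\,N\,e^{-M|g|^2/n}\qquad\text{for all } n\ge1,\ g\in G,$$ where $|g|$ is the word length of $g$ with respect to $S_2$. Then $\alpha(G')\ge 1-\gamma$ for any finitely generated group $G'$ having a Cayley graph quasi-isometric to a Cayley graph of $G$. Consequently, in every Cayley graph (with respect to a finite symmetric generating set) of such a group $G'$ (in particular of $G$), the speed exponent satisfies $\beta\le\frac{1}{2(1-\gamma)}$; so that, if $\gamma<\tfrac12$, the graph is Liouville.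
   Context: For a finite symmetric generating set $S$ of a group $G$, $P=P_S=\tfrac12(\delta_e+P')$ where $P'=\mathbf 1_S/|S|$ is the uniform distribution on $S$; $P^{(n)}$ is the $n$-fold convolution of $P$ with itself, $|g|$ is the word length of $g$ with respect to $S$, and $e$ is the identity. Speed exponent (of $G$ with respect to $S$): $\beta=\sup\{c\in[0,1]:\exists K>0\text{ such that }\mathbb E|P^{(n)}|\ge Kn^c\text{ for all }n\ge1\}$, where $\mathbb E|P^{(n)}|=\sum_{g}|g|P^{(n)}(g)$. A Cayley graph is Liouville if it has no non-constant bounded harmonic functions. Compression exponent: let $B$ be a Hilbert space and $\pi:G\to\mathrm{Isom}(B)$ a homomorphism to the group of (affine) isometries of $B$. An equivariant uniform embedding is a map $f:G\to B$ with $f(\gamma x)=\pi(\gamma)f(x)$ for all $\gamma,x\in G$, for which there exist an unbounded increasing (non-decreasing) function $\rho_-:\mathbb R_{\ge0}\to\mathbb R_{\ge0}$ and a constant $C>0$ with $$\rho_-(|y^{-1}x|)\le\|f(x)-f(y)\|\le C|y^{-1}x|+C\qquad\text{for all }x,y\in G.$$ Such a $\rho_-$ is called a compression function of $f$. The compression exponent $\alpha(f)$ is the supremum of the $c\in[0,1]$ for which there exist $K>0$ and a compression function $\rho_-$ of $f$ with $\rho_-(n)\ge Kn^c$ for all integers $n\ge1$. The equivariant compression exponent $\alpha(G)$ is the supremum of $\alpha(f)$ over all Hilbert spaces $B$, all $\pi$ and all equivariant uniform embeddings $f$ (with $\alpha(G)=0$ if there are none). It does not depend on the choice of generating set. *)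

theory Defs
  imports
    "HOL-Algebra.Bij"
    "HOL-Algebra.Module"
    "HOL-Algebra.Algebraic_Closure_Type"
    "HOL-Probability.Probability"
begin

section \<open>Word metrics and Cayley graphs\<close>

text \<open>The generating set is nonempty because the uniform distribution on it has to make sense.
  This only matters for the trivial group, which has the generating set consisting of the identity.\<close>

definition fin_sym_gen_set :: "('a, 'm) monoid_scheme \<Rightarrow> 'a set \<Rightarrow> bool" where
  "fin_sym_gen_set G S \<longleftrightarrow>
     finite S \<and> S \<noteq> {} \<and> S \<subseteq> carrier G \<and> (\<forall>s\<in>S. inv\<^bsub>G\<^esub> s \<in> S) \<and> generate G S = carrier G"

text \<open>Words use letters of \<open>S\<close> only, since \<open>S\<close> will be symmetric.\<close>

definition word_length :: "('a, 'm) monoid_scheme \<Rightarrow> 'a set \<Rightarrow> 'a \<Rightarrow> nat" where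
  "word_length G S g =
     (LEAST n. \<exists>ws. set ws \<subseteq> S \<and> length ws = n \<and> foldr (\<lambda>x y. x \<otimes>\<^bsub>G\<^esub> y) ws \<one>\<^bsub>G\<^esub> = g)"

text \<open>The graph distance of the Cayley graph in which \<open>x\<close> is joined to \<open>x \<otimes> s\<close> for \<open>s \<in> S\<close>.\<close>

definition cayley_dist :: "('a, 'm) monoid_scheme \<Rightarrow> 'a set \<Rightarrow> 'a \<Rightarrow> 'a \<Rightarrow> nat" where
  "cayley_dist G S x y = word_length G S (inv\<^bsub>G\<^esub> y \<otimes>\<^bsub>G\<^esub> x)"

definition quasi_isometric ::
  "'a set \<Rightarrow> ('a \<Rightarrow> 'a \<Rightarrow> real) \<Rightarrow> 'b set \<Rightarrow> ('b \<Rightarrow> 'b \<Rightarrow> real) \<Rightarrow> bool" where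
  "quasi_isometric V dV W dW \<longleftrightarrow>
     (\<exists>q A B. q \<in> V \<rightarrow> W \<and> A \<ge> 1 \<and> B \<ge> 0 \<and>
        (\<forall>x\<in>V. \<forall>x'\<in>V. dV x x' / A - B \<le> dW (q x) (q x') \<and> dW (q x) (q x') \<le> A * dV x x' + B) \<and>
        (\<forall>y\<in>W. \<exists>x\<in>V. dW (q x) y \<le> B))"

definition cayley_quasi_isometric ::
  "('a, 'm) monoid_scheme \<Rightarrow> 'a set \<Rightarrow> ('b, 'n) monoid_scheme \<Rightarrow> 'b set \<Rightarrow> bool" where
  "cayley_quasi_isometric G S H T \<longleftrightarrow>
     quasi_isometric (carrier G) (\<lambda>x y. real (cayley_dist G S x y))
                     (carrier H) (\<lambda>x y. real (cayley_dist H T x y))"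

definition harmonic_on_cayley :: "('a, 'm) monoid_scheme \<Rightarrow> 'a set \<Rightarrow> ('a \<Rightarrow> real) \<Rightarrow> bool" where
  "harmonic_on_cayley G S h \<longleftrightarrow> (\<forall>x\<in>carrier G. h x = (\<Sum>s\<in>S. h (x \<otimes>\<^bsub>G\<^esub> s)) / real (card S))"

definition liouville :: "('a, 'm) monoid_scheme \<Rightarrow> 'a set \<Rightarrow> bool" where
  "liouville G S \<longleftrightarrow>
     (\<forall>h. harmonic_on_cayley G S h \<and> bounded (h ` carrier G) \<longrightarrow> h constant_on carrier G)"


section \<open>The lazy simple random walk\<close>

definition lazy_step :: "('a, 'm) monoid_scheme \<Rightarrow> 'a set \<Rightarrow> 'a pmf" where
  "lazy_step G S =
     bernoulli_pmf (1/2) \<bind> (\<lambda>stay. if stay then return_pmf \<one>\<^bsub>G\<^esub> else pmf_of_set S)"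

lemma pmf_lazy_step:
  assumes "finite S" "S \<noteq> {}"
  shows "pmf (lazy_step G S) g = (indicator {\<one>\<^bsub>G\<^esub>} g + indicator S g / real (card S)) / 2"
  using assms by (simp add: lazy_step_def pmf_bind pmf_return indicator_def)

definition convolution :: "('a, 'm) monoid_scheme \<Rightarrow> 'a pmf \<Rightarrow> 'a pmf \<Rightarrow> 'a pmf" where
  "convolution G p q = map_pmf (\<lambda>(x, y). x \<otimes>\<^bsub>G\<^esub> y) (pair_pmf p q)"

primrec convolution_power :: "('a, 'm) monoid_scheme \<Rightarrow> 'a pmf \<Rightarrow> nat \<Rightarrow> 'a pmf" where
  "convolution_power G p 0 = return_pmf \<one>\<^bsub>G\<^esub>"
| "convolution_power G p (Suc n) = convolution G (convolution_power G p n) p"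

definition lazy_walk :: "('a, 'm) monoid_scheme \<Rightarrow> 'a set \<Rightarrow> nat \<Rightarrow> 'a pmf" where
  "lazy_walk G S n = convolution_power G (lazy_step G S) n"

text \<open>Suprema of sets of exponents are taken in \<open>[0,1]\<close>, so that the empty set has supremum 0.\<close>

definition exponent_Sup :: "real set \<Rightarrow> real" where
  "exponent_Sup A = Sup (insert 0 A)"

definition speed_exponent :: "('a, 'm) monoid_scheme \<Rightarrow> 'a set \<Rightarrow> real" where
  "speed_exponent G S = exponent_Sup {c \<in> {0..1}. \<exists>K>0. \<forall>n\<ge>1.
     measure_pmf.expectation (lazy_walk G S n) (\<lambda>g. real (word_length G S g)) \<ge> K * real n powr c}"


section \<open>Hilbert spaces with explicit carriers\<close>

text \<open>The exponent below is a supremum over Hilbert spaces, so these are structures rather than types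
  of class \<^class>\<open>real_inner\<close>. As always with \<open>module\<close>, the fields \<open>mult\<close> and \<open>one\<close> inherited from
  \<open>ring\<close> play no role.\<close>

record 'b inner_module = "(real, 'b) module" +
  inner_prod :: "'b \<Rightarrow> 'b \<Rightarrow> real"

definition vdist :: "'b inner_module \<Rightarrow> 'b \<Rightarrow> 'b \<Rightarrow> real" where
  "vdist B x y = sqrt (inner_prod B (x \<ominus>\<^bsub>B\<^esub> y) (x \<ominus>\<^bsub>B\<^esub> y))"

definition hilbert_space :: "'b inner_module \<Rightarrow> bool" where
  "hilbert_space B \<longleftrightarrow>
     Module.module (ring_of_type_algebra :: real ring) B \<and>
     (\<forall>x\<in>carrier B. \<forall>y\<in>carrier B. inner_prod B x y = inner_prod B y x) \<and>
     (\<forall>x\<in>carrier B. \<forall>y\<in>carrier B. \<forall>z\<in>carrier B.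
        inner_prod B (x \<oplus>\<^bsub>B\<^esub> y) z = inner_prod B x z + inner_prod B y z) \<and>
     (\<forall>r. \<forall>x\<in>carrier B. \<forall>y\<in>carrier B. inner_prod B (r \<odot>\<^bsub>B\<^esub> x) y = r * inner_prod B x y) \<and>
     (\<forall>x\<in>carrier B. inner_prod B x x \<ge> 0) \<and>
     (\<forall>x\<in>carrier B. inner_prod B x x = 0 \<longrightarrow> x = \<zero>\<^bsub>B\<^esub>) \<and>
     Metric_space.mcomplete (carrier B) (vdist B)"

definition affine_isometries :: "'b inner_module \<Rightarrow> ('b \<Rightarrow> 'b) set" where
  "affine_isometries B =
     {T \<in> Bij (carrier B).
        (\<forall>x\<in>carrier B. \<forall>y\<in>carrier B. vdist B (T x) (T y) = vdist B x y) \<and>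
        (\<forall>r. \<forall>x\<in>carrier B. \<forall>y\<in>carrier B.
           T ((1 - r) \<odot>\<^bsub>B\<^esub> x \<oplus>\<^bsub>B\<^esub> r \<odot>\<^bsub>B\<^esub> y) = (1 - r) \<odot>\<^bsub>B\<^esub> T x \<oplus>\<^bsub>B\<^esub> r \<odot>\<^bsub>B\<^esub> T y)}"

definition IsomGroup :: "'b inner_module \<Rightarrow> ('b \<Rightarrow> 'b) monoid" where
  "IsomGroup B = BijGroup (carrier B) \<lparr>carrier := affine_isometries B\<rparr>"


section \<open>The equivariant compression exponent\<close>

definition compression_function ::
  "('a, 'm) monoid_scheme \<Rightarrow> 'a set \<Rightarrow> 'b inner_module \<Rightarrow> ('a \<Rightarrow> 'b) \<Rightarrow> (real \<Rightarrow> real) \<Rightarrow> bool" where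
  "compression_function G S B f \<rho> \<longleftrightarrow>
     \<rho> \<in> {0..} \<rightarrow> {0..} \<and> mono_on {0..} \<rho> \<and> \<not> bdd_above (\<rho> ` {0..}) \<and>
     (\<exists>C>0. \<forall>x\<in>carrier G. \<forall>y\<in>carrier G.
        \<rho> (real (word_length G S (inv\<^bsub>G\<^esub> y \<otimes>\<^bsub>G\<^esub> x))) \<le> vdist B (f x) (f y) \<and>
        vdist B (f x) (f y) \<le> C * real (word_length G S (inv\<^bsub>G\<^esub> y \<otimes>\<^bsub>G\<^esub> x)) + C)"

definition equivariant_uniform_embedding ::
  "('a, 'm) monoid_scheme \<Rightarrow> 'a set \<Rightarrow> 'b inner_module \<Rightarrow> ('a \<Rightarrow> 'b \<Rightarrow> 'b) \<Rightarrow> ('a \<Rightarrow> 'b) \<Rightarrow> bool" where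
  "equivariant_uniform_embedding G S B \<pi> f \<longleftrightarrow>
     f \<in> carrier G \<rightarrow> carrier B \<and>
     (\<forall>\<gamma>\<in>carrier G. \<forall>x\<in>carrier G. f (\<gamma> \<otimes>\<^bsub>G\<^esub> x) = \<pi> \<gamma> (f x)) \<and>
     (\<exists>\<rho>. compression_function G S B f \<rho>)"

definition compression_exponent ::
  "('a, 'm) monoid_scheme \<Rightarrow> 'a set \<Rightarrow> 'b inner_module \<Rightarrow> ('a \<Rightarrow> 'b) \<Rightarrow> real" where
  "compression_exponent G S B f = exponent_Sup {c \<in> {0..1}. \<exists>K>0. \<exists>\<rho>.
     compression_function G S B f \<rho> \<and> (\<forall>n::nat. n \<ge> 1 \<longrightarrow> \<rho> (real n) \<ge> K * real n powr c)}"

text \<open>HOL cannot quantify over types inside a formula, so the Hilbert spaces range over all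
  those whose carrier is a set of elements of the type \<open>nat \<Rightarrow> real\<close>, that is, up to
  isomorphism, over all Hilbert spaces of cardinality at most the continuum. For the countable
  groups \<open>G\<close> considered here no other Hilbert space contributes to the supremum: the
  set \<open>f ` carrier G\<close> is countable and \<open>\<pi>\<close>-invariant, so its closed affine hull \<open>A\<close> is
  separable and \<open>\<pi>\<close>-invariant, and taking the point \<open>f \<one>\<close> as origin turns \<open>A\<close> into a Hilbert
  space of cardinality at most the continuum on which \<open>G\<close> acts by affine isometries and in which
  the distances between the points \<open>f x\<close> are unchanged.\<close>

definition equivariant_compression_exponent :: "('a, 'm) monoid_scheme \<Rightarrow> 'a set \<Rightarrow> real" where
  "equivariant_compression_exponent G S = exponent_Sup {compression_exponent G S B f
     | (B :: (nat \<Rightarrow> real) inner_module) \<pi> f.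
       hilbert_space B \<and> \<pi> \<in> hom G (IsomGroup B) \<and> equivariant_uniform_embedding G S B \<pi> f}"

end

theory Submission
  imports Defs
begin

text \<open>The proof turns the two hypotheses on heat kernels into one statement about unit vectors, and
  derives all three conclusions from it.

  Let \<open>P\<close> be the walk operator on the square-summable functions on a set on which the group acts.
  It is self-adjoint and, by laziness, positive, so the numbers \<open>\<parallel>P\<^sup>n u\<parallel>\<^sup>2\<close> form a log-convex
  sequence. For the point mass at the identity they are return probabilities, and a lower bound
  \<open>exp (- L n\<^sup>\<gamma>)\<close> for these forces the ratio of consecutive terms above \<open>1 - C n\<^sup>\<gamma>\<^sup>-\<^sup>1\<close>: translating
  the heat kernel \<open>\<phi>\<close> at time \<open>n\<close> by a generator changes it by a proportion \<open>C n\<^sup>(\<^sup>\<gamma>\<^sup>-\<^sup>1\<^sup>)\<^sup>/\<^sup>2\<close> of its norm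
  only (\<open>energy_lazy_walk_le\<close>). Log-convexity, read in the other direction, carries the lower bound
  over from \<open>S\<^sub>1\<close> to \<open>S\<^sub>2\<close> (\<open>return_probability_comparison\<close>). The Gaussian bound for \<open>S\<^sub>2\<close> says that \<open>\<phi>\<close>
  is far from its translate by \<open>y\<close> as soon as \<open>|y|\<close> exceeds a multiple of \<open>n\<^sup>1\<^sup>/\<^sup>2\<close>
  (\<open>gaussian_half\<close>).

  A quasi-isometry \<open>q\<close> from \<open>G'\<close> to \<open>G\<close> is not a homomorphism, so \<open>\<phi> \<circ> q\<close> alone does not inherit the second
  property. Instead, take the function \<open>(h, z) \<mapsto> \<phi> (q h) \<phi> (z q h)\<close> on \<open>G' \<times> G\<close> and let \<open>G'\<close> act on the first
  coordinate. The inner product of this function with its translate by \<open>g\<close> is a weighted average over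
  \<open>h\<close> of the inner products of \<open>\<phi>\<close> with its translates by \<open>(q h)\<^sup>-\<^sup>1 q (h g)\<close>, and these elements have
  length comparable to \<open>|g|\<close>. Hence for every scale \<open>R\<close> there is a unit vector which \<open>g\<close> moves by at
  most \<open>C |g| R\<^sup>\<gamma>\<^sup>-\<^sup>1\<close>, and by at least \<open>1\<close> if \<open>|g| \<ge> R\<close> (\<open>disperses_product\<close>).

  For \<open>c < 1 - \<gamma>\<close>, superposing these vectors for \<open>R = 2\<^sup>k\<close> with weights \<open>2\<^sup>c\<^sup>k\<close> gives a function \<open>F\<close>, not
  itself square-summable, which differs from its translate by \<open>g\<close> by a square-summable function of
  norm between multiples of \<open>|g|\<^sup>c\<close> and of \<open>|g|\<close>. The group acts by the affine isometries
  \<open>v \<mapsto> F + g (v - F)\<close>, and the orbit of \<open>0\<close> is the embedding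
  (\<open>equivariant_compression_exponent_ge_of_disperses\<close>). Log-convexity also shows that at time \<open>2 n\<close>
  the mean square displacement of each of the vectors is at most a multiple of \<open>n\<close> times that of
  one step; summing over the scales, the expectation of \<open>|X\<^sub>2\<^sub>n|\<^sup>2\<^sup>c\<close> is at most linear in \<open>n\<close>, which bounds the
  speed (\<open>expectation_word_length_le\<close>). Finally, sublinear speed makes the entropy of the walk
  sublinear, so that some of its increments are arbitrarily small; an increment bounds the distance between
  the law of the walk and its translates by a first step, and thereby the differences \<open>h (x s) - h x\<close>
  of a bounded harmonic function (\<open>liouville_of_sublinear_speed\<close>).\<close>

section \<open>Square-summable functions on a set\<close>

definition square_summable :: "'x set \<Rightarrow> ('x \<Rightarrow> real) \<Rightarrow> bool" where
  "square_summable A u \<longleftrightarrow> (\<lambda>x. (u x)\<^sup>2) summable_on A"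

definition inner_on :: "'x set \<Rightarrow> ('x \<Rightarrow> real) \<Rightarrow> ('x \<Rightarrow> real) \<Rightarrow> real" where
  "inner_on A u v = (\<Sum>\<^sub>\<infinity>x\<in>A. u x * v x)"

definition norm_sq :: "'x set \<Rightarrow> ('x \<Rightarrow> real) \<Rightarrow> real" where
  "norm_sq A u = inner_on A u u"

lemma norm_sq_eq: "norm_sq A u = (\<Sum>\<^sub>\<infinity>x\<in>A. (u x)\<^sup>2)"
  by (simp add: norm_sq_def inner_on_def power2_eq_square)

lemma inner_on_cong:
  "(\<And>x. x \<in> A \<Longrightarrow> u x = u' x) \<Longrightarrow> (\<And>x. x \<in> A \<Longrightarrow> v x = v' x) \<Longrightarrow> inner_on A u v = inner_on A u' v'"
  unfolding inner_on_def by (rule infsum_cong) simp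

lemma norm_sq_cong: "(\<And>x. x \<in> A \<Longrightarrow> u x = v x) \<Longrightarrow> norm_sq A u = norm_sq A v"
  unfolding norm_sq_def by (rule inner_on_cong)

lemma summable_on_mult:
  assumes "square_summable A u" "square_summable A v"
  shows "(\<lambda>x. u x * v x) summable_on A"
proof -
  have "(\<lambda>x. (u x)\<^sup>2 + (v x)\<^sup>2) summable_on A"
    using assms unfolding square_summable_def by (rule summable_on_add)
  moreover have "\<bar>u x * v x\<bar> \<le> (u x)\<^sup>2 + (v x)\<^sup>2" for x
  proof -
    have "2 * (\<bar>u x\<bar> * \<bar>v x\<bar>) \<le> \<bar>u x\<bar>\<^sup>2 + \<bar>v x\<bar>\<^sup>2"
      using sum_squares_bound[of "\<bar>u x\<bar>" "\<bar>v x\<bar>"] by simp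
    then have "2 * \<bar>u x * v x\<bar> \<le> (u x)\<^sup>2 + (v x)\<^sup>2" by (simp add: abs_mult)
    moreover have "0 \<le> \<bar>u x * v x\<bar>" by (rule abs_ge_zero)
    ultimately show ?thesis by linarith
  qed
  ultimately have "(\<lambda>x. norm (u x * v x)) summable_on A"
    by (intro summable_on_comparison_test[where g = "\<lambda>x. norm (u x * v x)" and f = "\<lambda>x. (u x)\<^sup>2 + (v x)\<^sup>2"]) auto
  then show ?thesis by (rule abs_summable_summable)
qed

lemma square_summable_0 [simp]: "square_summable A (\<lambda>x. 0)"
  by (simp add: square_summable_def)

lemma square_summable_cmult:
  "square_summable A u \<Longrightarrow> square_summable A (\<lambda>x. c * u x)"
  unfolding square_summable_def power_mult_distrib by (rule summable_on_cmult_right)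

lemma square_summable_add:
  assumes "square_summable A u" "square_summable A v"
  shows "square_summable A (\<lambda>x. u x + v x)"
proof -
  have "(\<lambda>x. (u x)\<^sup>2 + (v x)\<^sup>2 + 2 * (u x * v x)) summable_on A"
    using assms summable_on_mult[OF assms] unfolding square_summable_def
    by (intro summable_on_add summable_on_cmult_right)
  then show ?thesis by (simp add: square_summable_def power2_sum mult.assoc)
qed

lemma square_summable_diff:
  assumes "square_summable A u" "square_summable A v"
  shows "square_summable A (\<lambda>x. u x - v x)"
  using square_summable_add[OF assms(1) square_summable_cmult[OF assms(2), of "-1"]] by simp

lemma square_summable_sum:
  assumes "\<And>i. i \<in> I \<Longrightarrow> square_summable A (u i)"
  shows "square_summable A (\<lambda>x. \<Sum>i\<in>I. u i x)"
  using assms by (induction I rule: infinite_finite_induct) (auto intro: square_summable_add)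

lemma square_summable_finite_support:
  assumes "finite {x \<in> A. u x \<noteq> 0}"
  shows "square_summable A u"
proof -
  have "(\<lambda>x. (u x)\<^sup>2) summable_on {x \<in> A. u x \<noteq> 0}" using assms by simp
  then show ?thesis unfolding square_summable_def
    by (subst summable_on_cong_neutral[where T = "{x \<in> A. u x \<noteq> 0}"]) auto
qed

lemma inner_on_commute: "inner_on A u v = inner_on A v u"
  by (simp add: inner_on_def mult.commute)

lemma square_summable_point: "square_summable A (indicator {x} :: _ \<Rightarrow> real)"
  by (rule square_summable_finite_support, rule finite_subset[of _ "{x}"]) (auto simp: indicator_def)

lemma inner_on_point: "x \<in> A \<Longrightarrow> inner_on A (indicator {x}) u = u x"
  unfolding inner_on_def
  by (subst infsum_cong_neutral[where T = "{x}" and g = u]) (auto simp: indicator_def)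

lemma inner_on_add_left:
  assumes "square_summable A u" "square_summable A v" "square_summable A w"
  shows "inner_on A (\<lambda>x. u x + v x) w = inner_on A u w + inner_on A v w"
  unfolding inner_on_def distrib_right
  by (intro infsum_add summable_on_mult assms)

lemma inner_on_cmult_left: "inner_on A (\<lambda>x. c * u x) w = c * inner_on A u w"
  unfolding inner_on_def mult.assoc by (rule infsum_cmult_right')

lemma inner_on_sum_left:
  assumes "finite I" "\<And>i. i \<in> I \<Longrightarrow> square_summable A (u i)" "square_summable A w"
  shows "inner_on A (\<lambda>x. \<Sum>i\<in>I. u i x) w = (\<Sum>i\<in>I. inner_on A (u i) w)"
  using assms
proof (induction I rule: finite_induct)
  case empty
  then show ?case by (simp add: inner_on_def)
next
  case (insert i I)
  have "inner_on A (\<lambda>x. u i x + (\<Sum>j\<in>I. u j x)) w = inner_on A (u i) w + inner_on A (\<lambda>x. \<Sum>j\<in>I. u j x) w"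
    using insert by (intro inner_on_add_left square_summable_sum) auto
  then show ?case using insert by simp
qed

lemma norm_sq_nonneg [simp]: "0 \<le> norm_sq A u"
  unfolding norm_sq_eq by (rule infsum_nonneg) simp

lemma norm_sq_cmult: "norm_sq A (\<lambda>x. c * u x) = c\<^sup>2 * norm_sq A u"
  unfolding norm_sq_eq power_mult_distrib by (rule infsum_cmult_right')

lemma norm_sq_minus_commute: "norm_sq A (\<lambda>x. u x - v x) = norm_sq A (\<lambda>x. v x - u x)"
  unfolding norm_sq_eq by (simp add: power2_commute)

lemma norm_sq_add:
  assumes "square_summable A u" "square_summable A v"
  shows "norm_sq A (\<lambda>x. u x + v x) = norm_sq A u + 2 * inner_on A u v + norm_sq A v"
proof -
  have "square_summable A (\<lambda>x. u x + v x)" using assms by (rule square_summable_add)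
  then have "norm_sq A (\<lambda>x. u x + v x) =
      inner_on A u (\<lambda>x. u x + v x) + inner_on A v (\<lambda>x. u x + v x)"
    unfolding norm_sq_def using assms by (intro inner_on_add_left)
  also have "\<dots> = norm_sq A u + 2 * inner_on A u v + norm_sq A v"
    using assms
    by (simp add: inner_on_commute[of A _ "\<lambda>x. u x + v x"] inner_on_add_left norm_sq_def
        inner_on_commute[of A v u])
  finally show ?thesis .
qed

lemma norm_sq_diff:
  assumes "square_summable A u" "square_summable A v"
  shows "norm_sq A (\<lambda>x. u x - v x) = norm_sq A u - 2 * inner_on A u v + norm_sq A v"
  using norm_sq_add[OF assms(1) square_summable_cmult[OF assms(2), of "-1"]]
    norm_sq_cmult[of A "-1" v] inner_on_cmult_left[of A "-1" v u]
  by (simp add: inner_on_commute[of A u])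

lemma square_le_norm_sq:
  assumes "square_summable A u" "x \<in> A"
  shows "(u x)\<^sup>2 \<le> norm_sq A u"
  using finite_sum_le_infsum[of "\<lambda>x. (u x)\<^sup>2" A "{x}"] assms
  by (simp add: norm_sq_eq square_summable_def)

lemma Cauchy_Schwarz_inner_on:
  assumes "square_summable A u" "square_summable A v"
  shows "(inner_on A u v)\<^sup>2 \<le> norm_sq A u * norm_sq A v"
proof (cases "norm_sq A v = 0")
  case True
  have "v x = 0" if "x \<in> A" for x
    using square_le_norm_sq[OF assms(2) that] True by simp
  then have "inner_on A u v = 0" unfolding inner_on_def by (intro infsum_0) simp
  then show ?thesis by simp
next
  case False
  then have pos: "norm_sq A v > 0" using norm_sq_nonneg[of A v] by linarith
  define a b where "a = norm_sq A v" and "b = inner_on A u v"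
  have "0 \<le> norm_sq A (\<lambda>x. a * u x - b * v x)" by simp
  also have "\<dots> = a\<^sup>2 * norm_sq A u - 2 * (a * b * b) + b\<^sup>2 * a"
  proof -
    have "inner_on A (\<lambda>x. a * u x) (\<lambda>x. b * v x) = a * (b * b)"
      unfolding inner_on_cmult_left inner_on_commute[of A u "\<lambda>x. b * v x"]
      by (simp only: inner_on_commute[of A v u] b_def)
    then show ?thesis
      using assms by (simp add: norm_sq_diff square_summable_cmult norm_sq_cmult a_def)
  qed
  also have "\<dots> = a * (norm_sq A u * a - b\<^sup>2)"
    by (simp add: power2_eq_square algebra_simps)
  finally have "0 \<le> a * (norm_sq A u * a - b\<^sup>2)" .
  with pos show ?thesis by (simp add: zero_le_mult_iff a_def b_def)
qed

lemma norm_triangle_on: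
  assumes "square_summable A u" "square_summable A v"
  shows "sqrt (norm_sq A (\<lambda>x. u x + v x)) \<le> sqrt (norm_sq A u) + sqrt (norm_sq A v)"
proof (rule real_le_lsqrt)
  have "inner_on A u v \<le> sqrt (norm_sq A u * norm_sq A v)"
    using Cauchy_Schwarz_inner_on[OF assms] by (rule real_le_rsqrt)
  then show "norm_sq A (\<lambda>x. u x + v x) \<le> (sqrt (norm_sq A u) + sqrt (norm_sq A v))\<^sup>2"
    using assms by (simp add: norm_sq_add power2_sum real_sqrt_mult)
qed auto

lemma norm_sq_add_le:
  assumes "square_summable A u" "square_summable A v"
  shows "norm_sq A (\<lambda>x. u x + v x) \<le> 2 * norm_sq A u + 2 * norm_sq A v"
  using norm_sq_nonneg[of A "\<lambda>x. u x - v x"] assms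
  by (simp add: norm_sq_diff norm_sq_add)

lemma norm_sq_mono:
  assumes "square_summable A v" "\<And>x. x \<in> A \<Longrightarrow> \<bar>u x\<bar> \<le> \<bar>v x\<bar>"
  shows "square_summable A u" and "norm_sq A u \<le> norm_sq A v"
proof -
  have le: "(u x)\<^sup>2 \<le> (v x)\<^sup>2" if "x \<in> A" for x
    using assms(2)[OF that] by (simp add: abs_le_square_iff)
  show "square_summable A u"
    using assms(1) le unfolding square_summable_def
    by (rule summable_on_comparison_test) auto
  then show "norm_sq A u \<le> norm_sq A v"
    using assms(1) le unfolding norm_sq_eq square_summable_def by (intro infsum_mono)
qed

text \<open>For \<open>v = \<Sum>i. c i w i\<close> one has \<open>\<parallel>v\<parallel>\<^sup>2 = \<Sum>i. c i \<langle>w i, v\<rangle>\<close>, and Cauchy-Schwarz bounds every inner product on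
  the right by \<open>b\<^sup>1\<^sup>/\<^sup>2 \<parallel>v\<parallel>\<close>.\<close>

lemma norm_sq_convex_combination:
  assumes fin: "finite I" and c: "\<And>i. i \<in> I \<Longrightarrow> 0 \<le> c i" "(\<Sum>i\<in>I. c i) = 1"
    and w: "\<And>i. i \<in> I \<Longrightarrow> square_summable A (w i)" "\<And>i. i \<in> I \<Longrightarrow> norm_sq A (w i) \<le> b"
  shows "norm_sq A (\<lambda>x. \<Sum>i\<in>I. c i * w i x) \<le> b"
proof -
  define v where "v = (\<lambda>x. \<Sum>i\<in>I. c i * w i x)"
  have v: "square_summable A v"
    unfolding v_def by (intro square_summable_sum square_summable_cmult w)
  have "norm_sq A v = (\<Sum>i\<in>I. inner_on A (\<lambda>x. c i * w i x) v)"
    unfolding norm_sq_def by (subst (1) v_def, rule inner_on_sum_left[OF fin _ v])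
      (intro square_summable_cmult w)
  also have "\<dots> = (\<Sum>i\<in>I. c i * inner_on A (w i) v)"
    by (simp only: inner_on_cmult_left)
  also have "\<dots> \<le> (\<Sum>i\<in>I. c i * (sqrt b * sqrt (norm_sq A v)))"
  proof (intro sum_mono mult_left_mono c)
    fix i assume i: "i \<in> I"
    have "(inner_on A (w i) v)\<^sup>2 \<le> norm_sq A (w i) * norm_sq A v"
      by (rule Cauchy_Schwarz_inner_on[OF w(1)[OF i] v])
    also have "\<dots> \<le> b * norm_sq A v" using w(2)[OF i] by (intro mult_right_mono) auto
    finally show "inner_on A (w i) v \<le> sqrt b * sqrt (norm_sq A v)"
      by (simp add: real_le_rsqrt flip: real_sqrt_mult)
  qed
  also have "\<dots> = sqrt b * sqrt (norm_sq A v)" using c(2) by (simp flip: sum_distrib_right)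
  finally have *: "norm_sq A v \<le> sqrt b * sqrt (norm_sq A v)" .
  show ?thesis
  proof (cases "norm_sq A v = 0")
    case True
    obtain i where "i \<in> I" using c(2) by fastforce
    from order_trans[OF norm_sq_nonneg w(2)[OF this]] True show ?thesis by (simp add: v_def)
  next
    case False
    then have pos: "norm_sq A v > 0" using norm_sq_nonneg[of A v] by linarith
    have "sqrt (norm_sq A v) * sqrt (norm_sq A v) \<le> sqrt b * sqrt (norm_sq A v)"
      using * pos by simp
    then have "sqrt (norm_sq A v) \<le> sqrt b"
      by (rule mult_right_le_imp_le) (use pos in simp)
    then show ?thesis by (simp add: v_def)
  qed
qed

section \<open>Log-convex sequences\<close>

lemma log_convex_ratio_mono:
  fixes c :: "nat \<Rightarrow> real"
  assumes pos: "\<And>k. c k > 0" and lc: "\<And>k. (c (Suc k))\<^sup>2 \<le> c k * c (Suc (Suc k))"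
  shows "mono (\<lambda>k. c (Suc k) / c k)"
  by (rule monoI, rule lift_Suc_mono_le[of "\<lambda>k. c (Suc k) / c k"])
     (use pos lc in \<open>auto simp: divide_simps power2_eq_square mult.commute\<close>)

lemma log_convex_ge_geometric:
  fixes c :: "nat \<Rightarrow> real"
  assumes pos: "\<And>k. c k > 0" and lc: "\<And>k. (c (Suc k))\<^sup>2 \<le> c k * c (Suc (Suc k))"
  shows "c 0 * (c 1 / c 0) ^ k \<le> c k"
proof (induction k)
  case (Suc k)
  have "c 0 * (c 1 / c 0) ^ Suc k = (c 0 * (c 1 / c 0) ^ k) * (c 1 / c 0)" by simp
  also have "\<dots> \<le> c k * (c (Suc k) / c k)"
  proof (rule mult_mono[OF Suc])
    show "c 1 / c 0 \<le> c (Suc k) / c k"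
      using monoD[OF log_convex_ratio_mono[of c, OF pos lc], of 0 k] by simp
  qed (use pos in \<open>auto intro!: divide_nonneg_nonneg mult_nonneg_nonneg zero_le_power intro: less_imp_le\<close>)
  also have "\<dots> = c (Suc k)" using pos[of k] by simp
  finally show ?case .
qed (use pos in simp)

text \<open>The last ratio \<open>r\<close> is at least the geometric mean \<open>(c k / c 0)\<^sup>1\<^sup>/\<^sup>k\<close> of all earlier ones, and
  \<open>1 - r \<le> - ln r\<close>.\<close>

lemma log_convex_decrement:
  fixes c :: "nat \<Rightarrow> real"
  assumes pos: "\<And>k. c k > 0" and lc: "\<And>k. (c (Suc k))\<^sup>2 \<le> c k * c (Suc (Suc k))" and "k \<ge> 1"
  shows "c k - c (Suc k) \<le> c k * (ln (c 0 / c k) / k)"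
proof -
  define r where "r = c (Suc k) / c k"
  have r: "r > 0" using pos by (simp add: r_def)
  have "c j \<le> c 0 * r ^ j" if "j \<le> k" for j
    using that
  proof (induction j)
    case (Suc j)
    have "c (Suc j) = c j * (c (Suc j) / c j)" using pos[of j] by simp
    also have "\<dots> \<le> (c 0 * r ^ j) * r"
    proof (rule mult_mono)
      show "c (Suc j) / c j \<le> r"
        using monoD[OF log_convex_ratio_mono[of c, OF pos lc], of j k] Suc.prems by (simp add: r_def)
    qed (use Suc pos[of "Suc j"] pos[of j] pos[of 0] r in auto)
    finally show ?case by (simp only: power_Suc2 mult.assoc)
  qed simp
  from this[of k] have "c k / c 0 \<le> r ^ k" using pos[of 0] by (simp add: field_simps)
  then have "ln (c k / c 0) \<le> ln (r ^ k)" using pos r by (subst ln_le_cancel_iff) auto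
  then have "ln (c k / c 0) \<le> k * ln r" using r by (simp add: ln_realpow)
  moreover have "ln r \<le> r - 1" using r by (rule ln_le_minus_one)
  ultimately have "ln (c k / c 0) / k \<le> r - 1"
    using \<open>k \<ge> 1\<close> by (auto simp: divide_le_eq mult.commute intro: order_trans mult_left_mono)
  then have "1 - r \<le> ln (c 0 / c k) / k" using pos[of k] pos[of 0] by (simp add: ln_div diff_divide_distrib)
  then have "c k * (1 - r) \<le> c k * (ln (c 0 / c k) / k)"
    using less_imp_le[OF pos[of k]] by (rule mult_left_mono)
  then show ?thesis using pos[of k] by (simp add: r_def algebra_simps)
qed

section \<open>Words in the generators\<close>

locale generated_group = group G for G (structure) +
  fixes S :: "'a set"
  assumes generators: "fin_sym_gen_set G S"
begin

abbreviation word_value :: "'a list \<Rightarrow> 'a" where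
  "word_value ws \<equiv> foldr (\<lambda>x y. x \<otimes> y) ws \<one>"

abbreviation heat :: "nat \<Rightarrow> 'a \<Rightarrow> real" where
  "heat n \<equiv> pmf (lazy_walk G S n)"

abbreviation mean :: "nat \<Rightarrow> ('a \<Rightarrow> real) \<Rightarrow> real" where
  "mean n f \<equiv> measure_pmf.expectation (lazy_walk G S n) f"

lemma finite_generators: "finite S"
  and generators_nonempty: "S \<noteq> {}"
  and generators_closed: "s \<in> S \<Longrightarrow> s \<in> carrier G"
  and generators_inv: "s \<in> S \<Longrightarrow> inv s \<in> S"
  and generate_generators: "generate G S = carrier G"
  using generators by (auto simp: fin_sym_gen_set_def)

lemma card_generators_pos: "0 < card S"
  using finite_generators generators_nonempty by (simp add: card_gt_0_iff)

lemma word_value_closed: "set ws \<subseteq> S \<Longrightarrow> word_value ws \<in> carrier G"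
  by (induction ws) (auto intro: generators_closed)

lemma word_value_append:
  "set vs \<subseteq> S \<Longrightarrow> set ws \<subseteq> S \<Longrightarrow> word_value (vs @ ws) = word_value vs \<otimes> word_value ws"
  by (induction vs) (auto simp: word_value_closed generators_closed m_assoc)

lemma ex_word:
  assumes "g \<in> carrier G"
  shows "\<exists>ws. set ws \<subseteq> S \<and> word_value ws = g"
proof -
  from assms have "g \<in> generate G S" by (simp add: generate_generators)
  then show ?thesis
  proof (induction g rule: generate.induct)
    case one
    then show ?case by (intro exI[of _ "[]"]) simp
  next
    case (incl h)
    then show ?case by (intro exI[of _ "[h]"]) (simp add: generators_closed)
  next
    case (inv h)
    then show ?case by (intro exI[of _ "[inv h]"]) (simp add: generators_closed generators_inv)
  next
    case (eng h1 h2)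
    then obtain vs ws where "set vs \<subseteq> S" "word_value vs = h1" "set ws \<subseteq> S" "word_value ws = h2"
      by auto
    then show ?case by (intro exI[of _ "vs @ ws"]) (use word_value_append in auto)
  qed
qed

lemma word_length_le: "set ws \<subseteq> S \<Longrightarrow> word_length G S (word_value ws) \<le> length ws"
  unfolding word_length_def by (rule Least_le) auto

lemma ex_geodesic_word:
  assumes "g \<in> carrier G"
  shows "\<exists>ws. set ws \<subseteq> S \<and> length ws = word_length G S g \<and> word_value ws = g"
  unfolding word_length_def by (rule LeastI_ex) (use ex_word[OF assms] in auto)

lemma word_length_one [simp]: "word_length G S \<one> = 0"
  using word_length_le[of "[]"] by simp

lemma word_length_pos:
  assumes "g \<in> carrier G" "g \<noteq> \<one>"
  shows "1 \<le> word_length G S g"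
  using ex_geodesic_word[OF assms(1)] assms(2) by (cases "word_length G S g") auto

lemma word_length_generator: "s \<in> S \<Longrightarrow> word_length G S s \<le> 1"
  using word_length_le[of "[s]"] by (simp add: generators_closed)

lemma word_length_mult:
  assumes "g \<in> carrier G" "h \<in> carrier G"
  shows "word_length G S (g \<otimes> h) \<le> word_length G S g + word_length G S h"
proof -
  obtain vs ws where "set vs \<subseteq> S" "length vs = word_length G S g" "word_value vs = g"
    "set ws \<subseteq> S" "length ws = word_length G S h" "word_value ws = h"
    using ex_geodesic_word assms by metis
  then show ?thesis using word_length_le[of "vs @ ws"] word_value_append[of vs ws] by simp
qed

text \<open>Many quantities below grow by a bounded amount when the group element is multiplied by
  a generator; such a quantity is Lipschitz for the word metric.\<close>

lemma bounded_by_word_length: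
  fixes f :: "'a \<Rightarrow> real"
  assumes "f \<one> \<le> 0" and step: "\<And>s g. s \<in> S \<Longrightarrow> g \<in> carrier G \<Longrightarrow> f (s \<otimes> g) \<le> M + f g"
    and "g \<in> carrier G"
  shows "f g \<le> M * word_length G S g"
proof -
  have "f (word_value ws) \<le> M * length ws" if "set ws \<subseteq> S" for ws
    using that
  proof (induction ws)
    case (Cons s ws)
    then have "f (s \<otimes> word_value ws) \<le> M + f (word_value ws)"
      by (intro step word_value_closed) auto
    with Cons show ?case by (simp add: algebra_simps)
  qed (use assms(1) in simp)
  then show ?thesis using ex_geodesic_word[OF assms(3)] by metis
qed

lemma word_length_inv_le:
  assumes "g \<in> carrier G"
  shows "word_length G S (inv g) \<le> word_length G S g"
proof -
  have "real (word_length G S (inv g)) \<le> 1 * real (word_length G S g)"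
  proof (rule bounded_by_word_length[OF _ _ assms])
    fix s g assume sg: "s \<in> S" "g \<in> carrier G"
    then have "word_length G S (inv (s \<otimes> g)) \<le> word_length G S (inv g) + word_length G S (inv s)"
      by (simp add: inv_mult_group generators_closed word_length_mult)
    moreover have "word_length G S (inv s) \<le> 1"
      using sg by (intro word_length_generator generators_inv)
    ultimately show "real (word_length G S (inv (s \<otimes> g))) \<le> 1 + real (word_length G S (inv g))"
      by linarith
  qed simp
  then show ?thesis by simp
qed

lemma word_length_inv: "g \<in> carrier G \<Longrightarrow> word_length G S (inv g) = word_length G S g"
  using word_length_inv_le[of g] word_length_inv_le[of "inv g"] by simp

lemma finite_word_ball: "finite {g \<in> carrier G. word_length G S g \<le> n}"
proof (rule finite_subset)
  show "{g \<in> carrier G. word_length G S g \<le> n} \<subseteq> word_value ` {ws. set ws \<subseteq> S \<and> length ws \<le> n}"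
    using ex_geodesic_word by (fastforce simp: image_iff)
  show "finite (word_value ` {ws. set ws \<subseteq> S \<and> length ws \<le> n})"
    by (intro finite_imageI finite_lists_length_le finite_generators)
qed

lemma card_word_sphere_le: "card {g \<in> carrier G. word_length G S g = n} \<le> card S ^ n"
proof -
  have "{g \<in> carrier G. word_length G S g = n} \<subseteq> word_value ` {ws. set ws \<subseteq> S \<and> length ws = n}"
    using ex_geodesic_word by (fastforce simp: image_iff)
  then have "card {g \<in> carrier G. word_length G S g = n} \<le> card {ws. set ws \<subseteq> S \<and> length ws = n}"
    by (rule surj_card_le[OF finite_lists_length_eq[OF finite_generators]])
  then show ?thesis by (simp add: card_lists_length_eq finite_generators)
qed

lemma countable_carrier: "countable (carrier G)"
proof -
  have "carrier G = (\<Union>n. {g \<in> carrier G. word_length G S g \<le> n})" by auto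
  then show ?thesis
    using countable_UN[of UNIV "\<lambda>n. {g \<in> carrier G. word_length G S g \<le> n}"]
      countable_finite[OF finite_word_ball] by simp
qed

end

text \<open>Every letter of \<open>S\<close> is a word in \<open>T\<close>.\<close>

lemma word_length_equivalent:
  assumes "generated_group G S" "generated_group G T"
  obtains C :: real where "C \<ge> 1"
    and "\<And>g. g \<in> carrier G \<Longrightarrow> real (word_length G T g) \<le> C * word_length G S g"
proof -
  interpret S: generated_group G S by fact
  interpret T: generated_group G T by fact
  define C where "C = (\<Sum>s\<in>S. real (word_length G T s)) + 1"
  show thesis
  proof (rule that)
    show "C \<ge> 1" by (simp add: C_def sum_nonneg)
    fix g assume g: "g \<in> carrier G"
    show "real (word_length G T g) \<le> C * word_length G S g"
    proof (rule S.bounded_by_word_length[OF _ _ g])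
      fix s g assume sg: "s \<in> S" "g \<in> carrier G"
      have "real (word_length G T s) \<le> (\<Sum>s\<in>S. real (word_length G T s))"
        using sg by (intro member_le_sum) (auto simp: S.finite_generators)
      moreover have "word_length G T (s \<otimes>\<^bsub>G\<^esub> g) \<le> word_length G T s + word_length G T g"
        using sg by (simp add: T.word_length_mult S.generators_closed)
      ultimately show "real (word_length G T (s \<otimes>\<^bsub>G\<^esub> g)) \<le> C + real (word_length G T g)"
        unfolding C_def by linarith
    qed simp
  qed
qed

section \<open>Translations and the lazy walk operator\<close>

text \<open>Throughout, a group acts from the right on a set \<open>A\<close>, and \<open>displacement A act u g\<close> is the squared distance
  from \<open>u\<close> to its translate by \<open>g\<close>. The energy is the Dirichlet form \<open>\<langle>u, u - P u\<rangle>\<close> of the walk operator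
  \<open>P\<close>, see \<open>inner_on_walk_op_self\<close> below.\<close>

definition displacement :: "'x set \<Rightarrow> ('x \<Rightarrow> 'a \<Rightarrow> 'x) \<Rightarrow> ('x \<Rightarrow> real) \<Rightarrow> 'a \<Rightarrow> real" where
  "displacement A act u g = norm_sq A (\<lambda>x. u x - u (act x g))"

definition walk_op :: "'a set \<Rightarrow> ('x \<Rightarrow> 'a \<Rightarrow> 'x) \<Rightarrow> ('x \<Rightarrow> real) \<Rightarrow> 'x \<Rightarrow> real" where
  "walk_op S act u x = u x / 2 + (\<Sum>s\<in>S. u (act x s)) / (2 * card S)"

definition energy :: "'x set \<Rightarrow> 'a set \<Rightarrow> ('x \<Rightarrow> 'a \<Rightarrow> 'x) \<Rightarrow> ('x \<Rightarrow> real) \<Rightarrow> real" where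
  "energy A S act u = (\<Sum>s\<in>S. displacement A act u s) / (4 * card S)"

lemma displacement_nonneg [simp]: "0 \<le> displacement A act u g"
  by (simp add: displacement_def)

lemma energy_nonneg [simp]: "0 \<le> energy A S act u"
  by (simp add: energy_def sum_nonneg)

locale right_action = group G for G (structure) +
  fixes A :: "'x set" and act :: "'x \<Rightarrow> 'a \<Rightarrow> 'x"
  assumes act_closed: "x \<in> A \<Longrightarrow> g \<in> carrier G \<Longrightarrow> act x g \<in> A"
    and act_one: "x \<in> A \<Longrightarrow> act x \<one> = x"
    and act_mult: "x \<in> A \<Longrightarrow> g \<in> carrier G \<Longrightarrow> h \<in> carrier G \<Longrightarrow> act x (g \<otimes> h) = act (act x g) h"
begin

lemma act_inv: "x \<in> A \<Longrightarrow> g \<in> carrier G \<Longrightarrow> act (act x g) (inv g) = x"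
  using act_mult[of x g "inv g"] by (simp add: act_one)

lemma act_inv': "x \<in> A \<Longrightarrow> g \<in> carrier G \<Longrightarrow> act (act x (inv g)) g = x"
  using act_mult[of x "inv g" g] by (simp add: act_one)

lemma bij_act: "g \<in> carrier G \<Longrightarrow> bij_betw (\<lambda>x. act x g) A A"
  by (rule bij_betw_byWitness[where f' = "\<lambda>x. act x (inv g)"])
     (auto simp: act_inv act_inv' act_closed)

lemma square_summable_translate:
  "g \<in> carrier G \<Longrightarrow> square_summable A u \<Longrightarrow> square_summable A (\<lambda>x. u (act x g))"
  unfolding square_summable_def
  using summable_on_reindex_bij_betw[OF bij_act, of g "\<lambda>x. (u x)\<^sup>2"] by simp

lemma inner_on_translate:
  "g \<in> carrier G \<Longrightarrow> inner_on A (\<lambda>x. u (act x g)) (\<lambda>x. v (act x g)) = inner_on A u v"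
  unfolding inner_on_def
  using infsum_reindex_bij_betw[OF bij_act, of g "\<lambda>x. u x * v x"] by simp

lemma norm_sq_translate: "g \<in> carrier G \<Longrightarrow> norm_sq A (\<lambda>x. u (act x g)) = norm_sq A u"
  unfolding norm_sq_def by (rule inner_on_translate)

lemma inner_on_translate_left:
  assumes "g \<in> carrier G"
  shows "inner_on A (\<lambda>x. u (act x g)) v = inner_on A u (\<lambda>x. v (act x (inv g)))"
proof -
  have "inner_on A (\<lambda>x. u (act x g)) v =
      inner_on A (\<lambda>x. u (act x g)) (\<lambda>x. (\<lambda>y. v (act y (inv g))) (act x g))"
    using assms by (intro inner_on_cong) (simp_all add: act_inv)
  also have "\<dots> = inner_on A u (\<lambda>x. v (act x (inv g)))"
    by (rule inner_on_translate[OF assms])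
  finally show ?thesis .
qed

lemma displacement_eq:
  assumes "g \<in> carrier G" "square_summable A u"
  shows "displacement A act u g = 2 * norm_sq A u - 2 * inner_on A u (\<lambda>x. u (act x g))"
  unfolding displacement_def using assms
  by (simp add: norm_sq_diff square_summable_translate norm_sq_translate)

lemma displacement_one: "displacement A act u \<one> = 0"
  unfolding displacement_def norm_sq_eq by (intro infsum_0) (simp add: act_one)

lemma displacement_le_4:
  assumes "g \<in> carrier G" "square_summable A u"
  shows "displacement A act u g \<le> 4 * norm_sq A u"
  using norm_sq_add_le[of A u "\<lambda>x. (-1) * u (act x g)"]
    square_summable_translate[OF assms] assms norm_sq_cmult[of A "-1" "\<lambda>x. u (act x g)"]
    square_summable_cmult[of A "\<lambda>x. u (act x g)" "-1"]
  by (simp add: displacement_def norm_sq_translate)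

lemma sqrt_displacement_mult:
  assumes "g \<in> carrier G" "h \<in> carrier G" "square_summable A u"
  shows "sqrt (displacement A act u (g \<otimes> h)) \<le> sqrt (displacement A act u g) + sqrt (displacement A act u h)"
proof -
  define v where "v = (\<lambda>x. u x - u (act x h))"
  have v: "square_summable A v"
    unfolding v_def by (intro square_summable_diff square_summable_translate assms)
  have "displacement A act u (g \<otimes> h) = norm_sq A (\<lambda>x. (u x - u (act x g)) + v (act x g))"
    unfolding displacement_def v_def using assms by (intro norm_sq_cong) (simp add: act_mult)
  also have "sqrt \<dots> \<le> sqrt (displacement A act u g) + sqrt (norm_sq A (\<lambda>x. v (act x g)))"
    unfolding displacement_def
    by (intro norm_triangle_on square_summable_diff square_summable_translate assms v)
  also have "norm_sq A (\<lambda>x. v (act x g)) = displacement A act u h"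
    using norm_sq_translate[OF assms(1), of v] by (simp add: v_def displacement_def)
  finally show ?thesis by simp
qed

end

locale right_action_walk = right_action G A act + generated_group G S
  for G (structure) and A :: "'x set" and act and S
begin

lemma displacement_generator_le:
  assumes "s \<in> S"
  shows "displacement A act u s \<le> 4 * card S * energy A S act u"
  using member_le_sum[of s S "displacement A act u"] assms card_generators_pos
  by (simp add: energy_def finite_generators generators_nonempty)

text \<open>The square root of the displacement is subadditive in the group element.\<close>

lemma displacement_le_energy:
  assumes "square_summable A u" "g \<in> carrier G"
  shows "displacement A act u g \<le> 4 * card S * (word_length G S g)\<^sup>2 * energy A S act u"
proof -
  have "sqrt (displacement A act u g) \<le> sqrt (4 * card S * energy A S act u) * word_length G S g"
  proof (rule bounded_by_word_length[OF _ _ assms(2)])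
    fix s g assume sg: "s \<in> S" "g \<in> carrier G"
    then have "sqrt (displacement A act u s) \<le> sqrt (4 * card S * energy A S act u)"
      by (intro real_sqrt_le_mono displacement_generator_le)
    with sqrt_displacement_mult[OF generators_closed[OF sg(1)] sg(2) assms(1)]
    show "sqrt (displacement A act u (s \<otimes> g)) \<le>
        sqrt (4 * card S * energy A S act u) + sqrt (displacement A act u g)"
      by linarith
  qed (simp add: displacement_one)
  then have "(sqrt (displacement A act u g))\<^sup>2 \<le> (sqrt (4 * card S * energy A S act u) * word_length G S g)\<^sup>2"
    by (intro power_mono) auto
  then show ?thesis by (simp add: power_mult_distrib mult_ac)
qed

lemma walk_op_cong:
  "(\<And>x. x \<in> A \<Longrightarrow> u x = v x) \<Longrightarrow> x \<in> A \<Longrightarrow> walk_op S act u x = walk_op S act v x"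
  unfolding walk_op_def by (auto intro!: arg_cong2[where f="(+)"] arg_cong2[where f="(/)"] sum.cong act_closed generators_closed)

lemma square_summable_walk_op:
  assumes "square_summable A u"
  shows "square_summable A (walk_op S act u)"
proof -
  have "square_summable A (\<lambda>x. (1/2) * u x + (1 / (2 * card S)) * (\<Sum>s\<in>S. u (act x s)))"
    by (intro square_summable_add square_summable_cmult square_summable_sum assms
        square_summable_translate generators_closed)
  then show ?thesis by (simp add: walk_op_def[abs_def])
qed

lemma square_summable_walk_op_funpow:
  "square_summable A u \<Longrightarrow> square_summable A ((walk_op S act ^^ n) u)"
  by (induction n) (auto intro: square_summable_walk_op)

lemma walk_op_funpow_cong:
  assumes "\<And>x. x \<in> A \<Longrightarrow> u x = v x" "x \<in> A"
  shows "(walk_op S act ^^ n) u x = (walk_op S act ^^ n) v x"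
  using assms(2)
proof (induction n arbitrary: x)
  case (Suc n)
  show ?case using walk_op_cong[OF Suc.IH Suc.prems] by simp
qed (use assms(1) in simp)

lemma walk_op_nonneg: "(\<And>x. 0 \<le> u x) \<Longrightarrow> 0 \<le> walk_op S act u x"
  unfolding walk_op_def by (intro add_nonneg_nonneg divide_nonneg_nonneg sum_nonneg) auto

lemma walk_op_funpow_nonneg: "(\<And>x. 0 \<le> u x) \<Longrightarrow> 0 \<le> (walk_op S act ^^ n) u x"
  by (induction n arbitrary: x) (auto intro: walk_op_nonneg)

lemma inner_on_walk_op:
  assumes "square_summable A u" "square_summable A v"
  shows "inner_on A (walk_op S act u) v =
    inner_on A u v / 2 + (\<Sum>s\<in>S. inner_on A (\<lambda>x. u (act x s)) v) / (2 * card S)"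
proof -
  have "inner_on A (\<lambda>x. (1/2) * u x + (1 / (2 * card S)) * (\<Sum>s\<in>S. u (act x s))) v =
     (1/2) * inner_on A u v + (1 / (2 * card S)) * (\<Sum>s\<in>S. inner_on A (\<lambda>x. u (act x s)) v)"
    using assms
    by (simp only: inner_on_add_left square_summable_cmult square_summable_sum inner_on_cmult_left
        square_summable_translate generators_closed inner_on_sum_left finite_generators)
  then show ?thesis by (simp add: walk_op_def[abs_def])
qed

text \<open>The operator is self-adjoint because the set of generators is symmetric.\<close>

lemma walk_op_self_adjoint:
  assumes "square_summable A u" "square_summable A v"
  shows "inner_on A (walk_op S act u) v = inner_on A u (walk_op S act v)"
proof -
  have "(\<Sum>s\<in>S. inner_on A (\<lambda>x. u (act x s)) v) = (\<Sum>s\<in>S. inner_on A (\<lambda>x. v (act x (inv s))) u)"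
  proof (rule sum.cong)
    fix s assume "s \<in> S"
    then show "inner_on A (\<lambda>x. u (act x s)) v = inner_on A (\<lambda>x. v (act x (inv s))) u"
      using inner_on_translate_left[OF generators_closed, of s u v]
        inner_on_commute[of A u "\<lambda>x. v (act x (inv s))"] by simp
  qed simp
  also have "\<dots> = (\<Sum>s\<in>S. inner_on A (\<lambda>x. v (act x s)) u)"
    by (rule sum.reindex_bij_witness[of _ "\<lambda>s. inv s" "\<lambda>s. inv s"])
       (auto simp: generators_closed generators_inv)
  finally show ?thesis
    using assms by (simp add: inner_on_walk_op inner_on_commute[of A u])
qed

lemma inner_on_walk_op_self:
  assumes "square_summable A u"
  shows "inner_on A u (walk_op S act u) = norm_sq A u - energy A S act u"
proof -
  have "displacement A act u s = 2 * norm_sq A u - 2 * inner_on A (\<lambda>x. u (act x s)) u" if "s \<in> S" for s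
    using displacement_eq[OF generators_closed[OF that] assms] by (simp add: inner_on_commute)
  then have "energy A S act u =
      (\<Sum>s\<in>S. 2 * norm_sq A u - 2 * inner_on A (\<lambda>x. u (act x s)) u) / (4 * card S)"
    unfolding energy_def by simp
  also have "\<dots> = norm_sq A u / 2 - (\<Sum>s\<in>S. inner_on A (\<lambda>x. u (act x s)) u) / (2 * card S)"
    using card_generators_pos
    by (simp add: sum_subtractf flip: sum_distrib_left) (simp add: field_simps)
  finally have "energy A S act u =
      norm_sq A u / 2 - (\<Sum>s\<in>S. inner_on A (\<lambda>x. u (act x s)) u) / (2 * card S)" .
  then show ?thesis
    using inner_on_walk_op[OF assms assms]
    by (simp add: inner_on_commute[of A u "walk_op S act u"] norm_sq_def)
qed

text \<open>With \<open>P = (1 + P') / 2\<close> one has \<open>\<langle>u, P u\<rangle> - \<parallel>P u\<parallel>\<^sup>2 = (\<parallel>u\<parallel>\<^sup>2 - \<parallel>P' u\<parallel>\<^sup>2) / 4\<close>, and \<open>P'\<close> is an average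
  of isometries. This is where the laziness of the walk is used.\<close>

lemma norm_sq_walk_op_le_inner:
  assumes "square_summable A u"
  shows "norm_sq A (walk_op S act u) \<le> inner_on A u (walk_op S act u)"
proof -
  define m where "m = real (card S)"
  have m: "m > 0" using card_generators_pos by (simp add: m_def)
  define v where "v = (\<lambda>x. (1 / m) * (\<Sum>s\<in>S. u (act x s)))"
  have v: "square_summable A v" unfolding v_def
    by (intro square_summable_cmult square_summable_sum square_summable_translate assms generators_closed)
  have trans: "norm_sq A (\<lambda>x. u (act x s)) = norm_sq A u" if "s \<in> S" for s
    using that by (simp add: norm_sq_translate generators_closed)
  have "norm_sq A (\<lambda>x. \<Sum>s\<in>S. (1 / m) * u (act x s)) \<le> norm_sq A u"
    using m by (intro norm_sq_convex_combination)
      (auto simp: m_def finite_generators generators_closed square_summable_translate assms trans)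
  then have le: "norm_sq A v \<le> norm_sq A u" by (simp add: v_def sum_distrib_left)
  have walk: "walk_op S act u = (\<lambda>x. (1/2) * (u x + v x))"
    by (rule ext) (simp add: walk_op_def v_def m_def field_simps)
  have "norm_sq A (walk_op S act u) = (1/4) * (norm_sq A u + 2 * inner_on A u v + norm_sq A v)"
    unfolding walk norm_sq_cmult by (simp add: norm_sq_add assms v power2_eq_square)
  also have "\<dots> \<le> (1/2) * (norm_sq A u + inner_on A v u)"
    using le by (simp add: inner_on_commute)
  also have "\<dots> = inner_on A (walk_op S act u) u"
    unfolding walk inner_on_cmult_left by (simp add: inner_on_add_left assms v norm_sq_def)
  finally show ?thesis by (simp add: inner_on_commute)
qed

text \<open>The loss of squared norm in one step of the walk lies between the energy and twice the energy.\<close>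

lemma energy_le_decrement:
  assumes "square_summable A u"
  shows "energy A S act u \<le> norm_sq A u - norm_sq A (walk_op S act u)"
  using norm_sq_walk_op_le_inner[OF assms] inner_on_walk_op_self[OF assms] by simp

lemma norm_sq_walk_op_ge:
  assumes "square_summable A u"
  shows "norm_sq A u - 2 * energy A S act u \<le> norm_sq A (walk_op S act u)"
  using norm_sq_nonneg[of A "\<lambda>x. u x - walk_op S act u x"] inner_on_walk_op_self[OF assms]
    norm_sq_diff[OF assms square_summable_walk_op[OF assms]] by simp

end

section \<open>Log-convexity along the walk\<close>

context right_action_walk
begin

lemma walk_op_funpow_self_adjoint:
  assumes "square_summable A u" "square_summable A v"
  shows "inner_on A ((walk_op S act ^^ n) u) v = inner_on A u ((walk_op S act ^^ n) v)"
  using assms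
proof (induction n arbitrary: u)
  case (Suc n)
  then show ?case
    by (simp add: walk_op_self_adjoint square_summable_walk_op_funpow square_summable_walk_op funpow_swap1)
qed simp

lemma norm_sq_walk_log_convex:
  assumes "square_summable A u"
  shows "(norm_sq A ((walk_op S act ^^ Suc k) u))\<^sup>2 \<le>
    norm_sq A ((walk_op S act ^^ k) u) * norm_sq A ((walk_op S act ^^ Suc (Suc k)) u)"
proof -
  define v where "v = (walk_op S act ^^ k) u"
  have v: "square_summable A v" unfolding v_def by (rule square_summable_walk_op_funpow[OF assms])
  have "norm_sq A (walk_op S act v) = inner_on A v (walk_op S act (walk_op S act v))"
    unfolding norm_sq_def by (rule walk_op_self_adjoint[OF v square_summable_walk_op[OF v]])
  then show ?thesis
    using Cauchy_Schwarz_inner_on[OF v square_summable_walk_op[OF square_summable_walk_op[OF v]]]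
    by (simp add: v_def)
qed

lemma norm_sq_walk_pos:
  assumes "square_summable A u" "\<And>x. 0 \<le> u x" "norm_sq A u > 0"
  shows "norm_sq A ((walk_op S act ^^ k) u) > 0"
proof (induction k)
  case (Suc k)
  define v where "v = (walk_op S act ^^ k) u"
  have v: "square_summable A v" "\<And>x. 0 \<le> v x"
    unfolding v_def using assms by (auto intro: square_summable_walk_op_funpow walk_op_funpow_nonneg)
  have "\<bar>(1/2) * v x\<bar> \<le> \<bar>walk_op S act v x\<bar>" for x
    using v(2) by (auto simp: walk_op_def sum_nonneg)
  then have "norm_sq A (\<lambda>x. (1/2) * v x) \<le> norm_sq A (walk_op S act v)"
    by (rule norm_sq_mono(2)[OF square_summable_walk_op[OF v(1)]])
  moreover have "norm_sq A (\<lambda>x. (1/2) * v x) > 0"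
    unfolding norm_sq_cmult using Suc by (simp add: v_def)
  ultimately show ?case by (simp add: v_def)
qed (use assms in simp)

text \<open>By log-convexity the first step loses the largest proportion of the squared norm, and that proportion is
  controlled by the energy.\<close>

lemma norm_sq_walk_ge_power:
  assumes u: "square_summable A u" "\<And>x. 0 \<le> u x" "norm_sq A u > 0"
    and e: "2 * energy A S act u \<le> e * norm_sq A u" and "e \<le> 1"
  shows "norm_sq A u * (1 - e) ^ k \<le> norm_sq A ((walk_op S act ^^ k) u)"
proof -
  define c where "c = (\<lambda>k. norm_sq A ((walk_op S act ^^ k) u))"
  have pos: "c k > 0" for k unfolding c_def by (rule norm_sq_walk_pos[OF u])
  have lc: "(c (Suc k))\<^sup>2 \<le> c k * c (Suc (Suc k))" for k
    unfolding c_def by (rule norm_sq_walk_log_convex[OF u(1)])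
  have "c 0 * (1 - e) \<le> c 1"
    using norm_sq_walk_op_ge[OF u(1)] e by (simp add: c_def algebra_simps)
  then have "1 - e \<le> c 1 / c 0" using pos[of 0] by (simp only: pos_le_divide_eq mult.commute)
  then have "(1 - e) ^ k \<le> (c 1 / c 0) ^ k" using \<open>e \<le> 1\<close> by (intro power_mono) auto
  then have "c 0 * (1 - e) ^ k \<le> c 0 * (c 1 / c 0) ^ k"
    using pos[of 0] by simp
  also have "\<dots> \<le> c k" by (rule log_convex_ge_geometric[of c, OF pos lc])
  finally show ?thesis by (simp add: c_def)
qed

lemma norm_sq_walk_ge_linear:
  assumes u: "square_summable A u" "\<And>x. 0 \<le> u x"
  shows "norm_sq A u - 2 * real k * energy A S act u \<le> norm_sq A ((walk_op S act ^^ k) u)"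
proof (cases "2 * energy A S act u < norm_sq A u")
  case True
  then have pos: "norm_sq A u > 0" using energy_nonneg[of A S act u] by linarith
  define e where "e = 2 * energy A S act u / norm_sq A u"
  have e: "0 \<le> e" "e \<le> 1" "2 * energy A S act u = e * norm_sq A u"
    using True pos by (auto simp: e_def)
  have "1 + real k * (- e) \<le> (1 + (- e)) ^ k"
    using e by (intro Bernoulli_inequality) auto
  then have "norm_sq A u * (1 - real k * e) \<le> norm_sq A u * (1 - e) ^ k"
    using pos by (intro mult_left_mono) auto
  also have "\<dots> \<le> norm_sq A ((walk_op S act ^^ k) u)"
    using norm_sq_walk_ge_power[OF u pos, of e k] e by simp
  finally show ?thesis using e(3) by (simp add: algebra_simps)
next
  case False
  show ?thesis
  proof (cases "k = 0")
    case False
    then have "2 * energy A S act u \<le> 2 * real k * energy A S act u"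
      by (intro mult_right_mono) auto
    with \<open>\<not> 2 * energy A S act u < norm_sq A u\<close>
    have "norm_sq A u - 2 * real k * energy A S act u \<le> 0" by linarith
    then show ?thesis using norm_sq_nonneg order_trans by blast
  qed simp
qed

text \<open>Conversely, the proportion lost in the last step is at most the average over all steps.\<close>

lemma energy_walk_le:
  assumes u: "square_summable A u" "\<And>x. 0 \<le> u x" "norm_sq A u > 0" and "k \<ge> 1"
  shows "energy A S act ((walk_op S act ^^ k) u) \<le>
    norm_sq A ((walk_op S act ^^ k) u) *
      (ln (norm_sq A u / norm_sq A ((walk_op S act ^^ k) u)) / k)"
proof -
  define c where "c = (\<lambda>k. norm_sq A ((walk_op S act ^^ k) u))"
  have pos: "c k > 0" for k unfolding c_def by (rule norm_sq_walk_pos[OF u])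
  have lc: "(c (Suc k))\<^sup>2 \<le> c k * c (Suc (Suc k))" for k
    unfolding c_def by (rule norm_sq_walk_log_convex[OF u(1)])
  show ?thesis
    using energy_le_decrement[OF square_summable_walk_op_funpow[OF u(1)], of k]
      log_convex_decrement[of c k, OF pos lc \<open>k \<ge> 1\<close>]
    by (simp add: c_def)
qed

end

section \<open>The law of the lazy random walk\<close>

lemma expectation_convolution:
  assumes "finite (set_pmf p)" "finite (set_pmf q)"
  shows "measure_pmf.expectation (convolution G p q) (f :: _ \<Rightarrow> real) =
    measure_pmf.expectation p (\<lambda>x. measure_pmf.expectation q (\<lambda>y. f (x \<otimes>\<^bsub>G\<^esub> y)))"
proof -
  have "measure_pmf.expectation (convolution G p q) f =
      (\<Sum>(x, y)\<in>set_pmf p \<times> set_pmf q. f (x \<otimes>\<^bsub>G\<^esub> y) * (pmf p x * pmf q y))"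
    unfolding convolution_def integral_map_pmf
    by (subst integral_measure_pmf_real[where A = "set_pmf p \<times> set_pmf q"])
       (use assms in \<open>auto intro!: sum.cong simp: pmf_pair split: prod.splits\<close>)
  also have "\<dots> = (\<Sum>x\<in>set_pmf p. \<Sum>y\<in>set_pmf q. f (x \<otimes>\<^bsub>G\<^esub> y) * (pmf p x * pmf q y))"
    by (rule sum.cartesian_product[symmetric])
  also have "\<dots> = (\<Sum>x\<in>set_pmf p. (\<Sum>y\<in>set_pmf q. f (x \<otimes>\<^bsub>G\<^esub> y) * pmf q y) * pmf p x)"
    by (simp add: sum_distrib_left mult_ac)
  also have "\<dots> = measure_pmf.expectation p (\<lambda>x. measure_pmf.expectation q (\<lambda>y. f (x \<otimes>\<^bsub>G\<^esub> y)))"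
    using assms by (subst (1 2) integral_measure_pmf_real) auto
  finally show ?thesis .
qed

context generated_group
begin

lemma set_lazy_step: "set_pmf (lazy_step G S) = insert \<one> S"
proof -
  have "1 + 1 / real (card S) > 0" by (simp add: add_pos_nonneg)
  then show ?thesis
    using card_generators_pos
    by (auto simp: set_pmf_iff pmf_lazy_step finite_generators generators_nonempty
        indicator_def split: if_splits)
qed

lemma expectation_lazy_step:
  "measure_pmf.expectation (lazy_step G S) f = f \<one> / 2 + (\<Sum>s\<in>S. f s) / (2 * card S)"
proof -
  have "measure_pmf.expectation (lazy_step G S) f =
      (\<Sum>g\<in>insert \<one> S. f g * ((indicator {\<one>} g + indicator S g / real (card S)) / 2))"
    by (subst integral_measure_pmf_real[where A = "insert \<one> S"])
       (simp_all add: set_lazy_step finite_generators pmf_lazy_step generators_nonempty)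
  also have "\<dots> = (\<Sum>g\<in>insert \<one> S. indicator {\<one>} g * (f g / 2)) +
      (\<Sum>g\<in>insert \<one> S. indicator S g * (f g / (2 * card S)))"
    by (simp add: algebra_simps add_divide_distrib flip: sum.distrib)
  also have "(\<Sum>g\<in>insert \<one> S. indicator {\<one>} g * (f g / 2)) = f \<one> / 2"
    by (subst sum.mono_neutral_right[where S = "{\<one>}"]) (auto simp: finite_generators)
  also have "(\<Sum>g\<in>insert \<one> S. indicator S g * (f g / (2 * card S))) = (\<Sum>s\<in>S. f s / (2 * card S))"
    by (rule sum.mono_neutral_cong_right) (auto simp: finite_generators)
  finally show ?thesis by (simp add: sum_divide_distrib)
qed

lemma set_lazy_walk:
  "finite (set_pmf (lazy_walk G S n))" "set_pmf (lazy_walk G S n) \<subseteq> carrier G"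
proof (induction n)
  case (Suc n)
  have eq: "set_pmf (lazy_walk G S (Suc n)) =
      (\<lambda>(x, y). x \<otimes> y) ` (set_pmf (lazy_walk G S n) \<times> insert \<one> S)"
    by (simp add: lazy_walk_def convolution_def set_lazy_step)
  show "finite (set_pmf (lazy_walk G S (Suc n)))"
    unfolding eq using Suc by (simp add: finite_generators)
  show "set_pmf (lazy_walk G S (Suc n)) \<subseteq> carrier G"
    unfolding eq using Suc by (auto simp: generators_closed)
qed (simp_all add: lazy_walk_def)

lemma expectation_lazy_walk_mult:
  fixes f :: "'a \<Rightarrow> real"
  shows "mean (Suc n) f =
    mean n
      (\<lambda>g. measure_pmf.expectation (lazy_step G S) (\<lambda>s. f (g \<otimes> s)))"
  using set_lazy_walk[of n]
  by (simp add: lazy_walk_def expectation_convolution set_lazy_step finite_generators)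

lemma right_action_walk_self: "right_action_walk G (carrier G) (\<otimes>) S"
  by unfold_locales (auto simp: m_assoc)

lemma expectation_lazy_walk_cong:
  "(\<And>g. g \<in> carrier G \<Longrightarrow> f g = h g) \<Longrightarrow>
    mean n f = mean n h"
  using set_lazy_walk(2)[of n] by (intro integral_cong_AE) (auto simp: AE_measure_pmf_iff)

lemma expectation_lazy_walk_mono:
  fixes f h :: "'a \<Rightarrow> real"
  assumes "\<And>g. g \<in> carrier G \<Longrightarrow> f g \<le> h g"
  shows "mean n f \<le> mean n h"
  using set_lazy_walk(2)[of n] assms
  by (intro integral_mono_AE integrable_measure_pmf_finite set_lazy_walk(1))
     (auto simp: AE_measure_pmf_iff)

end

context right_action_walk
begin

text \<open>Powers of the walk operator average a function over the end point of the walk.\<close>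

lemma walk_op_funpow_eq_expectation:
  assumes "x \<in> A"
  shows "(walk_op S act ^^ n) u x = mean n (\<lambda>g. u (act x g))"
proof (induction n arbitrary: u)
  case 0
  then show ?case using assms by (simp add: lazy_walk_def act_one)
next
  case (Suc n)
  have "(walk_op S act ^^ Suc n) u x = (walk_op S act ^^ n) (walk_op S act u) x"
    by (simp only: funpow_Suc_right comp_apply)
  also have "\<dots> = mean n (\<lambda>g. walk_op S act u (act x g))"
    by (rule Suc.IH)
  also have "\<dots> = mean n
      (\<lambda>g. measure_pmf.expectation (lazy_step G S) (\<lambda>s. u (act x (g \<otimes> s))))"
    using assms
    by (intro expectation_lazy_walk_cong)
       (simp add: expectation_lazy_step walk_op_def act_mult act_one generators_closed)
  also have "\<dots> = mean (Suc n) (\<lambda>g. u (act x g))"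
    by (rule expectation_lazy_walk_mult[symmetric])
  finally show ?case .
qed

end

section \<open>The heat kernel\<close>

context generated_group
begin

interpretation self: right_action_walk G "carrier G" "(\<otimes>)" S
  by (rule right_action_walk_self)

lemma square_summable_lazy_walk: "square_summable (carrier G) (heat n)"
  by (rule square_summable_finite_support, rule finite_subset[OF _ set_lazy_walk(1)[of n]])
     (auto simp: set_pmf_iff)

lemma pmf_lazy_walk_eq_expectation:
  "heat n g = mean n (indicator {g})"
  by (simp add: measure_pmf_single)

lemma pmf_lazy_walk:
  assumes g: "g \<in> carrier G"
  shows "heat n g = (walk_op S (\<otimes>) ^^ n) (indicator {\<one>}) g"
proof -
  have "heat n g = (walk_op S (\<otimes>) ^^ n) (indicator {g}) \<one>"
    unfolding pmf_lazy_walk_eq_expectation self.walk_op_funpow_eq_expectation[OF one_closed]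
    by (intro expectation_lazy_walk_cong) simp
  also have "\<dots> = inner_on (carrier G) (indicator {\<one>}) ((walk_op S (\<otimes>) ^^ n) (indicator {g}))"
    by (simp add: inner_on_point)
  also have "\<dots> = inner_on (carrier G) ((walk_op S (\<otimes>) ^^ n) (indicator {\<one>})) (indicator {g})"
    by (simp add: self.walk_op_funpow_self_adjoint square_summable_point)
  also have "\<dots> = (walk_op S (\<otimes>) ^^ n) (indicator {\<one>}) g"
    using g by (simp add: inner_on_point inner_on_commute[of "carrier G" _ "indicator {g}"])
  finally show ?thesis .
qed

lemma pmf_lazy_walk_inv:
  assumes g: "g \<in> carrier G"
  shows "heat n (inv g) = heat n g"
proof -
  have "z = inv g \<longleftrightarrow> g \<otimes> z = \<one>" if "z \<in> carrier G" for z
    using g that inv_equality[of g z] by auto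
  then have "mean n (indicator {inv g} :: _ \<Rightarrow> real) =
      mean n (\<lambda>z. indicator {\<one>} (g \<otimes> z))"
    by (intro expectation_lazy_walk_cong) (simp add: indicator_def)
  then show ?thesis
    by (simp only: pmf_lazy_walk_eq_expectation[of n "inv g"] pmf_lazy_walk[OF g]
        self.walk_op_funpow_eq_expectation[OF g])
qed

lemma expectation_eq_inner_on:
  "mean n f = inner_on (carrier G) (heat n) f"
proof -
  have "inner_on (carrier G) (heat n) f =
      (\<Sum>\<^sub>\<infinity>g\<in>set_pmf (lazy_walk G S n). heat n g * f g)"
    unfolding inner_on_def using set_lazy_walk(2)[of n]
    by (intro infsum_cong_neutral) (auto simp: set_pmf_iff)
  also have "\<dots> = mean n f"
    using set_lazy_walk(1)[of n] by (subst integral_measure_pmf_real) (auto simp: mult.commute)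
  finally show ?thesis ..
qed

text \<open>Since the law of the walk is symmetric, its convolution square is also its correlation with its own
  right translates. Bounds for the heat kernel at even times are thus bounds for inner products of
  translates.\<close>

lemma pmf_lazy_walk_double:
  assumes g: "g \<in> carrier G"
  shows "inner_on (carrier G) (heat n) (\<lambda>x. heat n (x \<otimes> g)) =
    heat (2 * n) g"
proof -
  define p where "p = heat n"
  have "heat (2 * n) g = heat (n + n) (inv g)"
    using g by (simp add: pmf_lazy_walk_inv mult_2)
  also have "\<dots> = (walk_op S (\<otimes>) ^^ n) ((walk_op S (\<otimes>) ^^ n) (indicator {\<one>})) (inv g)"
    using g by (simp add: pmf_lazy_walk funpow_add)
  also have "\<dots> = (walk_op S (\<otimes>) ^^ n) p (inv g)"
    using g by (intro self.walk_op_funpow_cong) (simp_all add: pmf_lazy_walk p_def)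
  also have "\<dots> = inner_on (carrier G) p (\<lambda>x. p (inv g \<otimes> x))"
    using g by (simp add: self.walk_op_funpow_eq_expectation expectation_eq_inner_on flip: p_def)
  also have "\<dots> = (\<Sum>\<^sub>\<infinity>x\<in>carrier G. p (inv x) * p (inv g \<otimes> inv x))"
    unfolding inner_on_def
    by (rule infsum_reindex_bij_witness[where i = "\<lambda>x. inv x" and j = "\<lambda>x. inv x"]) auto
  also have "\<dots> = inner_on (carrier G) p (\<lambda>x. p (x \<otimes> g))"
    unfolding inner_on_def p_def
    using g by (intro infsum_cong) (simp add: pmf_lazy_walk_inv flip: inv_mult_group)
  finally show ?thesis by (simp add: p_def)
qed

lemma norm_sq_lazy_walk:
  "norm_sq (carrier G) (heat n) = heat (2 * n) \<one>"
  unfolding norm_sq_def pmf_lazy_walk_double[OF one_closed, symmetric]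
  by (intro inner_on_cong) simp_all

lemma norm_sq_point: "norm_sq (carrier G) (indicator {\<one>}) = 1"
  by (simp add: norm_sq_def inner_on_point)

lemma norm_sq_lazy_walk_pos: "norm_sq (carrier G) (heat n) > 0"
proof -
  have "norm_sq (carrier G) (heat n) =
      norm_sq (carrier G) ((walk_op S (\<otimes>) ^^ n) (indicator {\<one>}))"
    by (intro norm_sq_cong) (simp add: pmf_lazy_walk)
  also have "\<dots> > 0"
    by (rule self.norm_sq_walk_pos) (auto simp: square_summable_point norm_sq_point)
  finally show ?thesis .
qed

lemma energy_lazy_walk_le:
  assumes "n \<ge> 1"
  shows "energy (carrier G) S (\<otimes>) (heat n) \<le>
    norm_sq (carrier G) (heat n) *
      (- ln (norm_sq (carrier G) (heat n)) / n)"
proof -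
  have n: "norm_sq (carrier G) (heat n) =
      norm_sq (carrier G) ((walk_op S (\<otimes>) ^^ n) (indicator {\<one>}))"
    by (intro norm_sq_cong) (simp add: pmf_lazy_walk)
  have e: "energy (carrier G) S (\<otimes>) (heat n) =
      energy (carrier G) S (\<otimes>) ((walk_op S (\<otimes>) ^^ n) (indicator {\<one>}))"
    unfolding energy_def displacement_def
    by (intro arg_cong2[where f = "(/)"] sum.cong norm_sq_cong)
       (simp_all add: pmf_lazy_walk generators_closed)
  show ?thesis
    using self.energy_walk_le[of "indicator {\<one>}" n] assms norm_sq_lazy_walk_pos[of n]
    unfolding n e by (simp add: square_summable_point norm_sq_point ln_div)
qed

lemma walk_op_funpow_left_translate:
  assumes "y \<in> carrier G" "x \<in> carrier G"
  shows "(walk_op S (\<otimes>) ^^ k) (\<lambda>x. w (y \<otimes> x)) x = (walk_op S (\<otimes>) ^^ k) w (y \<otimes> x)"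
  using assms
  by (auto simp: self.walk_op_funpow_eq_expectation m_assoc intro!: expectation_lazy_walk_cong)

lemma walk_op_funpow_sum:
  assumes "finite I"
  shows "(walk_op S (\<otimes>) ^^ k) (\<lambda>x. \<Sum>i\<in>I. c i * w i x) = (\<lambda>x. \<Sum>i\<in>I. c i * (walk_op S (\<otimes>) ^^ k) (w i) x)"
proof (induction k)
  case (Suc k)
  have "walk_op S (\<otimes>) (\<lambda>x. \<Sum>i\<in>I. c i * v i x) = (\<lambda>x. \<Sum>i\<in>I. c i * walk_op S (\<otimes>) (v i) x)" for v
    by (rule ext)
       (simp add: walk_op_def sum.distrib sum_divide_distrib sum_distrib_left distrib_left
        sum.swap[of _ S I])
  then show ?case using Suc by simp
qed simp

text \<open>A probability distribution is a convex combination of left translates of the point mass at the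
  identity, and the walk operator commutes with left translations.\<close>

lemma norm_sq_walk_of_pmf_le:
  fixes q :: "'a pmf"
  assumes "finite (set_pmf q)" "set_pmf q \<subseteq> carrier G"
  shows "norm_sq (carrier G) ((walk_op S (\<otimes>) ^^ k) (pmf q)) \<le> norm_sq (carrier G) (heat k)"
proof -
  define w where "w = (\<lambda>y x. heat k (inv y \<otimes> x))"
  have walk: "(walk_op S (\<otimes>) ^^ k) (pmf q) x = (\<Sum>y\<in>set_pmf q. pmf q y * w y x)" if x: "x \<in> carrier G" for x
  proof -
    have "pmf q z = (\<Sum>y\<in>set_pmf q. pmf q y * indicator {\<one>} (inv y \<otimes> z))" if z: "z \<in> carrier G" for z
    proof -
      have "inv y \<otimes> z = \<one> \<longleftrightarrow> y = z" if "y \<in> set_pmf q" for y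
        using that z assms(2) by (metis inv_closed inv_equality inv_inv l_inv subsetD)
      then have "(\<Sum>y\<in>set_pmf q. pmf q y * indicator {\<one>} (inv y \<otimes> z)) =
          (\<Sum>y\<in>set_pmf q. if y = z then pmf q y else 0)"
        by (intro sum.cong) (auto simp: indicator_def)
      then show ?thesis using assms(1) by (auto simp: set_pmf_iff)
    qed
    then have "(walk_op S (\<otimes>) ^^ k) (pmf q) x =
        (walk_op S (\<otimes>) ^^ k) (\<lambda>z. \<Sum>y\<in>set_pmf q. pmf q y * indicator {\<one>} (inv y \<otimes> z)) x"
      using x by (rule self.walk_op_funpow_cong)
    also have "\<dots> = (\<Sum>y\<in>set_pmf q. pmf q y * w y x)"
      unfolding walk_op_funpow_sum[OF assms(1)] w_def
      using x assms(2) by (intro sum.cong) (auto simp: walk_op_funpow_left_translate pmf_lazy_walk)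
    finally show ?thesis .
  qed
  have w: "square_summable (carrier G) (w y)"
      "norm_sq (carrier G) (w y) = norm_sq (carrier G) (heat k)"
    if y: "y \<in> carrier G" for y
  proof -
    have bij: "bij_betw (\<lambda>x. inv y \<otimes> x) (carrier G) (carrier G)"
      by (rule bij_betw_byWitness[where f' = "\<lambda>x. y \<otimes> x"]) (use y in \<open>auto simp flip: m_assoc\<close>)
    show "square_summable (carrier G) (w y)"
      using square_summable_lazy_walk[of k]
        summable_on_reindex_bij_betw[OF bij, of "\<lambda>x. (heat k x)\<^sup>2"]
      by (simp add: square_summable_def w_def)
    show "norm_sq (carrier G) (w y) = norm_sq (carrier G) (heat k)"
      using infsum_reindex_bij_betw[OF bij, of "\<lambda>x. (heat k x)\<^sup>2"]
      by (simp add: norm_sq_eq w_def)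
  qed
  have "norm_sq (carrier G) ((walk_op S (\<otimes>) ^^ k) (pmf q)) =
      norm_sq (carrier G) (\<lambda>x. \<Sum>y\<in>set_pmf q. pmf q y * w y x)"
    by (rule norm_sq_cong) (rule walk)
  also have "\<dots> \<le> norm_sq (carrier G) (heat k)"
    using assms w sum_pmf_eq_1[of "set_pmf q" q]
    by (intro norm_sq_convex_combination) (auto simp: subset_iff)
  finally show ?thesis .
qed

end

section \<open>Heat kernels with small energy\<close>

lemma (in generated_group) energy_le_of_return_probability:
  assumes "K > 0" "0 \<le> \<gamma>" "n \<ge> 1"
    and lower: "norm_sq (carrier G) (heat n) \<ge> K * exp (- L * real n powr \<gamma>)"
  shows "energy (carrier G) S (\<otimes>) (heat n) \<le>
    (L + \<bar>ln K\<bar>) * real n powr (\<gamma> - 1) * norm_sq (carrier G) (heat n)"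
proof -
  define c where "c = norm_sq (carrier G) (heat n)"
  have c: "c > 0" unfolding c_def by (rule norm_sq_lazy_walk_pos)
  have "ln (K * exp (- L * real n powr \<gamma>)) \<le> ln c"
    using lower c \<open>K > 0\<close> unfolding c_def by (subst ln_le_cancel_iff) auto
  then have "- ln c \<le> L * real n powr \<gamma> - ln K"
    using \<open>K > 0\<close> by (simp add: ln_mult)
  also have "\<dots> \<le> (L + \<bar>ln K\<bar>) * real n powr \<gamma>"
  proof -
    have "\<bar>ln K\<bar> * 1 \<le> \<bar>ln K\<bar> * real n powr \<gamma>"
      using assms by (intro mult_left_mono ge_one_powr_ge_zero) auto
    then show ?thesis by (simp add: distrib_right)
  qed
  finally have "- ln c / n \<le> (L + \<bar>ln K\<bar>) * real n powr \<gamma> / n"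
    using assms by (intro divide_right_mono) auto
  also have "\<dots> = (L + \<bar>ln K\<bar>) * real n powr (\<gamma> - 1)"
    using assms by (simp add: powr_diff)
  finally have "c * (- ln c / n) \<le> c * ((L + \<bar>ln K\<bar>) * real n powr (\<gamma> - 1))"
    using c by (intro mult_left_mono) auto
  then show ?thesis
    using energy_lazy_walk_le[OF \<open>n \<ge> 1\<close>] by (simp add: c_def mult_ac)
qed

text \<open>The letters of \<open>T\<close> have bounded length as words in \<open>S\<close>.\<close>

lemma energy_comparison:
  assumes "right_action_walk G A act S" "right_action_walk G A act T"
  obtains C :: real where "C \<ge> 0"
    and "\<And>u. square_summable A u \<Longrightarrow> energy A T act u \<le> C * energy A S act u"
proof -
  interpret S: right_action_walk G A act S by fact
  interpret T: right_action_walk G A act T by fact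
  obtain c :: real where c: "c \<ge> 1"
    "\<And>g. g \<in> carrier G \<Longrightarrow> real (word_length G S g) \<le> c * word_length G T g"
    using word_length_equivalent[OF T.generated_group_axioms S.generated_group_axioms] by blast
  show thesis
  proof (rule that)
    show "0 \<le> card S * c\<^sup>2" by simp
    fix u assume u: "square_summable A u"
    have "displacement A act u t \<le> 4 * card S * c\<^sup>2 * energy A S act u" if t: "t \<in> T" for t
    proof -
      have "real (word_length G T t) \<le> 1" using T.word_length_generator[OF t] by simp
      then have "c * word_length G T t \<le> c" using c(1) by (simp add: mult_left_le)
      then have "real (word_length G S t) \<le> c" using c(2)[OF T.generators_closed[OF t]] by linarith
      then have "(real (word_length G S t))\<^sup>2 \<le> c\<^sup>2" by (intro power_mono) auto
      then have "4 * card S * (word_length G S t)\<^sup>2 * energy A S act u \<le> 4 * card S * c\<^sup>2 * energy A S act u"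
        by (intro mult_right_mono) (auto intro: mult_left_mono)
      then show ?thesis
        using S.displacement_le_energy[OF u T.generators_closed[OF t]] by simp
    qed
    then have "(\<Sum>t\<in>T. displacement A act u t) \<le> card T * (4 * card S * c\<^sup>2 * energy A S act u)"
      by (rule sum_bounded_above)
    then have "energy A T act u \<le> card T * (4 * card S * c\<^sup>2 * energy A S act u) / (4 * card T)"
      unfolding energy_def by (intro divide_right_mono) auto
    also have "\<dots> = card S * c\<^sup>2 * energy A S act u"
      using T.card_generators_pos by simp
    finally show "energy A T act u \<le> card S * c\<^sup>2 * energy A S act u" .
  qed
qed

lemma exp_le_one_minus:
  fixes e :: real
  assumes "0 \<le> e" "e \<le> 1/2"
  shows "exp (- 2 * e) \<le> 1 - e"
proof -
  have "e * e \<le> e * (1/2)" using assms by (intro mult_left_mono) auto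
  then have "- 2 * e \<le> ln (1 - e)"
    using ln_one_minus_pos_lower_bound[of e] assms by (simp add: power2_eq_square)
  then have "exp (- 2 * e) \<le> exp (ln (1 - e))" by simp
  then show ?thesis using assms by simp
qed

text \<open>Let \<open>p\<close> be the law at time \<open>m\<close> of the walk driven by \<open>S\<close>. Its energy relative to its norm is of
  order \<open>m\<^sup>\<gamma>\<^sup>-\<^sup>1\<close>, for \<open>T\<close> as well as for \<open>S\<close>, so \<open>m\<close> steps of the walk driven by \<open>T\<close> retain a proportion
  \<open>(1 - C m\<^sup>\<gamma>\<^sup>-\<^sup>1)\<^sup>m\<close>, about \<open>exp (- C m\<^sup>\<gamma>)\<close>, of its squared norm. On the other hand \<open>p\<close> is a convex combination
  of point masses, so it ends up with a norm no larger than that of a point mass.\<close>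

lemma return_probability_comparison:
  fixes K L \<gamma> :: real
  assumes S: "generated_group G S" and T: "generated_group G T"
    and KL: "K > 0" "L > 0" and \<gamma>: "0 \<le> \<gamma>" "\<gamma> < 1"
    and lower: "\<forall>n\<ge>1. pmf (lazy_walk G S n) \<one>\<^bsub>G\<^esub> \<ge> K * exp (- L * real n powr \<gamma>)"
  obtains L' m\<^sub>0 where "L' > 0" "m\<^sub>0 \<ge> 1"
    "\<And>m. m \<ge> m\<^sub>0 \<Longrightarrow> norm_sq (carrier G) (pmf (lazy_walk G T m)) \<ge> K * exp (- L' * real m powr \<gamma>)"
proof -
  interpret S: generated_group G S by fact
  interpret T: generated_group G T by fact
  interpret SA: right_action_walk G "carrier G" "(\<otimes>\<^bsub>G\<^esub>)" S by (rule S.right_action_walk_self)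
  interpret TA: right_action_walk G "carrier G" "(\<otimes>\<^bsub>G\<^esub>)" T by (rule T.right_action_walk_self)
  obtain c where c: "c \<ge> 0"
    "\<And>u. square_summable (carrier G) u \<Longrightarrow>
      energy (carrier G) T (\<otimes>\<^bsub>G\<^esub>) u \<le> c * energy (carrier G) S (\<otimes>\<^bsub>G\<^esub>) u"
    using energy_comparison[OF SA.right_action_walk_axioms TA.right_action_walk_axioms] by blast
  \<comment> \<open>Twice the energy of \<open>p\<close> for \<open>T\<close>, relative to its squared norm, is at most \<open>C m\<^sup>\<gamma>\<^sup>-\<^sup>1\<close>. From time \<open>m\<^sub>0\<close> on this
    is at most \<open>1/2\<close>, so that \<open>1 - e \<ge> exp (- 2 e)\<close> applies.\<close>
  define C where "C = 2 * c * (2 * L + \<bar>ln K\<bar>)"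
  have C: "C \<ge> 0" using c KL by (simp add: C_def)
  have "((\<lambda>m. C * real m powr (\<gamma> - 1)) \<longlongrightarrow> C * 0) sequentially"
    using \<gamma> by (intro tendsto_mult_left tendsto_neg_powr filterlim_real_sequentially) auto
  then have "\<forall>\<^sub>F m in sequentially. C * real m powr (\<gamma> - 1) < 1/2"
    by (rule order_tendstoD) simp
  then obtain m\<^sub>0 where m\<^sub>0: "\<And>m. m \<ge> m\<^sub>0 \<Longrightarrow> C * real m powr (\<gamma> - 1) < 1/2"
    by (auto simp: eventually_sequentially)
  show thesis
  proof (rule that)
    show "2 * L + 2 * C > 0" using KL C by simp
    show "max m\<^sub>0 1 \<ge> 1" by simp
    fix m assume m: "m \<ge> max m\<^sub>0 1"
    define p where "p = pmf (lazy_walk G S m)"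
    define e where "e = C * real m powr (\<gamma> - 1)"
    have e: "0 \<le> e" "e \<le> 1/2" using m\<^sub>0[of m] m C by (auto simp: e_def)
    have p: "square_summable (carrier G) p" "norm_sq (carrier G) p > 0" "\<And>x. 0 \<le> p x"
      unfolding p_def by (auto intro: S.square_summable_lazy_walk S.norm_sq_lazy_walk_pos)
    have "real (2 * m) powr \<gamma> \<le> 2 * real m powr \<gamma>"
      using \<gamma> powr_mono[of \<gamma> 1 2] by (simp add: powr_mult mult_right_mono)
    then have "L * real (2 * m) powr \<gamma> \<le> 2 * L * real m powr \<gamma>" using KL by simp
    then have "K * exp (- (2 * L) * real m powr \<gamma>) \<le> K * exp (- L * real (2 * m) powr \<gamma>)"
      using KL by simp
    also have "\<dots> \<le> norm_sq (carrier G) p"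
      unfolding p_def S.norm_sq_lazy_walk using lower[rule_format, of "2 * m"] m by simp
    finally have p_lower: "K * exp (- (2 * L) * real m powr \<gamma>) \<le> norm_sq (carrier G) p" .
    have "energy (carrier G) S (\<otimes>\<^bsub>G\<^esub>) p \<le>
        (2 * L + \<bar>ln K\<bar>) * real m powr (\<gamma> - 1) * norm_sq (carrier G) p"
      unfolding p_def
      by (rule S.energy_le_of_return_probability) (use KL \<gamma> m p_lower in \<open>auto simp: p_def\<close>)
    then have "2 * c * energy (carrier G) S (\<otimes>\<^bsub>G\<^esub>) p \<le>
        2 * c * ((2 * L + \<bar>ln K\<bar>) * real m powr (\<gamma> - 1) * norm_sq (carrier G) p)"
      using c(1) by (intro mult_left_mono) auto
    then have "2 * (c * energy (carrier G) S (\<otimes>\<^bsub>G\<^esub>) p) \<le> e * norm_sq (carrier G) p"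
      by (simp add: e_def C_def algebra_simps)
    with c(2)[OF p(1)] have en: "2 * energy (carrier G) T (\<otimes>\<^bsub>G\<^esub>) p \<le> e * norm_sq (carrier G) p"
      by linarith
    have "exp (- 2 * e) ^ m \<le> (1 - e) ^ m"
      using exp_le_one_minus[OF e] by (intro power_mono) auto
    moreover have "exp (- 2 * e) ^ m = exp (- (2 * C) * real m powr \<gamma>)"
    proof -
      have "e * real m = C * real m powr \<gamma>" using m by (simp add: e_def powr_diff)
      then show ?thesis by (simp add: mult_ac flip: exp_of_nat_mult)
    qed
    ultimately have "K * exp (- (2 * L) * real m powr \<gamma>) * exp (- (2 * C) * real m powr \<gamma>)
        \<le> norm_sq (carrier G) p * (1 - e) ^ m"
      using p_lower by (intro mult_mono) auto
    also have "\<dots> \<le> norm_sq (carrier G) ((walk_op T (\<otimes>\<^bsub>G\<^esub>) ^^ m) p)"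
      using p en e by (intro TA.norm_sq_walk_ge_power) auto
    also have "\<dots> \<le> norm_sq (carrier G) (pmf (lazy_walk G T m))"
      unfolding p_def by (rule T.norm_sq_walk_of_pmf_le) (rule S.set_lazy_walk)+
    finally show "norm_sq (carrier G) (pmf (lazy_walk G T m)) \<ge> K * exp (- (2 * L + 2 * C) * real m powr \<gamma>)"
      by (simp add: distrib_right exp_add exp_diff exp_minus field_simps)
  qed
qed

lemma heat_kernel_displacement:
  fixes K L \<gamma> :: real
  assumes S: "generated_group G S" and T: "generated_group G T"
    and KL: "K > 0" "L > 0" and \<gamma>: "0 \<le> \<gamma>" "\<gamma> < 1"
    and lower: "\<forall>n\<ge>1. pmf (lazy_walk G S n) \<one>\<^bsub>G\<^esub> \<ge> K * exp (- L * real n powr \<gamma>)"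
  obtains C m\<^sub>0 where "C > 0" "m\<^sub>0 \<ge> 1"
    "\<And>m g. m \<ge> m\<^sub>0 \<Longrightarrow> g \<in> carrier G \<Longrightarrow>
      displacement (carrier G) (\<otimes>\<^bsub>G\<^esub>) (pmf (lazy_walk G T m)) g \<le>
        C * real m powr (\<gamma> - 1) * (word_length G T g)\<^sup>2 * norm_sq (carrier G) (pmf (lazy_walk G T m))"
proof -
  interpret T: generated_group G T by fact
  interpret TA: right_action_walk G "carrier G" "(\<otimes>\<^bsub>G\<^esub>)" T by (rule T.right_action_walk_self)
  obtain L' m\<^sub>0 where L': "L' > 0" "m\<^sub>0 \<ge> 1"
    "\<And>m. m \<ge> m\<^sub>0 \<Longrightarrow> norm_sq (carrier G) (pmf (lazy_walk G T m)) \<ge> K * exp (- L' * real m powr \<gamma>)"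
    using return_probability_comparison[OF S T KL \<gamma> lower] by metis
  define C where "C = 4 * card T * (L' + \<bar>ln K\<bar>)"
  show thesis
  proof (rule that)
    show "C > 0" unfolding C_def using T.card_generators_pos L'(1) by (intro mult_pos_pos) auto
    show "m\<^sub>0 \<ge> 1" by fact
    fix m g assume m: "m \<ge> m\<^sub>0" and g: "g \<in> carrier G"
    define p where "p = pmf (lazy_walk G T m)"
    have "displacement (carrier G) (\<otimes>\<^bsub>G\<^esub>) p g \<le>
        4 * card T * (word_length G T g)\<^sup>2 * energy (carrier G) T (\<otimes>\<^bsub>G\<^esub>) p"
      unfolding p_def by (rule TA.displacement_le_energy[OF T.square_summable_lazy_walk g])
    also have "\<dots> \<le> 4 * card T * (word_length G T g)\<^sup>2 *
        ((L' + \<bar>ln K\<bar>) * real m powr (\<gamma> - 1) * norm_sq (carrier G) p)"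
      unfolding p_def using KL \<gamma> L' m
      by (intro mult_left_mono T.energy_le_of_return_probability) auto
    finally show "displacement (carrier G) (\<otimes>\<^bsub>G\<^esub>) p g \<le>
        C * real m powr (\<gamma> - 1) * (word_length G T g)\<^sup>2 * norm_sq (carrier G) p"
      by (simp add: C_def algebra_simps)
  qed
qed

section \<open>Transport along a quasi-isometry\<close>

lemma (in generated_group) finite_word_ball_real: "finite {g \<in> carrier G. real (word_length G S g) \<le> r}"
  by (rule finite_subset[OF _ finite_word_ball[of "nat \<lceil>r\<rceil>"]]) (auto, linarith)

lemma infsum_finite_sum:
  fixes f :: "'i \<Rightarrow> 'x \<Rightarrow> real"
  assumes "finite I" "\<And>i. i \<in> I \<Longrightarrow> f i summable_on A"
  shows "(\<lambda>x. \<Sum>i\<in>I. f i x) summable_on A"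
    and "(\<Sum>\<^sub>\<infinity>x\<in>A. \<Sum>i\<in>I. f i x) = (\<Sum>i\<in>I. \<Sum>\<^sub>\<infinity>x\<in>A. f i x)"
proof -
  have "(\<lambda>x. \<Sum>i\<in>I. f i x) summable_on A \<and>
      (\<Sum>\<^sub>\<infinity>x\<in>A. \<Sum>i\<in>I. f i x) = (\<Sum>i\<in>I. \<Sum>\<^sub>\<infinity>x\<in>A. f i x)"
    using assms by (induction I) (auto intro: summable_on_add simp: infsum_add)
  then show "(\<lambda>x. \<Sum>i\<in>I. f i x) summable_on A"
    "(\<Sum>\<^sub>\<infinity>x\<in>A. \<Sum>i\<in>I. f i x) = (\<Sum>i\<in>I. \<Sum>\<^sub>\<infinity>x\<in>A. f i x)" by auto
qed

text \<open>A quasi-isometry from \<open>H\<close> to \<open>G\<close>, described by what it does to a right multiplication: moving from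
  \<open>h\<close> to \<open>h g\<close> moves the image by the right factor \<open>(q h)\<^sup>-\<^sup>1 q (h g)\<close>, which depends on \<open>h\<close> but has length
  comparable to that of \<open>g\<close>.\<close>

locale coarse_map = G: generated_group G S + H: generated_group H T
  for G :: "('a, 'm) monoid_scheme" (structure) and S and H :: "('b, 'n) monoid_scheme" and T +
  fixes q :: "'b \<Rightarrow> 'a" and a b :: real
  assumes q_closed: "h \<in> carrier H \<Longrightarrow> q h \<in> carrier G"
    and a_ge_1: "a \<ge> 1" and b_nonneg: "b \<ge> 0"
    and jump_le: "h \<in> carrier H \<Longrightarrow> g \<in> carrier H \<Longrightarrow>
      real (word_length G S (inv (q h) \<otimes> q (h \<otimes>\<^bsub>H\<^esub> g))) \<le> a * word_length H T g + b"
    and jump_ge: "h \<in> carrier H \<Longrightarrow> g \<in> carrier H \<Longrightarrow>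
      word_length H T g / a - b \<le> real (word_length G S (inv (q h) \<otimes> q (h \<otimes>\<^bsub>H\<^esub> g)))"
    and dense: "x \<in> carrier G \<Longrightarrow> \<exists>h\<in>carrier H. real (word_length G S (inv (q h) \<otimes> x)) \<le> b"
begin

sublocale GA: right_action_walk G "carrier G" "(\<otimes>)" S by (rule G.right_action_walk_self)
sublocale HA: right_action_walk H "carrier H" "(\<otimes>\<^bsub>H\<^esub>)" T by (rule H.right_action_walk_self)

abbreviation disp_G :: "('a \<Rightarrow> real) \<Rightarrow> 'a \<Rightarrow> real" where
  "disp_G \<equiv> displacement (carrier G) (\<otimes>)"

abbreviation disp_H :: "('b \<Rightarrow> real) \<Rightarrow> 'b \<Rightarrow> real" where
  "disp_H \<equiv> displacement (carrier H) (\<otimes>\<^bsub>H\<^esub>)"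

definition jump :: "'b \<Rightarrow> 'b \<Rightarrow> 'a" where
  "jump h g = inv (q h) \<otimes> q (h \<otimes>\<^bsub>H\<^esub> g)"

lemma jump_closed: "h \<in> carrier H \<Longrightarrow> g \<in> carrier H \<Longrightarrow> jump h g \<in> carrier G"
  by (simp add: jump_def q_closed)

lemma mult_jump: "h \<in> carrier H \<Longrightarrow> g \<in> carrier H \<Longrightarrow> q h \<otimes> jump h g = q (h \<otimes>\<^bsub>H\<^esub> g)"
  by (simp add: jump_def q_closed flip: G.m_assoc)

text \<open>Two points with the same image differ by an element of length at most \<open>a b\<close>.\<close>

definition multiplicity_bound :: nat where
  "multiplicity_bound = card {g \<in> carrier H. real (word_length H T g) \<le> a * b}"

lemma finite_fibre: "finite {h \<in> carrier H. q h = x}"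
  and card_fibre: "card {h \<in> carrier H. q h = x} \<le> multiplicity_bound"
proof -
  have "finite {h \<in> carrier H. q h = x} \<and> card {h \<in> carrier H. q h = x} \<le> multiplicity_bound"
  proof (cases "{h \<in> carrier H. q h = x} = {}")
    case False
    then obtain k where k: "k \<in> carrier H" "q k = x" by auto
    let ?B = "{g \<in> carrier H. real (word_length H T g) \<le> a * b}"
    have "{h \<in> carrier H. q h = x} \<subseteq> (\<lambda>g. k \<otimes>\<^bsub>H\<^esub> g) ` ?B"
    proof
      fix h assume h: "h \<in> {h \<in> carrier H. q h = x}"
      define g where "g = inv\<^bsub>H\<^esub> k \<otimes>\<^bsub>H\<^esub> h"
      have g: "g \<in> carrier H" "k \<otimes>\<^bsub>H\<^esub> g = h"
        using h k by (auto simp: g_def simp flip: H.m_assoc)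
      have "word_length H T g / a - b \<le> 0"
        using jump_ge[OF k(1) g(1)] h k q_closed[OF k(1)] g by simp
      then have "real (word_length H T g) \<le> a * b" using a_ge_1 by (simp add: field_simps)
      then show "h \<in> (\<lambda>g. k \<otimes>\<^bsub>H\<^esub> g) ` ?B" using g by force
    qed
    moreover have "finite ?B" by (rule H.finite_word_ball_real)
    ultimately show ?thesis
      using finite_subset surj_card_le unfolding multiplicity_bound_def by blast
  next
    case True
    show ?thesis unfolding True by simp
  qed
  then show "finite {h \<in> carrier H. q h = x}"
    "card {h \<in> carrier H. q h = x} \<le> multiplicity_bound" by auto
qed

lemma pullback_sum:
  fixes f :: "'a \<Rightarrow> real"
  assumes nonneg: "\<And>x. x \<in> carrier G \<Longrightarrow> 0 \<le> f x" and f: "f summable_on carrier G"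
  shows "(\<lambda>h. f (q h)) summable_on carrier H"
    and "(\<Sum>\<^sub>\<infinity>h\<in>carrier H. f (q h)) \<le> multiplicity_bound * (\<Sum>\<^sub>\<infinity>x\<in>carrier G. f x)"
proof -
  have le: "(\<Sum>h\<in>F. f (q h)) \<le> multiplicity_bound * (\<Sum>\<^sub>\<infinity>x\<in>carrier G. f x)"
    if F: "finite F" "F \<subseteq> carrier H" for F
  proof -
    have "(\<Sum>h\<in>F. f (q h)) = (\<Sum>x\<in>q ` F. \<Sum>h\<in>{h \<in> F. q h = x}. f (q h))"
      using F by (intro sum.image_gen)
    also have "\<dots> \<le> (\<Sum>x\<in>q ` F. multiplicity_bound * f x)"
    proof (rule sum_mono)
      fix x assume x: "x \<in> q ` F"
      then have x': "x \<in> carrier G" using F q_closed by auto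
      have "card {h \<in> F. q h = x} \<le> card {h \<in> carrier H. q h = x}"
        using F by (intro card_mono finite_fibre) auto
      also have "\<dots> \<le> multiplicity_bound" by (rule card_fibre)
      finally have "card {h \<in> F. q h = x} * f x \<le> multiplicity_bound * f x"
        using nonneg[OF x'] by (intro mult_right_mono) auto
      moreover have "(\<Sum>h\<in>{h \<in> F. q h = x}. f (q h)) = card {h \<in> F. q h = x} * f x"
        by (simp add: sum.cong)
      ultimately show "(\<Sum>h\<in>{h \<in> F. q h = x}. f (q h)) \<le> multiplicity_bound * f x" by simp
    qed
    also have "\<dots> = multiplicity_bound * (\<Sum>x\<in>q ` F. f x)" by (simp add: sum_distrib_left)
    also have "\<dots> \<le> multiplicity_bound * (\<Sum>\<^sub>\<infinity>x\<in>carrier G. f x)"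
      using F q_closed by (intro mult_left_mono finite_sum_le_infsum f) (auto intro: nonneg)
    finally show ?thesis .
  qed
  have "\<And>h. h \<in> carrier H \<Longrightarrow> 0 \<le> f (q h)" by (simp add: nonneg q_closed)
  then show sm: "(\<lambda>h. f (q h)) summable_on carrier H"
    using le by (intro nonneg_bdd_above_summable_on bdd_aboveI2) auto
  show "(\<Sum>\<^sub>\<infinity>h\<in>carrier H. f (q h)) \<le> multiplicity_bound * (\<Sum>\<^sub>\<infinity>x\<in>carrier G. f x)"
    by (rule infsum_le_finite_sums[OF sm]) (rule le)
qed

lemma square_summable_pullback:
  "square_summable (carrier G) \<phi> \<Longrightarrow> square_summable (carrier H) (\<lambda>h. \<phi> (q h))"
  unfolding square_summable_def by (rule pullback_sum(1)) auto

lemma sum_displacement_pullback: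
  assumes \<phi>: "square_summable (carrier G) \<phi>" and Y: "finite Y" "Y \<subseteq> carrier G"
  shows "(\<lambda>h. \<Sum>y\<in>Y. (\<phi> (q h) - \<phi> (q h \<otimes> y))\<^sup>2) summable_on carrier H"
    and "(\<Sum>\<^sub>\<infinity>h\<in>carrier H. \<Sum>y\<in>Y. (\<phi> (q h) - \<phi> (q h \<otimes> y))\<^sup>2) \<le>
      multiplicity_bound * (\<Sum>y\<in>Y. disp_G \<phi> y)"
proof -
  have sm: "(\<lambda>x. (\<phi> x - \<phi> (x \<otimes> y))\<^sup>2) summable_on carrier G" if "y \<in> Y" for y
    using square_summable_diff[OF \<phi> GA.square_summable_translate[OF _ \<phi>]] that Y(2)
    unfolding square_summable_def by auto
  have s: "(\<lambda>x. \<Sum>y\<in>Y. (\<phi> x - \<phi> (x \<otimes> y))\<^sup>2) summable_on carrier G"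
    using sm Y(1) by (rule infsum_finite_sum(1)[rotated])
  have "(\<Sum>\<^sub>\<infinity>x\<in>carrier G. \<Sum>y\<in>Y. (\<phi> x - \<phi> (x \<otimes> y))\<^sup>2) =
      (\<Sum>y\<in>Y. disp_G \<phi> y)"
    unfolding displacement_def norm_sq_eq using sm Y(1) by (rule infsum_finite_sum(2)[rotated])
  with pullback_sum[OF _ s]
  show "(\<lambda>h. \<Sum>y\<in>Y. (\<phi> (q h) - \<phi> (q h \<otimes> y))\<^sup>2) summable_on carrier H"
    "(\<Sum>\<^sub>\<infinity>h\<in>carrier H. \<Sum>y\<in>Y. (\<phi> (q h) - \<phi> (q h \<otimes> y))\<^sup>2) \<le>
      multiplicity_bound * (\<Sum>y\<in>Y. disp_G \<phi> y)"
    by (auto simp: sum_nonneg)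
qed

lemma displacement_pullback_generator:
  assumes \<phi>: "square_summable (carrier G) \<phi>" and t: "t \<in> T"
  shows "disp_H (\<lambda>h. \<phi> (q h)) t \<le> multiplicity_bound *
    (\<Sum>y\<in>{y \<in> carrier G. real (word_length G S y) \<le> a + b}. disp_G \<phi> y)"
proof -
  define Y where "Y = {y \<in> carrier G. real (word_length G S y) \<le> a + b}"
  have Y: "finite Y" "Y \<subseteq> carrier G" unfolding Y_def by (auto intro: G.finite_word_ball_real)
  have t': "t \<in> carrier H" using t by (rule H.generators_closed)
  have "a * word_length H T t \<le> a"
    using H.word_length_generator[OF t] a_ge_1 by (simp add: mult_left_le)
  then have J: "jump h t \<in> Y" if "h \<in> carrier H" for h
    using jump_le[OF that t'] jump_closed[OF that t'] by (simp add: Y_def jump_def)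
  have "disp_H (\<lambda>h. \<phi> (q h)) t =
      (\<Sum>\<^sub>\<infinity>h\<in>carrier H. (\<phi> (q h) - \<phi> (q (h \<otimes>\<^bsub>H\<^esub> t)))\<^sup>2)"
    by (simp add: displacement_def norm_sq_eq)
  also have "\<dots> \<le> (\<Sum>\<^sub>\<infinity>h\<in>carrier H. \<Sum>y\<in>Y. (\<phi> (q h) - \<phi> (q h \<otimes> y))\<^sup>2)"
  proof (rule infsum_mono)
    show "(\<lambda>h. (\<phi> (q h) - \<phi> (q (h \<otimes>\<^bsub>H\<^esub> t)))\<^sup>2) summable_on carrier H"
      using square_summable_pullback[OF \<phi>] t'
      unfolding square_summable_def[symmetric]
      by (intro square_summable_diff HA.square_summable_translate[where u = "\<lambda>h. \<phi> (q h)"])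
    show "(\<lambda>h. \<Sum>y\<in>Y. (\<phi> (q h) - \<phi> (q h \<otimes> y))\<^sup>2) summable_on carrier H"
      by (rule sum_displacement_pullback(1)[OF \<phi> Y])
    fix h assume h: "h \<in> carrier H"
    show "(\<phi> (q h) - \<phi> (q (h \<otimes>\<^bsub>H\<^esub> t)))\<^sup>2 \<le> (\<Sum>y\<in>Y. (\<phi> (q h) - \<phi> (q h \<otimes> y))\<^sup>2)"
      using member_le_sum[OF J[OF h], of "\<lambda>y. (\<phi> (q h) - \<phi> (q h \<otimes> y))\<^sup>2"] Y(1)
      by (simp add: mult_jump[OF h t'])
  qed
  also have "\<dots> \<le> multiplicity_bound * (\<Sum>y\<in>Y. disp_G \<phi> y)"
    by (rule sum_displacement_pullback(2)[OF \<phi> Y])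
  finally show ?thesis by (simp add: Y_def)
qed

text \<open>Composition with \<open>q\<close> keeps a fixed proportion of the norm of a function with small displacements, because
  every point of \<open>G\<close> is obtained from a point of the image by a right factor in the ball \<open>Z\<close>.\<close>

lemma norm_sq_le_pullback:
  assumes \<phi>: "square_summable (carrier G) \<phi>"
  defines "Z \<equiv> {y \<in> carrier G. real (word_length G S y) \<le> b}"
  shows "norm_sq (carrier G) \<phi> \<le> 2 * card Z * norm_sq (carrier H) (\<lambda>h. \<phi> (q h)) +
    2 * (multiplicity_bound * (\<Sum>y\<in>Z. disp_G \<phi> y))"
proof -
  have Z: "finite Z" "Z \<subseteq> carrier G" unfolding Z_def by (auto intro: G.finite_word_ball_real)
  have "\<forall>x\<in>carrier G. \<exists>h. h \<in> carrier H \<and> inv (q h) \<otimes> x \<in> Z"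
    using dense q_closed unfolding Z_def by fastforce
  then obtain r where r: "\<And>x. x \<in> carrier G \<Longrightarrow> r x \<in> carrier H \<and> inv (q (r x)) \<otimes> x \<in> Z"
    by (metis bchoice)
  let ?f = "\<lambda>h. (\<phi> (q h))\<^sup>2" and ?d = "\<lambda>h. \<Sum>y\<in>Z. (\<phi> (q h) - \<phi> (q h \<otimes> y))\<^sup>2"
  have sf: "?f summable_on carrier H"
    using square_summable_pullback[OF \<phi>] by (simp add: square_summable_def)
  have sd: "?d summable_on carrier H" by (rule sum_displacement_pullback(1)[OF \<phi> Z])
  have sb: "(\<lambda>h. 2 * card Z * ?f h + 2 * ?d h) summable_on carrier H"
    by (intro summable_on_add summable_on_cmult_right sf sd)
  have pt: "(\<Sum>y\<in>Z. (\<phi> (q h \<otimes> y))\<^sup>2) \<le> 2 * card Z * ?f h + 2 * ?d h" for h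
  proof -
    have "v\<^sup>2 \<le> 2 * u\<^sup>2 + 2 * (u - v)\<^sup>2" for u v :: real
      using zero_le_power2[of "2 * u - v"] by (simp add: power2_eq_square algebra_simps)
    then have "(\<Sum>y\<in>Z. (\<phi> (q h \<otimes> y))\<^sup>2) \<le>
        (\<Sum>y\<in>Z. 2 * ?f h + 2 * (\<phi> (q h) - \<phi> (q h \<otimes> y))\<^sup>2)"
      by (intro sum_mono) auto
    then show ?thesis by (simp add: sum.distrib sum_distrib_left)
  qed
  have "norm_sq (carrier G) \<phi> \<le> (\<Sum>\<^sub>\<infinity>h\<in>carrier H. 2 * card Z * ?f h + 2 * ?d h)"
    unfolding norm_sq_eq
  proof (rule infsum_le_finite_sums)
    show "(\<lambda>x. (\<phi> x)\<^sup>2) summable_on carrier G" using \<phi> by (simp add: square_summable_def)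
    fix F assume F: "finite F" "F \<subseteq> carrier G"
    let ?j = "\<lambda>x. (r x, inv (q (r x)) \<otimes> x)" and ?m = "\<lambda>(h, y). q h \<otimes> y"
    have mj: "?m (?j x) = x" if "x \<in> F" for x
      using that F(2) r[of x] q_closed[of "r x"] by (auto simp flip: G.m_assoc)
    have "(\<Sum>x\<in>F. (\<phi> x)\<^sup>2) = (\<Sum>p\<in>?j ` F. (\<phi> (?m p))\<^sup>2)"
      using mj by (subst sum.reindex) (auto intro!: inj_on_inverseI[where g = ?m] sum.cong)
    also have "\<dots> \<le> (\<Sum>p\<in>r ` F \<times> Z. (\<phi> (?m p))\<^sup>2)"
      using F r Z by (intro sum_mono2) auto
    also have "\<dots> = (\<Sum>h\<in>r ` F. \<Sum>y\<in>Z. (\<phi> (q h \<otimes> y))\<^sup>2)"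
      by (simp add: sum.cartesian_product case_prod_unfold)
    also have "\<dots> \<le> (\<Sum>h\<in>r ` F. 2 * card Z * ?f h + 2 * ?d h)"
      by (intro sum_mono pt)
    also have "\<dots> \<le> (\<Sum>\<^sub>\<infinity>h\<in>carrier H. 2 * card Z * ?f h + 2 * ?d h)"
      using F r by (intro finite_sum_le_infsum sb) (auto intro!: add_nonneg_nonneg sum_nonneg)
    finally show "(\<Sum>x\<in>F. (\<phi> x)\<^sup>2) \<le> (\<Sum>\<^sub>\<infinity>h\<in>carrier H. 2 * card Z * ?f h + 2 * ?d h)" .
  qed
  also have "\<dots> = 2 * card Z * norm_sq (carrier H) (\<lambda>h. \<phi> (q h)) + 2 * (\<Sum>\<^sub>\<infinity>h\<in>carrier H. ?d h)"
    using sf sd by (simp add: infsum_add summable_on_cmult_right infsum_cmult_right norm_sq_eq)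
  also have "\<dots> \<le> 2 * card Z * norm_sq (carrier H) (\<lambda>h. \<phi> (q h)) +
    2 * (multiplicity_bound * (\<Sum>y\<in>Z. disp_G \<phi> y))"
    using sum_displacement_pullback(2)[OF \<phi> Z] by simp
  finally show ?thesis .
qed

end

section \<open>From functions on \<open>G\<close> to functions on \<open>H \<times> G\<close>\<close>

lemma summable_on_finite_support:
  fixes f :: "'x \<Rightarrow> real"
  assumes "finite {x \<in> A. f x \<noteq> 0}"
  shows "f summable_on A"
  by (subst summable_on_cong_neutral[where T = "{x \<in> A. f x \<noteq> 0}" and g = f]) (use assms in auto)

context coarse_map
begin

definition product_act :: "'b \<times> 'a \<Rightarrow> 'b \<Rightarrow> 'b \<times> 'a" where
  "product_act p g = (fst p \<otimes>\<^bsub>H\<^esub> g, snd p)"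

abbreviation disp_P :: "('b \<times> 'a \<Rightarrow> real) \<Rightarrow> 'b \<Rightarrow> real" where
  "disp_P \<equiv> displacement (carrier H \<times> carrier G) product_act"

text \<open>The second factor is a translate of \<open>\<phi>\<close> in the variable \<open>z\<close>; it makes inner products see how
  far apart \<open>q h\<close> and \<open>q (h g)\<close> are. The first factor only localizes the variable \<open>h\<close> in a nearly invariant
  way.\<close>

definition product_fun :: "('a \<Rightarrow> real) \<Rightarrow> 'b \<times> 'a \<Rightarrow> real" where
  "product_fun \<phi> p = \<phi> (q (fst p)) * \<phi> (snd p \<otimes> q (fst p))"

sublocale PA: right_action_walk H "carrier H \<times> carrier G" product_act T
  by unfold_locales (auto simp: product_act_def H.m_assoc)

lemma finite_support_pullback:
  assumes "finite {x \<in> carrier G. \<phi> x \<noteq> 0}"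
  shows "finite {h \<in> carrier H. \<phi> (q h) \<noteq> 0}"
proof (rule finite_subset)
  show "{h \<in> carrier H. \<phi> (q h) \<noteq> 0} \<subseteq>
      (\<Union>x\<in>{x \<in> carrier G. \<phi> x \<noteq> 0}. {h \<in> carrier H. q h = x})"
    using q_closed by auto
  show "finite (\<Union>x\<in>{x \<in> carrier G. \<phi> x \<noteq> 0}. {h \<in> carrier H. q h = x})"
    using assms finite_fibre by blast
qed

lemma square_summable_product_fun:
  assumes fin: "finite {x \<in> carrier G. \<phi> x \<noteq> 0}"
  shows "square_summable (carrier H \<times> carrier G) (product_fun \<phi>)"
proof (rule square_summable_finite_support, rule finite_subset)
  let ?F = "{h \<in> carrier H. \<phi> (q h) \<noteq> 0}" and ?X = "{x \<in> carrier G. \<phi> x \<noteq> 0}"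
  show "{p \<in> carrier H \<times> carrier G. product_fun \<phi> p \<noteq> 0} \<subseteq>
      (\<Union>h\<in>?F. \<Union>x\<in>?X. {(h, x \<otimes> inv (q h))})"
  proof
    fix p assume "p \<in> {p \<in> carrier H \<times> carrier G. product_fun \<phi> p \<noteq> 0}"
    then obtain h z where p: "p = (h, z)" "h \<in> carrier H" "z \<in> carrier G"
      "\<phi> (q h) \<noteq> 0" "\<phi> (z \<otimes> q h) \<noteq> 0"
      by (auto simp: product_fun_def)
    then have "z = (z \<otimes> q h) \<otimes> inv (q h)" by (simp add: G.m_assoc q_closed)
    moreover have "z \<otimes> q h \<in> ?X" "h \<in> ?F" using p q_closed by auto
    ultimately show "p \<in> (\<Union>h\<in>?F. \<Union>x\<in>?X. {(h, x \<otimes> inv (q h))})"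
      using p(1) by blast
  qed
  show "finite (\<Union>h\<in>?F. \<Union>x\<in>?X. {(h, x \<otimes> inv (q h))})"
    using fin finite_support_pullback[OF fin] by blast
qed

lemma inner_on_product_fun:
  assumes fin: "finite {x \<in> carrier G. \<phi> x \<noteq> 0}" and g: "g \<in> carrier H"
  shows "inner_on (carrier H \<times> carrier G) (product_fun \<phi>) (\<lambda>p. product_fun \<phi> (product_act p g)) =
    (\<Sum>\<^sub>\<infinity>h\<in>carrier H. \<phi> (q h) * \<phi> (q (h \<otimes>\<^bsub>H\<^esub> g)) *
      inner_on (carrier G) \<phi> (\<lambda>x. \<phi> (x \<otimes> jump h g)))"
proof -
  let ?f = "\<lambda>h z. product_fun \<phi> (h, z) * product_fun \<phi> (product_act (h, z) g)"
  note ss = square_summable_product_fun[OF fin]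
  have "(\<lambda>(h, z). ?f h z) summable_on carrier H \<times> carrier G"
    using summable_on_mult[OF ss PA.square_summable_translate[OF g ss]]
    by (simp add: case_prod_unfold)
  then have "inner_on (carrier H \<times> carrier G) (product_fun \<phi>) (\<lambda>p. product_fun \<phi> (product_act p g)) =
      (\<Sum>\<^sub>\<infinity>h\<in>carrier H. \<Sum>\<^sub>\<infinity>z\<in>carrier G. ?f h z)"
    unfolding inner_on_def by (subst infsum_Sigma'_banach) (simp_all add: case_prod_unfold)
  also have "\<dots> = (\<Sum>\<^sub>\<infinity>h\<in>carrier H. \<phi> (q h) * \<phi> (q (h \<otimes>\<^bsub>H\<^esub> g)) *
      inner_on (carrier G) \<phi> (\<lambda>x. \<phi> (x \<otimes> jump h g)))"
  proof (rule infsum_cong)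
    fix h assume h: "h \<in> carrier H"
    have "(\<Sum>\<^sub>\<infinity>z\<in>carrier G. ?f h z) =
        (\<Sum>\<^sub>\<infinity>z\<in>carrier G. \<phi> (q h) * \<phi> (q (h \<otimes>\<^bsub>H\<^esub> g)) *
          (\<phi> (z \<otimes> q h) * \<phi> ((z \<otimes> q h) \<otimes> jump h g)))"
      using h g
      by (intro infsum_cong)
        (simp add: product_fun_def product_act_def G.m_assoc q_closed jump_closed mult_jump)
    also have "\<dots> = \<phi> (q h) * \<phi> (q (h \<otimes>\<^bsub>H\<^esub> g)) *
        inner_on (carrier G) (\<lambda>z. \<phi> (z \<otimes> q h)) (\<lambda>z. \<phi> ((z \<otimes> q h) \<otimes> jump h g))"
      unfolding inner_on_def by (rule infsum_cmult_right')
    also have "inner_on (carrier G) (\<lambda>z. \<phi> (z \<otimes> q h)) (\<lambda>z. \<phi> ((z \<otimes> q h) \<otimes> jump h g)) =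
        inner_on (carrier G) \<phi> (\<lambda>x. \<phi> (x \<otimes> jump h g))"
      using GA.inner_on_translate[of "q h" \<phi> "\<lambda>x. \<phi> (x \<otimes> jump h g)"] q_closed[OF h] by simp
    finally show "(\<Sum>\<^sub>\<infinity>z\<in>carrier G. ?f h z) = \<phi> (q h) * \<phi> (q (h \<otimes>\<^bsub>H\<^esub> g)) *
        inner_on (carrier G) \<phi> (\<lambda>x. \<phi> (x \<otimes> jump h g))" .
  qed
  finally show ?thesis .
qed

lemma norm_sq_product_fun:
  assumes fin: "finite {x \<in> carrier G. \<phi> x \<noteq> 0}"
  shows "norm_sq (carrier H \<times> carrier G) (product_fun \<phi>) =
    norm_sq (carrier H) (\<lambda>h. \<phi> (q h)) * norm_sq (carrier G) \<phi>"
proof -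
  have "norm_sq (carrier H \<times> carrier G) (product_fun \<phi>) =
    inner_on (carrier H \<times> carrier G) (product_fun \<phi>) (\<lambda>p. product_fun \<phi> (product_act p \<one>\<^bsub>H\<^esub>))"
    unfolding norm_sq_def by (intro inner_on_cong) (auto simp: PA.act_one)
  also have "\<dots> = (\<Sum>\<^sub>\<infinity>h\<in>carrier H. (\<phi> (q h))\<^sup>2 * norm_sq (carrier G) \<phi>)"
    unfolding inner_on_product_fun[OF fin H.one_closed]
  proof (rule infsum_cong)
    fix h assume h: "h \<in> carrier H"
    have "inner_on (carrier G) \<phi> (\<lambda>x. \<phi> (x \<otimes> jump h \<one>\<^bsub>H\<^esub>)) = norm_sq (carrier G) \<phi>"
      unfolding norm_sq_def using h by (intro inner_on_cong) (simp_all add: jump_def q_closed)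
    then show "\<phi> (q h) * \<phi> (q (h \<otimes>\<^bsub>H\<^esub> \<one>\<^bsub>H\<^esub>)) *
        inner_on (carrier G) \<phi> (\<lambda>x. \<phi> (x \<otimes> jump h \<one>\<^bsub>H\<^esub>)) = (\<phi> (q h))\<^sup>2 * norm_sq (carrier G) \<phi>"
      using h by (simp add: power2_eq_square)
  qed
  also have "\<dots> = norm_sq (carrier H) (\<lambda>h. \<phi> (q h)) * norm_sq (carrier G) \<phi>"
    unfolding norm_sq_eq[of "carrier H"] by (rule infsum_cmult_left')
  finally show ?thesis .
qed

lemma inner_on_pullback_translate:
  assumes fin: "finite {x \<in> carrier G. \<phi> x \<noteq> 0}" and g: "g \<in> carrier H"
  shows "(\<Sum>\<^sub>\<infinity>h\<in>carrier H. \<phi> (q h) * \<phi> (q (h \<otimes>\<^bsub>H\<^esub> g))) =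
    norm_sq (carrier H) (\<lambda>h. \<phi> (q h)) - disp_H (\<lambda>h. \<phi> (q h)) g / 2"
  using HA.displacement_eq[OF g square_summable_pullback[OF square_summable_finite_support[OF fin]]]
  by (simp add: inner_on_def)

text \<open>In the formula of \<open>inner_on_product_fun\<close>, replace the inner products on \<open>G\<close> by a common lower bound,
  here, and by the common upper bound \<open>\<parallel>\<phi>\<parallel>\<^sup>2 / 2\<close> in the next lemma.\<close>

lemma displacement_product_fun_le:
  assumes fin: "finite {x \<in> carrier G. \<phi> x \<noteq> 0}" and nonneg: "\<And>x. 0 \<le> \<phi> x"
    and g: "g \<in> carrier H" and "0 \<le> \<delta>"
    and \<delta>: "\<And>h. h \<in> carrier H \<Longrightarrow> disp_G \<phi> (jump h g) \<le> \<delta>"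
  shows "disp_P (product_fun \<phi>) g \<le>
    norm_sq (carrier G) \<phi> * disp_H (\<lambda>h. \<phi> (q h)) g +
    \<delta> * norm_sq (carrier H) (\<lambda>h. \<phi> (q h))"
proof -
  define \<xi> where "\<xi> = (\<lambda>h. \<phi> (q h))"
  define n where "n = norm_sq (carrier G) \<phi>"
  define d where "d = disp_H \<xi> g"
  define I where "I = inner_on (carrier H \<times> carrier G) (product_fun \<phi>) (\<lambda>p. product_fun \<phi> (product_act p g))"
  note ss = square_summable_finite_support[OF fin]
  note fin' = finite_support_pullback[OF fin]
  have "(\<Sum>\<^sub>\<infinity>h\<in>carrier H. \<xi> h * \<xi> (h \<otimes>\<^bsub>H\<^esub> g) * (n - \<delta> / 2)) \<le> I"
    unfolding I_def inner_on_product_fun[OF fin g]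
  proof (rule infsum_mono)
    show "(\<lambda>h. \<xi> h * \<xi> (h \<otimes>\<^bsub>H\<^esub> g) * (n - \<delta> / 2)) summable_on carrier H"
      by (rule summable_on_finite_support, rule finite_subset[OF _ fin']) (auto simp: \<xi>_def)
    show "(\<lambda>h. \<phi> (q h) * \<phi> (q (h \<otimes>\<^bsub>H\<^esub> g)) *
        inner_on (carrier G) \<phi> (\<lambda>x. \<phi> (x \<otimes> jump h g))) summable_on carrier H"
      by (rule summable_on_finite_support, rule finite_subset[OF _ fin']) auto
    fix h assume h: "h \<in> carrier H"
    have "n - \<delta> / 2 \<le> inner_on (carrier G) \<phi> (\<lambda>x. \<phi> (x \<otimes> jump h g))"
      using GA.displacement_eq[OF jump_closed[OF h g] ss] \<delta>[OF h] by (simp add: n_def)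
    then show "\<xi> h * \<xi> (h \<otimes>\<^bsub>H\<^esub> g) * (n - \<delta> / 2) \<le> \<phi> (q h) * \<phi> (q (h \<otimes>\<^bsub>H\<^esub> g)) *
        inner_on (carrier G) \<phi> (\<lambda>x. \<phi> (x \<otimes> jump h g))"
      unfolding \<xi>_def using nonneg by (intro mult_left_mono) auto
  qed
  also have "(\<Sum>\<^sub>\<infinity>h\<in>carrier H. \<xi> h * \<xi> (h \<otimes>\<^bsub>H\<^esub> g) * (n - \<delta> / 2)) =
      (norm_sq (carrier H) \<xi> - d / 2) * (n - \<delta> / 2)"
    unfolding \<xi>_def d_def infsum_cmult_left' inner_on_pullback_translate[OF fin g] ..
  finally have "(norm_sq (carrier H) \<xi> - d / 2) * (n - \<delta> / 2) \<le> I" .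
  moreover have "disp_P (product_fun \<phi>) g =
      2 * (norm_sq (carrier H) \<xi> * n) - 2 * I"
    unfolding PA.displacement_eq[OF g square_summable_product_fun[OF fin]] norm_sq_product_fun[OF fin]
    by (simp add: I_def \<xi>_def n_def)
  moreover have "0 \<le> d * \<delta>" using \<open>0 \<le> \<delta>\<close> by (simp add: d_def)
  ultimately have "disp_P (product_fun \<phi>) g \<le>
      n * d + \<delta> * norm_sq (carrier H) \<xi>"
    by (simp add: algebra_simps)
  then show ?thesis by (simp add: n_def d_def \<xi>_def)
qed

lemma displacement_product_fun_ge:
  assumes fin: "finite {x \<in> carrier G. \<phi> x \<noteq> 0}" and nonneg: "\<And>x. 0 \<le> \<phi> x"
    and g: "g \<in> carrier H"
    and half: "\<And>h. h \<in> carrier H \<Longrightarrow>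
      inner_on (carrier G) \<phi> (\<lambda>x. \<phi> (x \<otimes> jump h g)) \<le> norm_sq (carrier G) \<phi> / 2"
  shows "norm_sq (carrier H \<times> carrier G) (product_fun \<phi>) \<le>
    disp_P (product_fun \<phi>) g"
proof -
  define \<xi> where "\<xi> = (\<lambda>h. \<phi> (q h))"
  define n where "n = norm_sq (carrier G) \<phi>"
  define I where "I = inner_on (carrier H \<times> carrier G) (product_fun \<phi>) (\<lambda>p. product_fun \<phi> (product_act p g))"
  note fin' = finite_support_pullback[OF fin]
  have "I \<le> (\<Sum>\<^sub>\<infinity>h\<in>carrier H. \<xi> h * \<xi> (h \<otimes>\<^bsub>H\<^esub> g) * (n / 2))"
    unfolding I_def inner_on_product_fun[OF fin g]
  proof (rule infsum_mono)
    show "(\<lambda>h. \<xi> h * \<xi> (h \<otimes>\<^bsub>H\<^esub> g) * (n / 2)) summable_on carrier H"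
      by (rule summable_on_finite_support, rule finite_subset[OF _ fin']) (auto simp: \<xi>_def)
    show "(\<lambda>h. \<phi> (q h) * \<phi> (q (h \<otimes>\<^bsub>H\<^esub> g)) *
        inner_on (carrier G) \<phi> (\<lambda>x. \<phi> (x \<otimes> jump h g))) summable_on carrier H"
      by (rule summable_on_finite_support, rule finite_subset[OF _ fin']) auto
    fix h assume h: "h \<in> carrier H"
    show "\<phi> (q h) * \<phi> (q (h \<otimes>\<^bsub>H\<^esub> g)) * inner_on (carrier G) \<phi> (\<lambda>x. \<phi> (x \<otimes> jump h g)) \<le>
        \<xi> h * \<xi> (h \<otimes>\<^bsub>H\<^esub> g) * (n / 2)"
      unfolding \<xi>_def n_def using nonneg half[OF h] by (intro mult_left_mono) auto
  qed
  also have "\<dots> = (norm_sq (carrier H) \<xi> - disp_H \<xi> g / 2) * (n / 2)"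
    unfolding \<xi>_def infsum_cmult_left' inner_on_pullback_translate[OF fin g] ..
  also have "\<dots> \<le> norm_sq (carrier H) \<xi> * (n / 2)"
    by (intro mult_right_mono) (auto simp: n_def)
  finally have "2 * I \<le> n * norm_sq (carrier H) \<xi>" by (simp add: mult.commute)
  then show ?thesis
    unfolding PA.displacement_eq[OF g square_summable_product_fun[OF fin]] norm_sq_product_fun[OF fin]
    by (simp add: I_def \<xi>_def n_def mult.commute[of "norm_sq (carrier G) \<phi>"])
qed

definition nearly_invariant :: "real \<Rightarrow> ('a \<Rightarrow> real) \<Rightarrow> bool" where
  "nearly_invariant \<epsilon> \<phi> \<longleftrightarrow> finite {x \<in> carrier G. \<phi> x \<noteq> 0} \<and> (\<forall>x. 0 \<le> \<phi> x) \<and> 0 < norm_sq (carrier G) \<phi> \<and>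
     (\<forall>y\<in>carrier G. disp_G \<phi> y \<le> \<epsilon> * (word_length G S y)\<^sup>2 * norm_sq (carrier G) \<phi>)"

text \<open>The constants do not depend on \<open>\<phi>\<close>. The threshold for \<open>\<epsilon>\<close> is what \<open>norm_sq_le_pullback\<close> requires: half of
  \<open>\<parallel>\<phi>\<parallel>\<^sup>2\<close> must remain when the displacement term on its right hand side is subtracted.\<close>

lemma displacement_product_fun_bound:
  obtains c \<epsilon>\<^sub>0 :: real where "c > 0" "\<epsilon>\<^sub>0 > 0"
    and "\<And>\<phi> \<epsilon> g. nearly_invariant \<epsilon> \<phi> \<Longrightarrow> 0 \<le> \<epsilon> \<Longrightarrow> \<epsilon> \<le> \<epsilon>\<^sub>0 \<Longrightarrow> g \<in> carrier H \<Longrightarrow>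
      norm_sq (carrier H \<times> carrier G) (product_fun \<phi>) > 0 \<and>
      disp_P (product_fun \<phi>) g \<le>
        c * \<epsilon> * (word_length H T g)\<^sup>2 * norm_sq (carrier H \<times> carrier G) (product_fun \<phi>)"
proof -
  define V where "V = real multiplicity_bound"
  define Y where "Y = {y \<in> carrier G. real (word_length G S y) \<le> a + b}"
  define Z where "Z = {y \<in> carrier G. real (word_length G S y) \<le> b}"
  define W where "W = real (card Z)"
  define c\<^sub>1 where "c\<^sub>1 = card T * V * card Y * (a + b)\<^sup>2"
  define c where "c = c\<^sub>1 * (4 * W) + (a + b)\<^sup>2"
  have nn: "V \<ge> 0" "W \<ge> 0" "c\<^sub>1 \<ge> 0" "a + b > 0"
    using a_ge_1 b_nonneg by (auto simp: V_def W_def c\<^sub>1_def)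
  show thesis
  proof (rule that)
    show "c > 0" using nn by (auto simp: c_def intro!: add_nonneg_pos)
    show "1 / (4 * V * W * b\<^sup>2 + 1) > 0" using nn by (auto intro!: add_nonneg_pos)
    fix \<phi> :: "'a \<Rightarrow> real" and \<epsilon> g
    assume "nearly_invariant \<epsilon> \<phi>" and \<epsilon>: "0 \<le> \<epsilon>" "\<epsilon> \<le> 1 / (4 * V * W * b\<^sup>2 + 1)" and g: "g \<in> carrier H"
    then have fin: "finite {x \<in> carrier G. \<phi> x \<noteq> 0}" and nonneg: "\<And>x. 0 \<le> \<phi> x"
      and pos: "norm_sq (carrier G) \<phi> > 0"
      and disp: "\<And>y. y \<in> carrier G \<Longrightarrow> disp_G \<phi> y \<le> \<epsilon> * (word_length G S y)\<^sup>2 * norm_sq (carrier G) \<phi>"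
      by (auto simp: nearly_invariant_def)
    define \<xi> where "\<xi> = (\<lambda>h. \<phi> (q h))"
    define n where "n = norm_sq (carrier G) \<phi>"
    define k where "k = norm_sq (carrier H) \<xi>"
    define l where "l = real (word_length H T g)"
    have n: "n > 0" using pos by (simp add: n_def)
    note ss = square_summable_finite_support[OF fin]
    have ss\<xi>: "square_summable (carrier H) \<xi>" unfolding \<xi>_def by (rule square_summable_pullback[OF ss])
    have disp_ball: "disp_G \<phi> y \<le> \<epsilon> * r\<^sup>2 * n"
      if "y \<in> carrier G" "real (word_length G S y) \<le> r" for y r
    proof -
      have "(real (word_length G S y))\<^sup>2 \<le> r\<^sup>2" using that(2) by (intro power_mono) auto
      then have "\<epsilon> * (real (word_length G S y))\<^sup>2 * n \<le> \<epsilon> * r\<^sup>2 * n"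
        using \<epsilon>(1) n by (intro mult_right_mono mult_left_mono) auto
      then show ?thesis using disp[OF that(1)] by (simp add: n_def)
    qed
    have nk: "n \<le> 4 * W * k"
    proof -
      have "(\<Sum>y\<in>Z. disp_G \<phi> y) \<le> W * (\<epsilon> * b\<^sup>2 * n)"
        unfolding W_def by (rule sum_bounded_above) (auto simp: Z_def intro: disp_ball)
      then have "2 * (V * (\<Sum>y\<in>Z. disp_G \<phi> y)) \<le> 2 * (V * (W * (\<epsilon> * b\<^sup>2 * n)))"
        using nn by (intro mult_left_mono) auto
      moreover have "n \<le> 2 * W * k + 2 * (V * (\<Sum>y\<in>Z. disp_G \<phi> y))"
        using norm_sq_le_pullback[OF ss] by (simp add: n_def W_def k_def \<xi>_def V_def Z_def)
      moreover have "4 * V * W * b\<^sup>2 * \<epsilon> \<le> 1"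
      proof -
        have p: "0 < 4 * V * W * b\<^sup>2 + 1" using nn by (auto intro!: add_nonneg_pos)
        have "\<epsilon> * (4 * V * W * b\<^sup>2 + 1) \<le> 1" using \<epsilon>(2) p by (simp only: pos_le_divide_eq)
        then show ?thesis using \<epsilon>(1) by (simp add: algebra_simps)
      qed
      then have "4 * V * W * b\<^sup>2 * \<epsilon> * n \<le> 1 * n" using n by (intro mult_right_mono) auto
      ultimately show ?thesis by (simp add: mult_ac)
    qed
    have k: "k > 0"
      using n nk nn norm_sq_nonneg[of "carrier H" \<xi>] unfolding k_def[symmetric]
      by (cases "k = 0") auto
    have norm: "norm_sq (carrier H \<times> carrier G) (product_fun \<phi>) = k * n"
      by (simp add: norm_sq_product_fun[OF fin] k_def n_def \<xi>_def)
    have gen: "disp_H \<xi> t \<le> V * (card Y * (\<epsilon> * (a + b)\<^sup>2 * n))" if t: "t \<in> T" for t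
    proof -
      have "(\<Sum>y\<in>Y. disp_G \<phi> y) \<le> card Y * (\<epsilon> * (a + b)\<^sup>2 * n)"
        by (rule sum_bounded_above) (auto simp: Y_def intro: disp_ball)
      then have "V * (\<Sum>y\<in>Y. disp_G \<phi> y) \<le> V * (card Y * (\<epsilon> * (a + b)\<^sup>2 * n))"
        using nn by (intro mult_left_mono) auto
      then show ?thesis
        using displacement_pullback_generator[OF ss t] by (simp add: \<xi>_def V_def Y_def)
    qed
    have "(\<Sum>t\<in>T. disp_H \<xi> t) \<le> card T * (V * (card Y * (\<epsilon> * (a + b)\<^sup>2 * n)))"
      by (rule sum_bounded_above) (rule gen)
    then have "energy (carrier H) T (\<otimes>\<^bsub>H\<^esub>) \<xi> \<le> card T * (V * (card Y * (\<epsilon> * (a + b)\<^sup>2 * n))) / (4 * card T)"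
      unfolding energy_def by (intro divide_right_mono) auto
    also have "\<dots> = V * card Y * (a + b)\<^sup>2 * \<epsilon> * n / 4"
      using H.card_generators_pos by simp
    finally have "4 * card T * (word_length H T g)\<^sup>2 * energy (carrier H) T (\<otimes>\<^bsub>H\<^esub>) \<xi> \<le>
        4 * card T * (word_length H T g)\<^sup>2 * (V * card Y * (a + b)\<^sup>2 * \<epsilon> * n / 4)"
      by (intro mult_left_mono) auto
    also have "\<dots> = c\<^sub>1 * \<epsilon> * l\<^sup>2 * n" by (simp add: c\<^sub>1_def l_def)
    also have "\<dots> \<le> c\<^sub>1 * \<epsilon> * l\<^sup>2 * (4 * W * k)"
      using nk nn \<epsilon>(1) by (intro mult_left_mono) auto
    finally have d\<xi>: "disp_H \<xi> g \<le> c\<^sub>1 * \<epsilon> * l\<^sup>2 * (4 * W * k)"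
      using HA.displacement_le_energy[OF ss\<xi> g] by linarith
    have "disp_P (product_fun \<phi>) g \<le> c * \<epsilon> * l\<^sup>2 * (k * n)"
    proof (cases "g = \<one>\<^bsub>H\<^esub>")
      case True
      then show ?thesis using nn \<epsilon>(1) k n by (simp add: PA.displacement_one c_def)
    next
      case False
      then have l: "l \<ge> 1" using H.word_length_pos[OF g] by (simp add: l_def)
      then have "b * 1 \<le> b * l" using b_nonneg by (intro mult_left_mono) auto
      then have "a * l + b \<le> (a + b) * l" by (simp add: algebra_simps)
      then have "disp_G \<phi> (jump h g) \<le> \<epsilon> * ((a + b) * l)\<^sup>2 * n"
        if "h \<in> carrier H" for h
        using jump_le[OF that g] jump_closed[OF that g] by (intro disp_ball) (auto simp: jump_def l_def)
      then have "disp_P (product_fun \<phi>) g \<le>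
          n * disp_H \<xi> g + \<epsilon> * ((a + b) * l)\<^sup>2 * n * k"
        using displacement_product_fun_le[OF fin nonneg g, of "\<epsilon> * ((a + b) * l)\<^sup>2 * n"] \<epsilon>(1) n
        by (simp add: n_def k_def \<xi>_def)
      also have "\<dots> \<le> n * (c\<^sub>1 * \<epsilon> * l\<^sup>2 * (4 * W * k)) + \<epsilon> * ((a + b) * l)\<^sup>2 * n * k"
        using d\<xi> n by (intro add_right_mono mult_left_mono) auto
      also have "\<dots> = c * \<epsilon> * l\<^sup>2 * (k * n)"
        unfolding power_mult_distrib c_def by (simp add: algebra_simps)
      finally show ?thesis .
    qed
    then show "norm_sq (carrier H \<times> carrier G) (product_fun \<phi>) > 0 \<and>
      disp_P (product_fun \<phi>) g \<le>
        c * \<epsilon> * (word_length H T g)\<^sup>2 * norm_sq (carrier H \<times> carrier G) (product_fun \<phi>)"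
      unfolding norm using k n by (simp add: l_def)
  qed
qed

end

text \<open>For every scale \<open>R\<close> some nonnegative unit vector is moved little by short group elements, but by at
  least \<open>1\<close> by all elements of length at least \<open>R\<close>. The larger \<open>\<alpha>\<close>, the less the short elements move it.\<close>

definition disperses ::
  "('b, 'n) monoid_scheme \<Rightarrow> 'b set \<Rightarrow> 'x set \<Rightarrow> ('x \<Rightarrow> 'b \<Rightarrow> 'x) \<Rightarrow> real \<Rightarrow> bool" where
  "disperses H T A act \<alpha> \<longleftrightarrow> (\<exists>C>0. \<forall>R\<ge>1::real. \<exists>u. square_summable A u \<and> (\<forall>x. 0 \<le> u x) \<and> norm_sq A u = 1 \<and>
     (\<forall>g\<in>carrier H. displacement A act u g \<le> C * (real (word_length H T g))\<^sup>2 * R powr (- 2 * \<alpha>) \<and>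
       (R \<le> real (word_length H T g) \<longrightarrow> 1 \<le> displacement A act u g)))"

text \<open>At this distance the Gaussian factor has dropped to at most \<open>1 / (2 N)\<close>.\<close>

lemma (in generated_group) gaussian_half:
  assumes "M > 0" "N > 0" "m \<ge> 1" "y \<in> carrier G"
    and gauss: "\<forall>n\<ge>1. \<forall>g\<in>carrier G. heat n g \<le>
      heat n \<one> * N * exp (- M * (real (word_length G S g))\<^sup>2 / real n)"
    and far: "sqrt (2 * \<bar>ln (2 * N)\<bar> / M) * sqrt m \<le> word_length G S y"
  shows "inner_on (carrier G) (heat m) (\<lambda>x. heat m (x \<otimes> y)) \<le>
    norm_sq (carrier G) (heat m) / 2"
proof -
  let ?l = "real (word_length G S y)"
  have "(sqrt (2 * \<bar>ln (2 * N)\<bar> / M) * sqrt m)\<^sup>2 \<le> ?l\<^sup>2"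
    using far \<open>M > 0\<close> by (intro power_mono) auto
  then have "2 * \<bar>ln (2 * N)\<bar> / M * m \<le> ?l\<^sup>2" using \<open>M > 0\<close> by (simp add: power_mult_distrib)
  then have "2 * \<bar>ln (2 * N)\<bar> * m \<le> M * ?l\<^sup>2" using \<open>M > 0\<close> by (simp add: field_simps)
  then have "\<bar>ln (2 * N)\<bar> \<le> M * ?l\<^sup>2 / real (2 * m)" using \<open>m \<ge> 1\<close> by (simp add: field_simps)
  then have "exp (- M * ?l\<^sup>2 / real (2 * m)) \<le> exp (- ln (2 * N))" by simp
  also have "\<dots> = 1 / (2 * N)" using \<open>N > 0\<close> by (simp add: exp_minus field_simps)
  finally have "N * exp (- M * ?l\<^sup>2 / real (2 * m)) \<le> N * (1 / (2 * N))"
    using \<open>N > 0\<close> by (intro mult_left_mono) auto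
  also have "\<dots> = 1 / 2" using \<open>N > 0\<close> by simp
  finally have "heat (2 * m) \<one> * (N * exp (- M * ?l\<^sup>2 / real (2 * m))) \<le>
      heat (2 * m) \<one> * (1 / 2)" by (intro mult_left_mono) auto
  moreover have "heat (2 * m) y \<le>
      heat (2 * m) \<one> * N * exp (- M * ?l\<^sup>2 / real (2 * m))"
    using gauss[rule_format, of "2 * m" y] assms by simp
  ultimately show ?thesis
    using \<open>y \<in> carrier G\<close> by (simp add: pmf_lazy_walk_double norm_sq_lazy_walk mult.assoc)
qed

lemma displacement_cmult: "displacement A act (\<lambda>x. c * u x) g = c\<^sup>2 * displacement A act u g"
  unfolding displacement_def right_diff_distrib[symmetric] by (rule norm_sq_cmult)

lemma (in right_action) displacement_point:
  assumes "x \<in> A" "g \<in> carrier G" "act x g \<noteq> x"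
  shows "1 \<le> displacement A act (indicator {x}) g"
proof -
  have "displacement A act (indicator {x}) g = 2 - 2 * indicator {x} (act x g)"
    unfolding displacement_eq[OF assms(2) square_summable_point] norm_sq_def
    by (simp add: inner_on_point[OF assms(1)])
  then show ?thesis using assms(3) by simp
qed

context coarse_map
begin

text \<open>At scale \<open>R\<close>, use the heat kernel at a time \<open>m\<close> of order \<open>R\<^sup>2\<close>. Its displacements are of order
  \<open>m\<^sup>\<gamma>\<^sup>-\<^sup>1\<close>, and its translates by elements longer than a multiple of \<open>m\<^sup>1\<^sup>/\<^sup>2\<close> are far away.\<close>

lemma disperses_product:
  fixes K L M N \<gamma> :: real
  assumes S\<^sub>1: "generated_group G S\<^sub>1"
    and KL: "K > 0" "L > 0" and \<gamma>: "0 \<le> \<gamma>" "\<gamma> < 1"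
    and lower: "\<forall>n\<ge>1. pmf (lazy_walk G S\<^sub>1 n) \<one> \<ge> K * exp (- L * real n powr \<gamma>)"
    and MN: "M > 0" "N > 0"
    and gauss: "\<forall>n\<ge>1. \<forall>g\<in>carrier G. pmf (lazy_walk G S n) g \<le>
      pmf (lazy_walk G S n) \<one> * N * exp (- M * (real (word_length G S g))\<^sup>2 / real n)"
  shows "disperses H T (carrier H \<times> carrier G) product_act (1 - \<gamma>)"
proof -
  let ?A = "carrier H \<times> carrier G"
  obtain c \<epsilon>\<^sub>0 :: real where c: "c > 0" "\<epsilon>\<^sub>0 > 0"
    and bound: "\<And>\<phi> \<epsilon> g. nearly_invariant \<epsilon> \<phi> \<Longrightarrow> 0 \<le> \<epsilon> \<Longrightarrow> \<epsilon> \<le> \<epsilon>\<^sub>0 \<Longrightarrow> g \<in> carrier H \<Longrightarrow>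
      norm_sq ?A (product_fun \<phi>) > 0 \<and>
      disp_P (product_fun \<phi>) g \<le>
        c * \<epsilon> * (word_length H T g)\<^sup>2 * norm_sq ?A (product_fun \<phi>)"
    using displacement_product_fun_bound by blast
  obtain C m\<^sub>0 where C: "C > 0" "m\<^sub>0 \<ge> 1"
    and heat: "\<And>m g. m \<ge> m\<^sub>0 \<Longrightarrow> g \<in> carrier G \<Longrightarrow>
      disp_G (pmf (lazy_walk G S m)) g \<le>
        C * real m powr (\<gamma> - 1) * (word_length G S g)\<^sup>2 * norm_sq (carrier G) (pmf (lazy_walk G S m))"
    using heat_kernel_displacement[OF S\<^sub>1 G.generated_group_axioms KL \<gamma> lower] by blast
  have "((\<lambda>m. C * real m powr (\<gamma> - 1)) \<longlongrightarrow> C * 0) sequentially"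
    using \<gamma> by (intro tendsto_mult_left tendsto_neg_powr filterlim_real_sequentially) auto
  then have "\<forall>\<^sub>F m in sequentially. C * real m powr (\<gamma> - 1) < \<epsilon>\<^sub>0"
    using c(2) by (intro order_tendstoD) simp_all
  then obtain m\<^sub>1 where m\<^sub>1: "\<And>m. m \<ge> m\<^sub>1 \<Longrightarrow> C * real m powr (\<gamma> - 1) < \<epsilon>\<^sub>0"
    by (auto simp: eventually_sequentially)
  define m\<^sub>2 where "m\<^sub>2 = max m\<^sub>0 m\<^sub>1"
  have m\<^sub>2: "m\<^sub>2 \<ge> 1" "m\<^sub>2 \<ge> m\<^sub>0" "m\<^sub>2 \<ge> m\<^sub>1" using C(2) by (auto simp: m\<^sub>2_def)
  \<comment> \<open>An element of length at least \<open>D\<close> times \<open>sqrt m\<close> jumps by at least \<open>E\<close> times \<open>sqrt m\<close> in \<open>G\<close>: the factor \<open>a\<close> and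
    the constant \<open>b\<close> undo the distortion of \<open>q\<close>, and the summand \<open>1\<close> makes \<open>D \<ge> 1\<close>.\<close>
  define E where "E = sqrt (2 * \<bar>ln (2 * N)\<bar> / M)"
  have E: "E \<ge> 0" using MN by (simp add: E_def)
  define D where "D = a * (E + b + 1)"
  have "1 * 1 \<le> a * (E + b + 1)" using a_ge_1 b_nonneg E by (intro mult_mono) auto
  then have D: "D \<ge> 1" by (simp add: D_def)
  define C' where "C' = max (c * C * (2 * D\<^sup>2)) (4 * D\<^sup>2 * m\<^sub>2)"
  show ?thesis
    unfolding disperses_def
  proof (intro exI[of _ C'] conjI allI impI)
    show "C' > 0" using c C D by (auto simp: C'_def less_max_iff_disj)
    fix R :: real assume R: "R \<ge> 1"
    define m where "m = nat \<lfloor>(R / D)\<^sup>2\<rfloor>"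
    show "\<exists>u. square_summable ?A u \<and> (\<forall>x. 0 \<le> u x) \<and> norm_sq ?A u = 1 \<and>
      (\<forall>g\<in>carrier H. disp_P u g \<le>
          C' * (real (word_length H T g))\<^sup>2 * R powr (- 2 * (1 - \<gamma>)) \<and>
        (R \<le> word_length H T g \<longrightarrow> 1 \<le> disp_P u g))"
    proof (cases "m \<ge> m\<^sub>2")
      case True
      define \<phi> where "\<phi> = pmf (lazy_walk G S m)"
      define \<epsilon> where "\<epsilon> = C * real m powr (\<gamma> - 1)"
      have m1: "m \<ge> 1" using True m\<^sub>2 by linarith
      have fin: "finite {x \<in> carrier G. \<phi> x \<noteq> 0}"
        by (rule finite_subset[OF _ G.set_lazy_walk(1)[of m]]) (auto simp: \<phi>_def set_pmf_iff)
      have nonneg: "\<And>x. 0 \<le> \<phi> x" by (simp add: \<phi>_def)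
      have \<epsilon>: "0 \<le> \<epsilon>" "\<epsilon> \<le> \<epsilon>\<^sub>0" using C m\<^sub>1[of m] m\<^sub>2 True by (auto simp: \<epsilon>_def)
      have disp: "disp_G \<phi> y \<le> \<epsilon> * (word_length G S y)\<^sup>2 * norm_sq (carrier G) \<phi>"
        if "y \<in> carrier G" for y
        using heat[of m y] that True m\<^sub>2 by (simp add: \<phi>_def \<epsilon>_def)
      have inv: "nearly_invariant \<epsilon> \<phi>"
        unfolding nearly_invariant_def
        using fin disp G.norm_sq_lazy_walk_pos[of m] by (simp add: \<phi>_def)
      have B: "norm_sq ?A (product_fun \<phi>) > 0 \<and>
          disp_P (product_fun \<phi>) g \<le>
            c * \<epsilon> * (word_length H T g)\<^sup>2 * norm_sq ?A (product_fun \<phi>)"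
        if "g \<in> carrier H" for g
        by (rule bound[OF inv \<epsilon> that])
      define n where "n = norm_sq ?A (product_fun \<phi>)"
      have n: "n > 0" using B[OF H.one_closed] by (simp add: n_def)
      define u where "u = (\<lambda>p. (1 / sqrt n) * product_fun \<phi> p)"
      have du: "disp_P u g = disp_P (product_fun \<phi>) g / n" for g
        unfolding u_def displacement_cmult using n by (simp add: power_divide)
      have mR: "(R / D)\<^sup>2 / 2 \<le> m" "m \<le> (R / D)\<^sup>2"
      proof -
        have "real m = of_int \<lfloor>(R / D)\<^sup>2\<rfloor>" by (simp add: m_def)
        moreover have "1 \<le> \<lfloor>(R / D)\<^sup>2\<rfloor>" using m1 unfolding m_def by linarith
        ultimately show "(R / D)\<^sup>2 / 2 \<le> real m" "real m \<le> (R / D)\<^sup>2" by linarith+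
      qed
      have "real m powr (\<gamma> - 1) \<le> (R\<^sup>2 / (2 * D\<^sup>2)) powr (\<gamma> - 1)"
        using mR(1) R D \<gamma> by (intro powr_mono2') (auto simp: power_divide field_simps)
      also have "\<dots> = R powr (2 * (\<gamma> - 1)) * (2 * D\<^sup>2) powr (1 - \<gamma>)"
        using R D by (simp add: powr_divide powr_powr powr_minus_divide flip: powr_numeral)
          (simp add: powr_minus divide_inverse flip: powr_minus)
      also have "\<dots> \<le> R powr (2 * (\<gamma> - 1)) * (2 * D\<^sup>2) powr 1"
        using \<gamma> D by (intro mult_left_mono powr_mono) (auto intro: order_trans[of 1 2] one_le_power)
      also have "\<dots> = R powr (- 2 * (1 - \<gamma>)) * (2 * D\<^sup>2)" using D by (simp add: algebra_simps)
      finally have "c * C * real m powr (\<gamma> - 1) \<le> c * C * (R powr (- 2 * (1 - \<gamma>)) * (2 * D\<^sup>2))"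
        using c C by (intro mult_left_mono) auto
      also have "\<dots> = (c * C * (2 * D\<^sup>2)) * R powr (- 2 * (1 - \<gamma>))" by simp
      also have "\<dots> \<le> C' * R powr (- 2 * (1 - \<gamma>))"
        unfolding C'_def by (intro mult_right_mono) auto
      finally have ce: "c * \<epsilon> \<le> C' * R powr (- 2 * (1 - \<gamma>))" by (simp add: \<epsilon>_def)
      show ?thesis
      proof (intro exI[of _ u] conjI ballI impI allI)
        show "square_summable ?A u" unfolding u_def
          by (intro square_summable_cmult square_summable_product_fun fin)
        show "0 \<le> u x" for x using nonneg by (simp add: u_def product_fun_def n_def)
        show "norm_sq ?A u = 1" unfolding u_def norm_sq_cmult using n by (simp add: n_def power_divide)
        fix g assume g: "g \<in> carrier H"
        have "disp_P u g \<le> c * \<epsilon> * (word_length H T g)\<^sup>2"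
          using B[OF g] n unfolding du by (simp add: n_def field_simps)
        also have "\<dots> \<le> C' * R powr (- 2 * (1 - \<gamma>)) * (word_length H T g)\<^sup>2"
          by (intro mult_right_mono ce) auto
        finally show "disp_P u g \<le>
          C' * (real (word_length H T g))\<^sup>2 * R powr (- 2 * (1 - \<gamma>))" by (simp add: mult_ac)
        assume far: "R \<le> word_length H T g"
        have "sqrt m \<le> R / D" using mR(2) R D by (intro real_le_lsqrt) auto
        then have "D * sqrt m \<le> R" using D by (simp add: field_simps)
        then have "a * ((E + b + 1) * sqrt m) \<le> word_length H T g" using far by (simp add: D_def)
        then have l: "(E + b + 1) * sqrt m \<le> word_length H T g / a"
          using a_ge_1 by (simp add: field_simps)
        have s1: "1 \<le> sqrt m" using m1 by simp
        then have "b * 1 \<le> b * sqrt m" using b_nonneg by (intro mult_left_mono) auto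
        then have "E * sqrt m \<le> word_length H T g / a - b"
          using l[unfolded distrib_right] s1 by linarith
        then have "E * sqrt m \<le> word_length G S (jump h g)" if "h \<in> carrier H" for h
          using jump_ge[OF that g] by (simp add: jump_def)
        then have "norm_sq ?A (product_fun \<phi>) \<le> disp_P (product_fun \<phi>) g"
          unfolding \<phi>_def E_def
          by (intro displacement_product_fun_ge g fin[unfolded \<phi>_def] nonneg[unfolded \<phi>_def]
              G.gaussian_half[OF MN m1 _ gauss] jump_closed)
        then show "1 \<le> disp_P u g"
          unfolding du using n by (simp add: n_def)
      qed
    next
      case False
      \<comment> \<open>Only boundedly many scales are left; a point mass serves for all of them.\<close>
      define u :: "'b \<times> 'a \<Rightarrow> real" where "u = indicator {(\<one>\<^bsub>H\<^esub>, \<one>)}"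
      have o: "(\<one>\<^bsub>H\<^esub>, \<one>) \<in> ?A" by simp
      have ss: "square_summable ?A u" unfolding u_def by (rule square_summable_point)
      have norm: "norm_sq ?A u = 1"
        unfolding norm_sq_def u_def by (simp add: inner_on_point[OF o])
      have "(R / D)\<^sup>2 \<le> m\<^sub>2" using False unfolding m_def by linarith
      then have "R\<^sup>2 \<le> D\<^sup>2 * m\<^sub>2" using D by (simp add: power_divide field_simps)
      moreover have "R powr (2 * (1 - \<gamma>)) \<le> R powr 2" using R \<gamma> by (intro powr_mono) auto
      ultimately have "R powr (2 * (1 - \<gamma>)) \<le> D\<^sup>2 * m\<^sub>2" using R by simp
      then have "4 * R powr (2 * (1 - \<gamma>)) \<le> C'" by (simp add: C'_def)
      then have "4 * R powr (2 * (1 - \<gamma>)) * R powr (- 2 * (1 - \<gamma>)) \<le> C' * R powr (- 2 * (1 - \<gamma>))"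
        by (intro mult_right_mono) auto
      moreover have "R powr (2 * (1 - \<gamma>)) * R powr (- 2 * (1 - \<gamma>)) = 1"
        using R by (simp flip: powr_add)
      ultimately have C4: "4 \<le> C' * R powr (- 2 * (1 - \<gamma>))" by simp
      show ?thesis
      proof (intro exI[of _ u] conjI ballI impI allI ss norm)
        show "0 \<le> u x" for x by (simp add: u_def)
        fix g assume g: "g \<in> carrier H"
        show "disp_P u g \<le>
          C' * (real (word_length H T g))\<^sup>2 * R powr (- 2 * (1 - \<gamma>))"
        proof (cases "g = \<one>\<^bsub>H\<^esub>")
          case False
          then have "1 \<le> word_length H T g" using H.word_length_pos[OF g] by simp
          then have "1 \<le> (real (word_length H T g))\<^sup>2" by simp
          then have "4 * 1 \<le> C' * R powr (- 2 * (1 - \<gamma>)) * (real (word_length H T g))\<^sup>2"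
            using C4 by (intro mult_mono) auto
          moreover have "disp_P u g \<le> 4"
            using PA.displacement_le_4[OF g ss] by (simp add: norm)
          ultimately show ?thesis by (simp add: mult_ac)
        qed (simp add: PA.displacement_one)
        assume "R \<le> word_length H T g"
        then have "g \<noteq> \<one>\<^bsub>H\<^esub>" using R by auto
        then show "1 \<le> disp_P u g"
          unfolding u_def using g by (intro PA.displacement_point) (auto simp: product_act_def)
      qed
    qed
  qed
qed

end

section \<open>Square-summable sequences as a Hilbert space\<close>

text \<open>The addition of the module \<open>l2\<close> replaces sequences outside the carrier by \<open>0\<close>. Thus the distance
  \<open>vdist l2\<close>, which is defined through the additive inverse, is specified and symmetric on the whole type, as
  the locale \<open>Metric_space\<close> demands.\<close>

definition l2_proj :: "(nat \<Rightarrow> real) \<Rightarrow> nat \<Rightarrow> real" where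
  "l2_proj v = (if square_summable UNIV v then v else (\<lambda>_. 0))"

definition l2 :: "(nat \<Rightarrow> real) inner_module" where
  "l2 = \<lparr>carrier = {v. square_summable UNIV v}, monoid.mult = (\<lambda>u v. u), one = (\<lambda>_. 0), ring.zero = (\<lambda>_. 0),
     add = (\<lambda>u v i. l2_proj u i + l2_proj v i), module.smult = (\<lambda>r v i. r * v i), inner_prod = inner_on UNIV\<rparr>"

lemma carrier_l2: "carrier l2 = {v. square_summable UNIV v}"
  and zero_l2: "\<zero>\<^bsub>l2\<^esub> = (\<lambda>_. 0)"
  and add_l2: "u \<oplus>\<^bsub>l2\<^esub> v = (\<lambda>i. l2_proj u i + l2_proj v i)"
  and smult_l2: "r \<odot>\<^bsub>l2\<^esub> v = (\<lambda>i. r * v i)"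
  and inner_prod_l2: "inner_prod l2 = inner_on UNIV"
  by (simp_all add: l2_def)

lemma l2_proj_eq: "square_summable UNIV v \<Longrightarrow> l2_proj v = v"
  by (simp add: l2_proj_def)

lemma square_summable_l2_proj: "square_summable UNIV (l2_proj v)"
  by (simp add: l2_proj_def)

lemma square_summable_uminus: "square_summable A v \<Longrightarrow> square_summable A (\<lambda>x. - v x)"
  using square_summable_cmult[of A v "-1"] by simp

lemma minus_l2: "u \<ominus>\<^bsub>l2\<^esub> v = (\<lambda>i. l2_proj u i - l2_proj v i)"
proof -
  have ss: "square_summable UNIV (\<lambda>i. - l2_proj v i)"
    by (intro square_summable_uminus square_summable_l2_proj)
  have "\<ominus>\<^bsub>l2\<^esub> v = (\<lambda>i. - l2_proj v i)"
    unfolding a_inv_def m_inv_def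
  proof (rule the_equality)
    show "(\<lambda>i. - l2_proj v i) \<in> carrier (add_monoid l2) \<and>
        v \<otimes>\<^bsub>add_monoid l2\<^esub> (\<lambda>i. - l2_proj v i) = \<one>\<^bsub>add_monoid l2\<^esub> \<and>
        (\<lambda>i. - l2_proj v i) \<otimes>\<^bsub>add_monoid l2\<^esub> v = \<one>\<^bsub>add_monoid l2\<^esub>"
      using ss by (simp add: carrier_l2 add_l2 zero_l2 l2_proj_eq)
    fix w assume w: "w \<in> carrier (add_monoid l2) \<and> v \<otimes>\<^bsub>add_monoid l2\<^esub> w = \<one>\<^bsub>add_monoid l2\<^esub> \<and>
        w \<otimes>\<^bsub>add_monoid l2\<^esub> v = \<one>\<^bsub>add_monoid l2\<^esub>"
    then have "l2_proj w = w" by (simp add: carrier_l2 l2_proj_eq)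
    with w have "(\<lambda>i. l2_proj v i + w i) = (\<lambda>_. 0)"
      by (simp add: add_l2 zero_l2)
    then have "l2_proj v i + w i = 0" for i by (rule fun_cong)
    then show "w = (\<lambda>i. - l2_proj v i)" by (simp add: fun_eq_iff eq_neg_iff_add_eq_0 add.commute)
  qed
  then show ?thesis using ss by (simp add: a_minus_def add_l2 l2_proj_eq)
qed

lemma vdist_l2: "vdist l2 u v = sqrt (norm_sq UNIV (\<lambda>i. l2_proj u i - l2_proj v i))"
  by (simp add: vdist_def minus_l2 inner_prod_l2 norm_sq_def)

lemma vdist_l2_eq:
  "square_summable UNIV u \<Longrightarrow> square_summable UNIV v \<Longrightarrow> vdist l2 u v = sqrt (norm_sq UNIV (\<lambda>i. u i - v i))"
  by (simp add: vdist_l2 l2_proj_eq)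

lemma norm_sq_eq_0D: "square_summable A u \<Longrightarrow> norm_sq A u = 0 \<Longrightarrow> x \<in> A \<Longrightarrow> u x = 0"
  using square_le_norm_sq[of A u x] by simp

lemma Metric_space_l2: "Metric_space (carrier l2) (vdist l2)"
proof
  show "0 \<le> vdist l2 x y" for x y by (simp add: vdist_l2)
  show "vdist l2 x y = vdist l2 y x" for x y
    unfolding vdist_l2 by (simp only: norm_sq_minus_commute[of UNIV "l2_proj x" "l2_proj y"])
  show "vdist l2 x y = 0 \<longleftrightarrow> x = y" if "x \<in> carrier l2" "y \<in> carrier l2" for x y
  proof
    assume "vdist l2 x y = 0"
    then have "norm_sq UNIV (\<lambda>i. x i - y i) = 0" using that by (simp add: carrier_l2 vdist_l2_eq)
    then have "x i - y i = 0" for i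
      using norm_sq_eq_0D[OF square_summable_diff[of UNIV x y]] that by (simp add: carrier_l2)
    then show "x = y" by (simp add: fun_eq_iff)
  qed (simp add: vdist_l2 norm_sq_eq)
  show "vdist l2 x z \<le> vdist l2 x y + vdist l2 y z"
    if "x \<in> carrier l2" "y \<in> carrier l2" "z \<in> carrier l2" for x y z
    using norm_triangle_on[of UNIV "\<lambda>i. x i - y i" "\<lambda>i. y i - z i"] that
    by (simp add: carrier_l2 vdist_l2_eq square_summable_diff)
qed

lemma mcomplete_l2: "Metric_space.mcomplete (carrier l2) (vdist l2)"
  unfolding Metric_space.mcomplete_def[OF Metric_space_l2]
proof (intro allI impI)
  fix \<sigma> assume cauchy: "Metric_space.MCauchy (carrier l2) (vdist l2) \<sigma>"
  then have "range \<sigma> \<subseteq> carrier l2"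
    unfolding Metric_space.MCauchy_def[OF Metric_space_l2] by (rule conjunct1)
  then have \<sigma>: "square_summable UNIV (\<sigma> n)" for n by (auto simp: carrier_l2)
  have C: "\<exists>N. \<forall>n\<ge>N. \<forall>m\<ge>N. norm_sq UNIV (\<lambda>i. \<sigma> n i - \<sigma> m i) < e\<^sup>2" if "e > 0" for e
  proof -
    have "\<forall>e>0. \<exists>N. \<forall>n n'. N \<le> n \<longrightarrow> N \<le> n' \<longrightarrow> vdist l2 (\<sigma> n) (\<sigma> n') < e"
      using cauchy unfolding Metric_space.MCauchy_def[OF Metric_space_l2] by (rule conjunct2)
    with that obtain N where N: "\<And>n m. N \<le> n \<Longrightarrow> N \<le> m \<Longrightarrow> vdist l2 (\<sigma> n) (\<sigma> m) < e"
      by meson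
    have "norm_sq UNIV (\<lambda>i. \<sigma> n i - \<sigma> m i) < e\<^sup>2" if "N \<le> n" "N \<le> m" for n m
    proof -
      have "(sqrt (norm_sq UNIV (\<lambda>i. \<sigma> n i - \<sigma> m i)))\<^sup>2 < e\<^sup>2"
        using N[OF that] by (intro power_strict_mono) (auto simp: vdist_l2_eq \<sigma>)
      then show ?thesis by simp
    qed
    then show ?thesis by blast
  qed
  have "Cauchy (\<lambda>n. \<sigma> n i)" for i
  proof (rule metric_CauchyI)
    fix e :: real assume "0 < e"
    then obtain N where N: "\<forall>n\<ge>N. \<forall>m\<ge>N. norm_sq UNIV (\<lambda>i. \<sigma> n i - \<sigma> m i) < e\<^sup>2" using C by blast
    show "\<exists>N. \<forall>m\<ge>N. \<forall>n\<ge>N. dist (\<sigma> m i) (\<sigma> n i) < e"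
    proof (intro exI[of _ N] allI impI)
      fix m n assume "N \<le> m" "N \<le> n"
      then have "norm_sq UNIV (\<lambda>i. \<sigma> m i - \<sigma> n i) < e\<^sup>2" using N by blast
      moreover have "(\<sigma> m i - \<sigma> n i)\<^sup>2 \<le> norm_sq UNIV (\<lambda>i. \<sigma> m i - \<sigma> n i)"
        by (rule square_le_norm_sq[OF square_summable_diff[OF \<sigma> \<sigma>] UNIV_I])
      ultimately have "\<bar>\<sigma> m i - \<sigma> n i\<bar>\<^sup>2 < e\<^sup>2" unfolding power2_abs by linarith
      then show "dist (\<sigma> m i) (\<sigma> n i) < e"
        unfolding dist_real_def using \<open>0 < e\<close> by (rule power2_less_imp_less[OF _ less_imp_le])
    qed
  qed
  then have "\<exists>l. (\<lambda>n. \<sigma> n i) \<longlonglongrightarrow> l" for i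
    by (simp add: Cauchy_convergent_iff convergent_def)
  then obtain l where l: "\<And>i. (\<lambda>n. \<sigma> n i) \<longlonglongrightarrow> l i" by metis
  have lim: "square_summable UNIV (\<lambda>i. \<sigma> n i - l i) \<and> norm_sq UNIV (\<lambda>i. \<sigma> n i - l i) \<le> e\<^sup>2"
    if N: "\<forall>n\<ge>N. \<forall>m\<ge>N. norm_sq UNIV (\<lambda>i. \<sigma> n i - \<sigma> m i) < e\<^sup>2" and n: "n \<ge> N" for N n e
  proof -
    have le: "(\<Sum>i\<in>F. (\<sigma> n i - l i)\<^sup>2) \<le> e\<^sup>2" if F: "finite F" for F
    proof (rule LIMSEQ_le_const2)
      show "(\<lambda>m. \<Sum>i\<in>F. (\<sigma> n i - \<sigma> m i)\<^sup>2) \<longlonglongrightarrow> (\<Sum>i\<in>F. (\<sigma> n i - l i)\<^sup>2)"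
        by (intro tendsto_intros l)
      show "\<exists>M. \<forall>m\<ge>M. (\<Sum>i\<in>F. (\<sigma> n i - \<sigma> m i)\<^sup>2) \<le> e\<^sup>2"
      proof (intro exI[of _ N] allI impI)
        fix m assume "N \<le> m"
        then have "norm_sq UNIV (\<lambda>i. \<sigma> n i - \<sigma> m i) \<le> e\<^sup>2" using N n by (simp add: less_imp_le)
        moreover have "(\<Sum>i\<in>F. (\<sigma> n i - \<sigma> m i)\<^sup>2) \<le> norm_sq UNIV (\<lambda>i. \<sigma> n i - \<sigma> m i)"
          unfolding norm_sq_eq using F square_summable_diff[OF \<sigma>[of n] \<sigma>[of m]]
          by (intro finite_sum_le_infsum) (auto simp: square_summable_def)
        ultimately show "(\<Sum>i\<in>F. (\<sigma> n i - \<sigma> m i)\<^sup>2) \<le> e\<^sup>2" by simp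
      qed
    qed
    then have "square_summable UNIV (\<lambda>i. \<sigma> n i - l i)"
      unfolding square_summable_def
      by (intro nonneg_bdd_above_summable_on bdd_aboveI2) auto
    moreover from this have "norm_sq UNIV (\<lambda>i. \<sigma> n i - l i) \<le> e\<^sup>2"
      unfolding norm_sq_eq square_summable_def by (rule infsum_le_finite_sums) (rule le)
    ultimately show ?thesis by simp
  qed
  have "square_summable UNIV l"
  proof -
    obtain N where "\<forall>n\<ge>N. \<forall>m\<ge>N. norm_sq UNIV (\<lambda>i. \<sigma> n i - \<sigma> m i) < 1\<^sup>2" using C[of 1] by auto
    from lim[OF this order_refl] have "square_summable UNIV (\<lambda>i. \<sigma> N i - l i)" by blast
    from square_summable_diff[OF \<sigma>[of N] this] show ?thesis by simp
  qed
  moreover have "\<exists>N. \<forall>n\<ge>N. \<sigma> n \<in> carrier l2 \<and> vdist l2 (\<sigma> n) l < \<epsilon>" if "\<epsilon> > 0" for \<epsilon>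
  proof -
    obtain N where N: "\<forall>n\<ge>N. \<forall>m\<ge>N. norm_sq UNIV (\<lambda>i. \<sigma> n i - \<sigma> m i) < (\<epsilon> / 2)\<^sup>2"
      using C[of "\<epsilon> / 2"] \<open>\<epsilon> > 0\<close> by auto
    have "vdist l2 (\<sigma> n) l < \<epsilon>" if "n \<ge> N" for n
    proof -
      have "sqrt (norm_sq UNIV (\<lambda>i. \<sigma> n i - l i)) \<le> sqrt ((\<epsilon> / 2)\<^sup>2)"
        using lim[OF N that] by (intro real_sqrt_le_mono) simp
      then show ?thesis
        using \<open>\<epsilon> > 0\<close> \<open>square_summable UNIV l\<close> by (simp add: vdist_l2_eq \<sigma>)
    qed
    then show ?thesis using \<sigma> by (auto simp: carrier_l2)
  qed
  ultimately show "\<exists>x. limitin (Metric_space.mtopology (carrier l2) (vdist l2)) \<sigma> x sequentially"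
    unfolding Metric_space.limit_metric_sequentially[OF Metric_space_l2] by (auto simp: carrier_l2)
qed

lemma hilbert_space_l2: "hilbert_space l2"
  unfolding hilbert_space_def
proof (intro conjI ballI allI impI)
  show "Module.module (ring_of_type_algebra :: real ring) l2"
  proof (rule moduleI)
    show "cring (ring_of_type_algebra :: real ring)" by (rule cring_from_type_algebra)
    show "abelian_group l2"
    proof (rule abelian_groupI)
      fix v assume "v \<in> carrier l2"
      then show "\<exists>w\<in>carrier l2. w \<oplus>\<^bsub>l2\<^esub> v = \<zero>\<^bsub>l2\<^esub>"
        by (intro bexI[of _ "\<lambda>i. - v i"])
          (auto simp: carrier_l2 add_l2 zero_l2 l2_proj_eq square_summable_uminus)
    qed (auto simp: carrier_l2 add_l2 zero_l2 l2_proj_eq square_summable_add fun_eq_iff)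
  qed (auto simp: ring_of_type_algebra_def carrier_l2 add_l2 smult_l2 l2_proj_eq square_summable_add
      square_summable_cmult fun_eq_iff algebra_simps)
  show "Metric_space.mcomplete (carrier l2) (vdist l2)" by (rule mcomplete_l2)
  show "x = \<zero>\<^bsub>l2\<^esub>" if "x \<in> carrier l2" "inner_prod l2 x x = 0" for x
    using norm_sq_eq_0D[of UNIV x] that by (auto simp: carrier_l2 inner_prod_l2 zero_l2 norm_sq_def)
  show "inner_prod l2 x x \<ge> 0" for x
    using norm_sq_nonneg[of UNIV x] by (simp add: inner_prod_l2 norm_sq_def)
  show "inner_prod l2 x y = inner_prod l2 y x" for x y
    unfolding inner_prod_l2 by (rule inner_on_commute)
qed (simp_all add: carrier_l2 add_l2 smult_l2 inner_prod_l2 l2_proj_eq inner_on_add_left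
    inner_on_cmult_left)

section \<open>Affine actions by permutation of coordinates\<close>

text \<open>The group permutes the coordinates, and acts on square-summable sequences by the affine maps \<open>v \<mapsto> F + g (v - F)\<close>.
  These make sense although \<open>F\<close> need not be square-summable, since \<open>F - g F\<close> is. The orbit of \<open>0\<close>
  consists of the differences \<open>F - g F\<close>.\<close>

locale permutation_cocycle = right_action_walk G "UNIV :: nat set" act S
  for G (structure) and act S +
  fixes F :: "nat \<Rightarrow> real"
  assumes square_summable_diff_translate:
    "g \<in> carrier G \<Longrightarrow> square_summable UNIV (\<lambda>i. F i - F (act i g))"
begin

definition affine_act :: "'a \<Rightarrow> (nat \<Rightarrow> real) \<Rightarrow> nat \<Rightarrow> real" where
  "affine_act g = restrict (\<lambda>v i. F i - F (act i g) + v (act i g)) (carrier l2)"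

definition orbit_map :: "'a \<Rightarrow> nat \<Rightarrow> real" where
  "orbit_map g = (\<lambda>i. F i - F (act i g))"

lemma affine_act_eq:
  "square_summable UNIV v \<Longrightarrow> affine_act g v = (\<lambda>i. F i - F (act i g) + v (act i g))"
  by (simp add: affine_act_def carrier_l2)

lemma square_summable_affine_act:
  "g \<in> carrier G \<Longrightarrow> square_summable UNIV v \<Longrightarrow> square_summable UNIV (affine_act g v)"
  unfolding affine_act_eq
  by (intro square_summable_add square_summable_diff_translate square_summable_translate)

lemma affine_act_mult:
  assumes "g \<in> carrier G" "h \<in> carrier G" "square_summable UNIV v"
  shows "affine_act (g \<otimes> h) v = affine_act g (affine_act h v)"
  unfolding affine_act_eq[OF square_summable_affine_act[OF assms(2,3)]]
  using assms by (simp add: affine_act_eq act_mult algebra_simps)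

lemma affine_act_one: "square_summable UNIV v \<Longrightarrow> affine_act \<one> v = v"
  by (simp add: affine_act_eq act_one)

lemma affine_act_isometry:
  assumes g: "g \<in> carrier G"
  shows "affine_act g \<in> affine_isometries l2"
proof -
  have "bij_betw (affine_act g) (carrier l2) (carrier l2)"
    by (rule bij_betw_byWitness[where f' = "affine_act (inv g)"])
      (use g in \<open>auto simp: carrier_l2 square_summable_affine_act affine_act_one simp flip: affine_act_mult\<close>)
  moreover have "affine_act g \<in> extensional (carrier l2)" by (simp add: affine_act_def)
  moreover have "vdist l2 (affine_act g x) (affine_act g y) = vdist l2 x y"
    if "square_summable UNIV x" "square_summable UNIV y" for x y
  proof -
    have "vdist l2 (affine_act g x) (affine_act g y) =
        sqrt (norm_sq UNIV (\<lambda>i. (\<lambda>j. x j - y j) (act i g)))"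
      using that g by (simp add: vdist_l2_eq square_summable_affine_act) (simp add: affine_act_eq)
    also have "\<dots> = vdist l2 x y"
      using norm_sq_translate[OF g, of "\<lambda>j. x j - y j"] that by (simp add: vdist_l2_eq)
    finally show ?thesis .
  qed
  moreover have "affine_act g ((1 - r) \<odot>\<^bsub>l2\<^esub> x \<oplus>\<^bsub>l2\<^esub> r \<odot>\<^bsub>l2\<^esub> y) =
      (1 - r) \<odot>\<^bsub>l2\<^esub> affine_act g x \<oplus>\<^bsub>l2\<^esub> r \<odot>\<^bsub>l2\<^esub> affine_act g y"
    if "square_summable UNIV x" "square_summable UNIV y" for x y r
    using that g
    by (simp add: smult_l2 add_l2 l2_proj_eq square_summable_cmult square_summable_affine_act
        square_summable_add affine_act_eq[of "\<lambda>i. (1 - r) * x i + r * y i"])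
      (simp add: affine_act_eq fun_eq_iff algebra_simps)
  ultimately show ?thesis
    unfolding affine_isometries_def Bij_def by (simp add: carrier_l2)
qed

lemma affine_act_hom: "affine_act \<in> hom G (IsomGroup l2)"
proof (rule homI)
  fix g assume "g \<in> carrier G"
  then show "affine_act g \<in> carrier (IsomGroup l2)" by (simp add: IsomGroup_def affine_act_isometry)
next
  fix g h assume gh: "g \<in> carrier G" "h \<in> carrier G"
  then have "affine_act g \<in> Bij (carrier l2)" "affine_act h \<in> Bij (carrier l2)"
    using affine_act_isometry by (auto simp: affine_isometries_def)
  then have "affine_act g \<otimes>\<^bsub>IsomGroup l2\<^esub> affine_act h = compose (carrier l2) (affine_act g) (affine_act h)"
    by (simp add: IsomGroup_def BijGroup_def)
  also have "\<dots> = affine_act (g \<otimes> h)"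
    unfolding compose_def
  proof (rule extensionalityI)
    show "affine_act (g \<otimes> h) \<in> extensional (carrier l2)" by (simp add: affine_act_def)
  qed (use gh affine_act_mult in \<open>auto simp: carrier_l2\<close>)
  finally show "affine_act (g \<otimes> h) = affine_act g \<otimes>\<^bsub>IsomGroup l2\<^esub> affine_act h" ..
qed

lemma orbit_map_closed: "g \<in> carrier G \<Longrightarrow> orbit_map g \<in> carrier l2"
  by (simp add: orbit_map_def carrier_l2 square_summable_diff_translate)

lemma orbit_map_equivariant:
  "g \<in> carrier G \<Longrightarrow> x \<in> carrier G \<Longrightarrow> orbit_map (g \<otimes> x) = affine_act g (orbit_map x)"
  using square_summable_diff_translate[of x]
  by (simp add: orbit_map_def affine_act_eq act_mult)

text \<open>The sequence \<open>y F - x F\<close> is the translate by \<open>y\<close> of \<open>F - (y\<^sup>-\<^sup>1 x) F\<close>.\<close>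

lemma vdist_orbit_map:
  assumes "x \<in> carrier G" "y \<in> carrier G"
  shows "vdist l2 (orbit_map x) (orbit_map y) = sqrt (displacement UNIV act F (inv y \<otimes> x))"
proof -
  have "vdist l2 (orbit_map x) (orbit_map y) = sqrt (norm_sq UNIV (\<lambda>i. F (act i y) - F (act i x)))"
    using assms by (simp add: orbit_map_def vdist_l2_eq square_summable_diff_translate)
  also have "norm_sq UNIV (\<lambda>i. F (act i y) - F (act i x)) =
      norm_sq UNIV (\<lambda>i. (\<lambda>j. F j - F (act j (inv y \<otimes> x))) (act i y))"
    using assms by (intro norm_sq_cong) (simp add: act_mult[symmetric] m_assoc[symmetric])
  also have "\<dots> = displacement UNIV act F (inv y \<otimes> x)"
    unfolding displacement_def by (rule norm_sq_translate[OF assms(2)])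
  finally show ?thesis .
qed

lemma compression_exponent_ge:
  fixes c \<kappa> C :: real
  assumes c: "0 < c" "c \<le> 1" and pos: "\<kappa> > 0" "C > 0"
    and lower: "\<And>g. g \<in> carrier G \<Longrightarrow> g \<noteq> \<one> \<Longrightarrow>
      \<kappa> * real (word_length G S g) powr c \<le> sqrt (displacement UNIV act F g)"
    and upper: "\<And>g. g \<in> carrier G \<Longrightarrow> sqrt (displacement UNIV act F g) \<le> C * real (word_length G S g)"
  shows "c \<le> equivariant_compression_exponent G S"
proof -
  define \<rho> where "\<rho> = (\<lambda>t::real. \<kappa> * t powr c)"
  have \<rho>: "compression_function G S l2 orbit_map \<rho>"
    unfolding compression_function_def
  proof (intro conjI exI[of _ C] ballI)
    show "\<rho> \<in> {0..} \<rightarrow> {0..}" using pos by (auto simp: \<rho>_def)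
    show "mono_on {0..} \<rho>"
      using pos c by (auto simp: \<rho>_def intro!: mono_onI mult_left_mono powr_mono2)
    show "\<not> bdd_above (\<rho> ` {0..})"
    proof
      assume "bdd_above (\<rho> ` {0..})"
      then obtain B where B: "\<And>t. t \<ge> 0 \<Longrightarrow> \<rho> t \<le> B" by (auto simp: bdd_above_def)
      define t where "t = ((\<bar>B\<bar> + 1) / \<kappa>) powr (1 / c)"
      have "\<rho> t = \<bar>B\<bar> + 1" using pos c by (simp add: \<rho>_def t_def powr_powr)
      moreover have "\<rho> t \<le> B" by (rule B) (simp add: t_def)
      ultimately show False by linarith
    qed
    show "C > 0" by fact
    fix x y assume xy: "x \<in> carrier G" "y \<in> carrier G"
    then have z: "inv y \<otimes> x \<in> carrier G" by simp
    show "\<rho> (real (word_length G S (inv y \<otimes> x))) \<le> vdist l2 (orbit_map x) (orbit_map y)"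
      unfolding vdist_orbit_map[OF xy] \<rho>_def
      using lower[OF z] by (cases "inv y \<otimes> x = \<one>") (auto simp: displacement_one)
    show "vdist l2 (orbit_map x) (orbit_map y) \<le> C * real (word_length G S (inv y \<otimes> x)) + C"
      unfolding vdist_orbit_map[OF xy] using upper[OF z] pos by linarith
  qed
  have "c \<le> compression_exponent G S l2 orbit_map"
    unfolding compression_exponent_def exponent_Sup_def
  proof (rule cSup_upper)
    show "c \<in> insert 0 {c \<in> {0..1}. \<exists>K>0. \<exists>\<rho>. compression_function G S l2 orbit_map \<rho> \<and>
        (\<forall>n::nat. n \<ge> 1 \<longrightarrow> \<rho> (real n) \<ge> K * real n powr c)}"
      using c \<rho> pos by (auto simp: \<rho>_def intro!: exI[of _ \<kappa>] exI[of _ \<rho>])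
  qed (auto intro!: bdd_aboveI[of _ 1])
  also have "\<dots> \<le> equivariant_compression_exponent G S"
    unfolding equivariant_compression_exponent_def exponent_Sup_def
  proof (rule cSup_upper)
    have "equivariant_uniform_embedding G S l2 affine_act orbit_map"
      unfolding equivariant_uniform_embedding_def
      using \<rho> orbit_map_closed orbit_map_equivariant by auto
    then show "compression_exponent G S l2 orbit_map \<in> insert 0 {compression_exponent G S B f
       | (B :: (nat \<Rightarrow> real) inner_module) \<pi> f.
         hilbert_space B \<and> \<pi> \<in> hom G (IsomGroup B) \<and> equivariant_uniform_embedding G S B \<pi> f}"
      using hilbert_space_l2 affine_act_hom by blast
    have "compression_exponent G S B f \<le> 1" for B :: "(nat \<Rightarrow> real) inner_module" and f
      unfolding compression_exponent_def exponent_Sup_def by (rule cSup_least) auto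
    then show "bdd_above (insert 0 {compression_exponent G S B f
       | (B :: (nat \<Rightarrow> real) inner_module) \<pi> f.
         hilbert_space B \<and> \<pi> \<in> hom G (IsomGroup B) \<and> equivariant_uniform_embedding G S B \<pi> f})"
      by (intro bdd_aboveI[of _ 1]) auto
  qed
  finally show ?thesis .
qed

end

section \<open>Superposition of all scales\<close>

lemma square_summable_Sigma:
  assumes w: "\<And>k. square_summable A (w k)" and sum: "(\<lambda>k. norm_sq A (w k)) summable_on K"
  shows "square_summable (K \<times> A) (\<lambda>p. w (fst p) (snd p))"
    and "norm_sq (K \<times> A) (\<lambda>p. w (fst p) (snd p)) = (\<Sum>\<^sub>\<infinity>k\<in>K. norm_sq A (w k))"
proof -
  have "(\<lambda>p. norm ((w (fst p) (snd p))\<^sup>2)) summable_on Sigma K (\<lambda>_. A)"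
    unfolding Infinite_Sum.abs_summable_on_Sigma_iff
    using w sum by (simp add: square_summable_def norm_sq_eq infsum_nonneg)
  then show "square_summable (K \<times> A) (\<lambda>p. w (fst p) (snd p))"
    by (simp add: square_summable_def)
  then have "(\<lambda>(k, x). (w k x)\<^sup>2) summable_on Sigma K (\<lambda>_. A)"
    by (simp add: square_summable_def case_prod_unfold)
  from infsum_Sigma'_banach[OF this]
  show "norm_sq (K \<times> A) (\<lambda>p. w (fst p) (snd p)) = (\<Sum>\<^sub>\<infinity>k\<in>K. norm_sq A (w k))"
    by (simp add: norm_sq_eq case_prod_unfold)
qed

lemma dyadic_scale_power:
  "((2 ^ k) powr c)\<^sup>2 * (2 ^ k) powr (- 2 * \<alpha>) = ((2::real) powr (2 * (c - \<alpha>))) ^ k"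
proof -
  have "((2 ^ k) powr c)\<^sup>2 * (2 ^ k) powr (- 2 * \<alpha>) = (2 ^ k :: real) powr (2 * (c - \<alpha>))"
    by (simp add: power2_eq_square algebra_simps flip: powr_add)
  also have "\<dots> = (2 powr (2 * (c - \<alpha>))) ^ k"
    by (simp add: powr_powr mult.commute flip: powr_realpow)
  finally show ?thesis .
qed

lemma dyadic_scale:
  assumes "1 \<le> (l::nat)"
  obtains k where "2 ^ k \<le> l" "real l / 2 \<le> 2 ^ k" "k \<le> l"
proof -
  obtain k where k: "2 ^ k \<le> l" "l < 2 ^ (k + 1)" using ex_power_ivl1[of 2 l] assms by auto
  have "k \<le> l" using less_exp[of k] k(1) by linarith
  moreover have "real l < real (2 ^ (k + 1))" using k(2) by (simp only: of_nat_less_iff)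
  ultimately show thesis using k(1) by (intro that[of k]) auto
qed

lemma geometric_summable_on:
  fixes r :: real
  assumes "0 \<le> r" "r < 1"
  shows "(\<lambda>k. r ^ k) summable_on (UNIV :: nat set)"
  using assms by (simp add: summable_on_UNIV_nonneg_real_iff summable_geometric)

context right_action_walk
begin

lemma disperses_dyadic:
  assumes "disperses G S A act \<alpha>"
  obtains C u where "C > 0" "\<And>k::nat. square_summable A (u k)" "\<And>k x. 0 \<le> u k x"
    "\<And>k g. g \<in> carrier G \<Longrightarrow>
      displacement A act (u k) g \<le> C * (real (word_length G S g))\<^sup>2 * (2 ^ k) powr (- 2 * \<alpha>)"
    "\<And>k g. g \<in> carrier G \<Longrightarrow> 2 ^ k \<le> real (word_length G S g) \<Longrightarrow> 1 \<le> displacement A act (u k) g"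
proof -
  let ?ok = "\<lambda>C R u. square_summable A u \<and> (\<forall>x. 0 \<le> u x) \<and>
     (\<forall>g\<in>carrier G. displacement A act u g \<le> C * (real (word_length G S g))\<^sup>2 * R powr (- 2 * \<alpha>) \<and>
       (R \<le> real (word_length G S g) \<longrightarrow> 1 \<le> displacement A act u g))"
  obtain C where C: "C > 0" "\<And>R::real. R \<ge> 1 \<Longrightarrow> \<exists>u. ?ok C R u"
    using assms unfolding disperses_def by blast
  have "\<forall>k::nat. \<exists>u. ?ok C (2 ^ k) u" by (intro allI C(2)) simp
  then obtain u where "\<And>k. ?ok C (2 ^ k) (u k)" by metis
  then show thesis using that[of C u] C(1) by blast
qed

text \<open>The vector at scale \<open>2\<^sup>k\<close> gets the weight \<open>2\<^sup>c\<^sup>k\<close>. An element of length \<open>l\<close> displaces the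
  \<open>k\<close>-th term by at most a multiple of \<open>l 2\<^sup>(\<^sup>c\<^sup>-\<^sup>\<alpha>\<^sup>)\<^sup>k\<close>, which is summable, and the last term with \<open>2\<^sup>k \<le> l\<close> by at
  least \<open>2\<^sup>c\<^sup>k\<close>, which is comparable to \<open>l\<^sup>c\<close>.\<close>

lemma equivariant_compression_exponent_ge_of_disperses:
  assumes disp: "disperses G S A act \<alpha>" and A: "countable A" "A \<noteq> {}"
    and c: "0 < c" "c < \<alpha>" "c \<le> 1"
  shows "c \<le> equivariant_compression_exponent G S"
proof -
  obtain C u where C: "C > 0" and u: "\<And>k. square_summable A (u k)"
    and u_le: "\<And>k g. g \<in> carrier G \<Longrightarrow>
      displacement A act (u k) g \<le> C * (real (word_length G S g))\<^sup>2 * (2 ^ k) powr (- 2 * \<alpha>)"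
    and u_ge: "\<And>k g. g \<in> carrier G \<Longrightarrow> 2 ^ k \<le> real (word_length G S g) \<Longrightarrow> 1 \<le> displacement A act (u k) g"
    using disperses_dyadic[OF disp] by metis
  define r where "r = (2::real) powr (2 * (c - \<alpha>))"
  have r: "0 \<le> r" "r < 1" using c by (auto simp: r_def powr_less_one)
  define \<Gamma> where "\<Gamma> = (\<Sum>\<^sub>\<infinity>k\<in>(UNIV::nat set). r ^ k)"
  have \<Gamma>: "\<Gamma> \<ge> 0" unfolding \<Gamma>_def using r by (intro infsum_nonneg) simp
  define v where "v = (\<lambda>k x. (2 ^ k) powr c * u k x)"
  have dv: "displacement A act (v k) g = ((2 ^ k) powr c)\<^sup>2 * displacement A act (u k) g" for k g
    unfolding v_def by (rule displacement_cmult)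
  have dv_le: "displacement A act (v k) g \<le> C * (real (word_length G S g))\<^sup>2 * r ^ k"
    if "g \<in> carrier G" for k g
  proof -
    have "displacement A act (v k) g \<le>
        ((2 ^ k) powr c)\<^sup>2 * (C * (real (word_length G S g))\<^sup>2 * (2 ^ k) powr (- 2 * \<alpha>))"
      unfolding dv by (intro mult_left_mono u_le that) auto
    also have "\<dots> = C * (real (word_length G S g))\<^sup>2 * (((2 ^ k) powr c)\<^sup>2 * (2 ^ k) powr (- 2 * \<alpha>))"
      by (simp only: mult_ac)
    also have "\<dots> = C * (real (word_length G S g))\<^sup>2 * r ^ k"
      unfolding dyadic_scale_power r_def ..
    finally show ?thesis .
  qed
  have geo: "(\<lambda>k. C * (real l)\<^sup>2 * r ^ k) summable_on (UNIV::nat set)" for l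
    using r by (intro summable_on_cmult_right geometric_summable_on)
  have dv_sum: "(\<lambda>k. displacement A act (v k) g) summable_on UNIV" if "g \<in> carrier G" for g
    by (rule summable_on_comparison_test[OF geo]) (use dv_le that in auto)

  \<comment> \<open>The superposition is a function on pairs of a scale and a point of \<open>A\<close>; an enumeration of these pairs
    turns it into a sequence.\<close>
  let ?B = "(UNIV :: nat set) \<times> A"
  have B: "countable ?B" "infinite ?B" using A by (auto simp: finite_cartesian_product_iff)
  define e where "e = from_nat_into ?B"
  define \<iota> where "\<iota> = to_nat_on ?B"
  have bij: "bij_betw e UNIV ?B" unfolding e_def using B by (rule bij_betw_from_nat_into)
  have e_in: "e i \<in> ?B" for i using bij by (auto simp: bij_betw_def)
  have \<iota>e: "\<iota> (e i) = i" for i unfolding \<iota>_def e_def using B by (simp add: to_nat_on_from_nat_into_infinite)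
  have e\<iota>: "e (\<iota> p) = p" if "p \<in> ?B" for p unfolding \<iota>_def e_def using B that by (simp add: from_nat_into_to_nat_on)
  define sact where "sact = (\<lambda>(p :: nat \<times> 'x) g. (fst p, act (snd p) g))"
  have sact_in: "sact p g \<in> ?B" if "p \<in> ?B" "g \<in> carrier G" for p g
    using that by (auto simp: sact_def act_closed)
  define \<tau> where "\<tau> = (\<lambda>i g. \<iota> (sact (e i) g))"
  define F where "F = (\<lambda>i. v (fst (e i)) (snd (e i)))"
  interpret N: right_action_walk G "UNIV :: nat set" \<tau> S
  proof unfold_locales
    fix x :: nat
    show "\<tau> x \<one> = x" using e_in[of x] by (simp add: \<tau>_def sact_def act_one mem_Times_iff \<iota>e)
    fix g h assume gh: "g \<in> carrier G" "h \<in> carrier G"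
    have "sact (e x) (g \<otimes> h) = sact (sact (e x) g) h"
      using e_in[of x] gh by (simp add: sact_def act_mult mem_Times_iff)
    then show "\<tau> x (g \<otimes> h) = \<tau> (\<tau> x g) h"
      using e_in[of x] gh by (simp add: \<tau>_def e\<iota> sact_in)
  qed auto
  have F\<tau>: "(\<lambda>i. F i - F (\<tau> i g)) = (\<lambda>i. (\<lambda>p. v (fst p) (snd p) - v (fst p) (act (snd p) g)) (e i))"
    if "g \<in> carrier G" for g
    by (rule ext) (use that e_in in \<open>simp add: F_def \<tau>_def e\<iota> sact_in, simp add: sact_def\<close>)
  have vss: "square_summable A (\<lambda>x. v k x - v k (act x g))" if "g \<in> carrier G" for k g
    unfolding v_def using that
    by (intro square_summable_diff square_summable_cmult u
        square_summable_translate[where u = "\<lambda>x. (2 ^ k) powr c * u k x"])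
  have Fss: "square_summable UNIV (\<lambda>i. F i - F (\<tau> i g))" if g: "g \<in> carrier G" for g
    unfolding F\<tau>[OF g] square_summable_def
    using square_summable_Sigma(1)[of A "\<lambda>k x. v k x - v k (act x g)" UNIV] vss[OF g] dv_sum[OF g]
      summable_on_reindex_bij_betw[OF bij, of "\<lambda>p. (v (fst p) (snd p) - v (fst p) (act (snd p) g))\<^sup>2"]
    by (simp add: square_summable_def displacement_def)
  have Fdisp: "displacement UNIV \<tau> F g = (\<Sum>\<^sub>\<infinity>k. displacement A act (v k) g)" if g: "g \<in> carrier G" for g
    unfolding displacement_def F\<tau>[OF g] norm_sq_eq[of UNIV]
    using square_summable_Sigma(2)[of A "\<lambda>k x. v k x - v k (act x g)" UNIV] vss[OF g] dv_sum[OF g]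
      infsum_reindex_bij_betw[OF bij, of "\<lambda>p. (v (fst p) (snd p) - v (fst p) (act (snd p) g))\<^sup>2"]
    by (simp add: displacement_def norm_sq_eq[of ?B])
  interpret P: permutation_cocycle G \<tau> S F
    by unfold_locales (rule Fss)
  show ?thesis
  proof (rule P.compression_exponent_ge)
    show "0 < c" "c \<le> 1" by fact+
    show "(1/2) powr c > 0" by simp
    show "sqrt (C * \<Gamma>) + 1 > 0" using C \<Gamma> by (simp add: add_nonneg_pos)
    fix g assume g: "g \<in> carrier G"
    define l where "l = word_length G S g"
    have "displacement UNIV \<tau> F g \<le> (\<Sum>\<^sub>\<infinity>k\<in>(UNIV::nat set). C * (real l)\<^sup>2 * r ^ k)"
      unfolding Fdisp[OF g] l_def by (rule infsum_mono[OF dv_sum[OF g] geo dv_le[OF g]])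
    also have "\<dots> = C * \<Gamma> * (real l)\<^sup>2"
      unfolding \<Gamma>_def infsum_cmult_right' by simp
    finally have "sqrt (displacement UNIV \<tau> F g) \<le> sqrt (C * \<Gamma> * (real l)\<^sup>2)"
      by (rule real_sqrt_le_mono)
    also have "\<dots> \<le> (sqrt (C * \<Gamma>) + 1) * real l" by (simp add: real_sqrt_mult distrib_right)
    finally show "sqrt (displacement UNIV \<tau> F g) \<le> (sqrt (C * \<Gamma>) + 1) * real (word_length G S g)"
      by (simp add: l_def)
    assume "g \<noteq> \<one>"
    then have "1 \<le> l" using word_length_pos[OF g] by (simp add: l_def)
    then obtain k where k: "2 ^ k \<le> l" "real l / 2 \<le> 2 ^ k" by (rule dyadic_scale)
    have "(1/2) powr c * real l powr c = (real l / 2) powr c"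
      by (simp add: powr_divide)
    also have "\<dots> \<le> (2 ^ k) powr c" using k(2) c by (intro powr_mono2) auto
    also have "\<dots> \<le> sqrt (displacement UNIV \<tau> F g)"
    proof (rule real_le_rsqrt)
      have "real (2 ^ k) \<le> real l" using k(1) by (simp only: of_nat_le_iff)
      then have "1 \<le> displacement A act (u k) g"
        using u_ge[OF g, of k] by (simp add: l_def)
      then have "((2 ^ k) powr c)\<^sup>2 * 1 \<le> displacement A act (v k) g"
        unfolding dv by (intro mult_left_mono) auto
      also have "\<dots> \<le> displacement UNIV \<tau> F g"
        unfolding Fdisp[OF g]
        using finite_sum_le_infsum[OF dv_sum[OF g], of "{k}"] by simp
      finally show "((2 ^ k) powr c)\<^sup>2 \<le> displacement UNIV \<tau> F g" by simp
    qed
    finally show "(1/2) powr c * real (word_length G S g) powr c \<le> sqrt (displacement UNIV \<tau> F g)"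
      by (simp add: l_def)
  qed
qed

section \<open>The speed of the random walk\<close>

text \<open>Averaging \<open>\<parallel>u - g u\<parallel>\<^sup>2 = 2 \<parallel>u\<parallel>\<^sup>2 - 2 \<langle>u, g u\<rangle>\<close> over the walk at time \<open>2 n\<close> gives
  \<open>2 \<parallel>u\<parallel>\<^sup>2 - 2 \<parallel>P\<^sup>n u\<parallel>\<^sup>2\<close>, and each of the \<open>n\<close> steps loses at most twice the energy.\<close>

lemma expectation_displacement_le:
  assumes u: "square_summable A u" "\<And>x. 0 \<le> u x"
  shows "mean (2 * n) (displacement A act u) \<le>
    4 * real n * energy A S act u"
proof -
  define p where "p = lazy_walk G S (2 * n)"
  have fin: "finite (set_pmf p)" and sub: "set_pmf p \<subseteq> carrier G"
    unfolding p_def by (rule set_lazy_walk)+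
  have ss: "square_summable A (\<lambda>x. pmf p g * u (act x g))" if "g \<in> set_pmf p" for g
    using that sub by (intro square_summable_cmult square_summable_translate u) auto
  have "norm_sq A ((walk_op S act ^^ n) u) = inner_on A ((walk_op S act ^^ (2 * n)) u) u"
    unfolding norm_sq_def mult_2 funpow_add comp_def
    by (rule walk_op_funpow_self_adjoint[OF square_summable_walk_op_funpow[OF u(1)] u(1), symmetric])
  also have "\<dots> = inner_on A (\<lambda>x. \<Sum>g\<in>set_pmf p. pmf p g * u (act x g)) u"
  proof (rule inner_on_cong)
    fix x assume "x \<in> A"
    then have "(walk_op S act ^^ (2 * n)) u x = measure_pmf.expectation p (\<lambda>g. u (act x g))"
      by (simp only: walk_op_funpow_eq_expectation p_def)
    also have "\<dots> = (\<Sum>g\<in>set_pmf p. u (act x g) * pmf p g)"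
      by (rule integral_measure_pmf_real[OF fin])
    finally show "(walk_op S act ^^ (2 * n)) u x = (\<Sum>g\<in>set_pmf p. pmf p g * u (act x g))"
      by (simp add: mult.commute)
  qed simp
  also have "\<dots> = (\<Sum>g\<in>set_pmf p. pmf p g * inner_on A u (\<lambda>x. u (act x g)))"
    using ss by (simp add: inner_on_sum_left[OF fin _ u(1)] inner_on_cmult_left inner_on_commute[of A u])
  finally have I: "(\<Sum>g\<in>set_pmf p. pmf p g * inner_on A u (\<lambda>x. u (act x g))) = norm_sq A ((walk_op S act ^^ n) u)" ..
  have "measure_pmf.expectation p (displacement A act u) =
      (\<Sum>g\<in>set_pmf p. displacement A act u g * pmf p g)"
    by (rule integral_measure_pmf_real[OF fin])
  also have "\<dots> = (\<Sum>g\<in>set_pmf p. 2 * norm_sq A u * pmf p g - 2 * (pmf p g * inner_on A u (\<lambda>x. u (act x g))))"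
    using sub u(1) by (intro sum.cong) (auto simp: displacement_eq algebra_simps subset_iff)
  also have "\<dots> = 2 * norm_sq A u - 2 * norm_sq A ((walk_op S act ^^ n) u)"
    unfolding sum_subtractf sum_distrib_left[symmetric] I sum_pmf_eq_1[OF fin order_refl] by simp
  also have "\<dots> \<le> 4 * real n * energy A S act u"
    using norm_sq_walk_ge_linear[OF u, of n] by simp
  finally show ?thesis by (simp add: p_def)
qed

lemma energy_le_of_displacement:
  assumes "\<And>g. g \<in> carrier G \<Longrightarrow> displacement A act u g \<le> b * (real (word_length G S g))\<^sup>2" "0 \<le> b"
  shows "4 * energy A S act u \<le> b"
proof -
  have "displacement A act u s \<le> b" if s: "s \<in> S" for s
  proof -
    have "(real (word_length G S s))\<^sup>2 \<le> 1"
      using word_length_generator[OF s] by (simp add: power_le_one)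
    then have "b * (real (word_length G S s))\<^sup>2 \<le> b * 1" using assms(2) by (intro mult_left_mono)
    then show ?thesis using assms(1)[OF generators_closed[OF s]] by simp
  qed
  then have "(\<Sum>s\<in>S. displacement A act u s) \<le> card S * b" by (rule sum_bounded_above)
  then show ?thesis using card_generators_pos by (simp add: energy_def field_simps)
qed

lemma expectation_word_length_powr_le:
  assumes disp: "disperses G S A act \<alpha>" and c: "0 < c" "c < \<alpha>"
  obtains D where "D \<ge> 0"
    "\<And>n. mean (2 * n) (\<lambda>g. real (word_length G S g) powr (2 * c)) \<le> D * real n"
proof -
  obtain C u where C: "C > 0" and u: "\<And>k. square_summable A (u k)" "\<And>k x. 0 \<le> u k x"
    and u_le: "\<And>k g. g \<in> carrier G \<Longrightarrow>
      displacement A act (u k) g \<le> C * (real (word_length G S g))\<^sup>2 * (2 ^ k) powr (- 2 * \<alpha>)"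
    and u_ge: "\<And>k g. g \<in> carrier G \<Longrightarrow> 2 ^ k \<le> real (word_length G S g) \<Longrightarrow> 1 \<le> displacement A act (u k) g"
    using disperses_dyadic[OF disp] by metis
  define r where "r = (2::real) powr (2 * (c - \<alpha>))"
  have r: "0 \<le> r" "r < 1" using c by (auto simp: r_def powr_less_one)
  define \<Gamma> where "\<Gamma> = (\<Sum>\<^sub>\<infinity>k\<in>(UNIV::nat set). r ^ k)"
  have \<Gamma>: "\<Gamma> \<ge> 0" unfolding \<Gamma>_def using r by (intro infsum_nonneg) simp
  show thesis
  proof (rule that)
    show "0 \<le> 2 powr (2 * c) * (C * \<Gamma>)" using C \<Gamma> by simp
    fix n
    define p where "p = lazy_walk G S (2 * n)"
    have fin: "finite (set_pmf p)" and sub: "set_pmf p \<subseteq> carrier G"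
      unfolding p_def by (rule set_lazy_walk)+
    define m where "m = (\<Sum>g\<in>set_pmf p. word_length G S g)"
    let ?w = "\<lambda>k. ((2 ^ k) powr c)\<^sup>2"
    have pt: "real (word_length G S g) powr (2 * c) \<le> 2 powr (2 * c) * (\<Sum>k\<le>m. ?w k * displacement A act (u k) g)"
      if gp: "g \<in> set_pmf p" for g
    proof (cases "g = \<one>")
      case False
      have g: "g \<in> carrier G" using gp sub by auto
      define l where "l = word_length G S g"
      have "1 \<le> l" using False word_length_pos[OF g] by (simp add: l_def)
      then obtain k where k: "2 ^ k \<le> l" "real l / 2 \<le> 2 ^ k" "k \<le> l" by (rule dyadic_scale)
      have "l \<le> m" unfolding l_def m_def by (rule member_le_sum[OF gp _ fin]) simp
      then have "k \<le> m" using k(3) by simp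
      have "real l powr (2 * c) = 2 powr (2 * c) * (real l / 2) powr (2 * c)"
        by (simp add: powr_divide)
      also have "\<dots> \<le> 2 powr (2 * c) * (2 ^ k) powr (2 * c)"
        using k(2) c by (intro mult_left_mono powr_mono2) auto
      also have "(2 ^ k) powr (2 * c) = ?w k * 1"
        by (simp add: power2_eq_square flip: powr_add)
      also have "?w k * 1 \<le> ?w k * displacement A act (u k) g"
      proof (intro mult_left_mono u_ge g)
        have "real (2 ^ k) \<le> real l" using k(1) by (simp only: of_nat_le_iff)
        then show "2 ^ k \<le> real (word_length G S g)" by (simp add: l_def)
      qed simp
      also have "\<dots> \<le> (\<Sum>k\<le>m. ?w k * displacement A act (u k) g)"
        using \<open>k \<le> m\<close> by (intro member_le_sum) auto
      finally show ?thesis by (simp add: l_def)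
    qed (use c in \<open>simp add: displacement_one\<close>)
    have E: "measure_pmf.expectation p f = (\<Sum>g\<in>set_pmf p. f g * pmf p g)" for f :: "'a \<Rightarrow> real"
      by (rule integral_measure_pmf_real[OF fin])
    have "measure_pmf.expectation p (\<lambda>g. real (word_length G S g) powr (2 * c)) \<le>
        (\<Sum>g\<in>set_pmf p. (2 powr (2 * c) * (\<Sum>k\<le>m. ?w k * displacement A act (u k) g)) * pmf p g)"
      unfolding E by (intro sum_mono mult_right_mono pt) auto
    also have "\<dots> = 2 powr (2 * c) * (\<Sum>k\<le>m. ?w k * measure_pmf.expectation p (displacement A act (u k)))"
      unfolding E sum_distrib_left sum_distrib_right by (subst sum.swap) (simp add: mult_ac)
    finally have upper: "measure_pmf.expectation p (\<lambda>g. real (word_length G S g) powr (2 * c)) \<le>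
        2 powr (2 * c) * (\<Sum>k\<le>m. ?w k * measure_pmf.expectation p (displacement A act (u k)))" .
    have "(\<Sum>k\<le>m. ?w k * measure_pmf.expectation p (displacement A act (u k))) \<le> (\<Sum>k\<le>m. C * real n * r ^ k)"
    proof (rule sum_mono)
      fix k
      have "4 * energy A S act (u k) \<le> C * (2 ^ k) powr (- 2 * \<alpha>)"
        using u_le C by (intro energy_le_of_displacement) (auto simp: mult_ac)
      then have "real n * (4 * energy A S act (u k)) \<le> real n * (C * (2 ^ k) powr (- 2 * \<alpha>))"
        by (intro mult_left_mono) auto
      then have "measure_pmf.expectation p (displacement A act (u k)) \<le> C * real n * (2 ^ k) powr (- 2 * \<alpha>)"
        using expectation_displacement_le[OF u, of n k] by (simp add: p_def mult_ac)
      then have "?w k * measure_pmf.expectation p (displacement A act (u k)) \<le>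
          ?w k * (C * real n * (2 ^ k) powr (- 2 * \<alpha>))"
        by (intro mult_left_mono) auto
      also have "\<dots> = C * real n * (?w k * (2 ^ k) powr (- 2 * \<alpha>))" by (simp only: mult_ac)
      also have "\<dots> = C * real n * r ^ k" unfolding dyadic_scale_power r_def ..
      finally show "?w k * measure_pmf.expectation p (displacement A act (u k)) \<le> C * real n * r ^ k" .
    qed
    also have "\<dots> = C * real n * (\<Sum>k\<le>m. r ^ k)"
      by (rule sum_distrib_left[symmetric])
    also have "\<dots> \<le> C * real n * \<Gamma>"
      unfolding \<Gamma>_def using r C by (intro mult_left_mono finite_sum_le_infsum geometric_summable_on) auto
    finally have "2 powr (2 * c) * (\<Sum>k\<le>m. ?w k * measure_pmf.expectation p (displacement A act (u k))) \<le>
        2 powr (2 * c) * (C * real n * \<Gamma>)"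
      by (rule mult_left_mono) simp
    from order_trans[OF upper this] show "mean (2 * n) (\<lambda>g. real (word_length G S g) powr (2 * c)) \<le>
        2 powr (2 * c) * (C * \<Gamma>) * real n"
      by (simp add: p_def mult_ac)
  qed
qed

text \<open>For every \<open>t > 0\<close> one has \<open>x \<le> t + t\<^sup>1\<^sup>-\<^sup>2\<^sup>c x\<^sup>2\<^sup>c\<close> because \<open>2 c > 1\<close>; for \<open>t = (2 n)\<^sup>1\<^sup>/\<^sup>2\<^sup>c\<close> both terms have the same
  order in expectation.\<close>

lemma expectation_word_length_le:
  assumes disp: "disperses G S A act \<alpha>" and c: "1/2 < c" "c < \<alpha>"
  obtains D where "D \<ge> 0"
    "\<And>n. n \<ge> 1 \<Longrightarrow> mean (2 * n) (\<lambda>g. real (word_length G S g)) \<le>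
      D * real (2 * n) powr (1 / (2 * c))"
proof -
  obtain D where D: "D \<ge> 0"
    "\<And>n. mean (2 * n) (\<lambda>g. real (word_length G S g) powr (2 * c)) \<le> D * real n"
    using expectation_word_length_powr_le[OF disp _ c(2)] c by auto
  show thesis
  proof (rule that)
    show "D + 1 \<ge> 0" using D by simp
    fix n :: nat assume n: "n \<ge> 1"
    define t where "t = real (2 * n) powr (1 / (2 * c))"
    define s where "s = t powr (1 - 2 * c)"
    have t: "t > 0" using n by (simp add: t_def)
    have fin: "finite (set_pmf (lazy_walk G S (2 * n)))" by (rule set_lazy_walk)
    have pt: "x \<le> t + s * x powr (2 * c)" if "0 \<le> x" for x
    proof (cases "x \<le> t")
      case True
      then show ?thesis by (simp add: s_def add_increasing2)
    next
      case False
      then have x: "t < x" "0 < x" using t by auto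
      have "x = x powr (1 - 2 * c) * x powr (2 * c)" using x by (simp flip: powr_add)
      also have "\<dots> \<le> s * x powr (2 * c)"
        unfolding s_def using x t c by (intro mult_right_mono powr_mono2') auto
      finally show ?thesis using t by simp
    qed
    have "mean (2 * n) (\<lambda>g. real (word_length G S g)) \<le>
        mean (2 * n) (\<lambda>g. t + s * real (word_length G S g) powr (2 * c))"
      by (intro expectation_lazy_walk_mono pt) simp
    also have "\<dots> = t + s * mean (2 * n) (\<lambda>g. real (word_length G S g) powr (2 * c))"
      by (simp add: integrable_measure_pmf_finite[OF fin])
    also have "\<dots> \<le> t + s * (D * real (2 * n))"
      using D(2)[of n] D(1) by (intro add_left_mono mult_left_mono) (auto simp: s_def intro: order_trans)
    also have "s * (D * real (2 * n)) = D * t"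
    proof -
      have "t powr (2 * c) = real (2 * n)" using c n by (simp add: t_def powr_powr)
      moreover have "s * t powr (2 * c) = t"
        using t by (simp add: s_def flip: powr_add)
      ultimately have "s * real (2 * n) = t" by simp
      then show ?thesis by (metis mult.assoc mult.commute)
    qed
    finally show "mean (2 * n) (\<lambda>g. real (word_length G S g)) \<le>
      (D + 1) * real (2 * n) powr (1 / (2 * c))"
      by (simp add: t_def distrib_right)
  qed
qed

text \<open>An exponent \<open>b \<le> 1\<close> exceeding \<open>1 / (2 \<alpha>)\<close> leaves room for some \<open>c\<close> with \<open>1 / (2 b) < c < \<alpha>\<close>; since
  \<open>b \<le> 1\<close>, this \<open>c\<close> exceeds \<open>1 / 2\<close>.\<close>

lemma speed_exponent_le:
  assumes disp: "disperses G S A act \<alpha>" and \<alpha>: "0 < \<alpha>" "\<alpha> \<le> 1"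
  shows "speed_exponent G S \<le> 1 / (2 * \<alpha>)"
  unfolding speed_exponent_def exponent_Sup_def
proof (rule cSup_least)
  fix b assume "b \<in> insert 0 {c \<in> {0..1}. \<exists>K>0. \<forall>n\<ge>1.
     mean n (\<lambda>g. real (word_length G S g)) \<ge> K * real n powr c}"
  then consider "b = 0" | "0 \<le> b" "b \<le> 1" "\<exists>K>0. \<forall>n\<ge>1.
     mean n (\<lambda>g. real (word_length G S g)) \<ge> K * real n powr b"
    by auto
  then show "b \<le> 1 / (2 * \<alpha>)"
  proof cases
    case 2
    then obtain K where K: "K > 0" and speed: "\<And>n. n \<ge> 1 \<Longrightarrow>
      K * real n powr b \<le> mean n (\<lambda>g. real (word_length G S g))"
      by blast
    show ?thesis
    proof (rule ccontr)
      assume "\<not> b \<le> 1 / (2 * \<alpha>)"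
      then have b: "1 / (2 * \<alpha>) < b" by simp
      have b0: "b > 0" using b \<alpha> by (smt (verit) divide_pos_pos)
      define c where "c = (1 / (2 * b) + \<alpha>) / 2"
      have "1 / (2 * b) < \<alpha>" using b \<alpha> b0 by (simp add: field_simps)
      then have c: "1 / (2 * b) < c" "c < \<alpha>" by (auto simp: c_def)
      have "1/2 \<le> 1 / (2 * b)" using b0 \<open>b \<le> 1\<close> by (simp add: field_simps)
      then have c2: "1/2 < c" using c by linarith
      obtain D where D: "D \<ge> 0" "\<And>n. n \<ge> 1 \<Longrightarrow>
        mean (2 * n) (\<lambda>g. real (word_length G S g)) \<le>
          D * real (2 * n) powr (1 / (2 * c))"
        using expectation_word_length_le[OF disp c2 c(2)] by blast
      define d where "d = b - 1 / (2 * c)"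
      have d: "d > 0" using c(1) c2 b0 by (simp add: d_def field_simps)
      have bound: "real (2 * n) powr d \<le> D / K" if n: "n \<ge> 1" for n
      proof -
        have "K * real (2 * n) powr b \<le> D * real (2 * n) powr (1 / (2 * c))"
          using speed[of "2 * n"] D(2)[OF n] n by simp
        moreover have "real (2 * n) powr b = real (2 * n) powr d * real (2 * n) powr (1 / (2 * c))"
          by (simp add: d_def flip: powr_add)
        ultimately have "(K * real (2 * n) powr d) * real (2 * n) powr (1 / (2 * c)) \<le>
            D * real (2 * n) powr (1 / (2 * c))" by (simp add: mult_ac)
        then have "K * real (2 * n) powr d \<le> D"
          using n by (subst (asm) mult_le_cancel_right_pos) auto
        then show ?thesis using K by (simp add: field_simps)
      qed
      obtain n :: nat where n: "(D / K + 1) powr (1 / d) < real n" using reals_Archimedean2 by blast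
      have "D / K + 1 > 0" using D K by (simp add: add_nonneg_pos)
      then have "0 < real n" using n powr_gt_zero by (meson le_less_trans powr_ge_zero)
      have "D / K + 1 = ((D / K + 1) powr (1 / d)) powr d"
        using d \<open>D / K + 1 > 0\<close> by (simp add: powr_powr)
      also have "\<dots> \<le> real (2 * n) powr d" using n d by (intro powr_mono2) auto
      also have "\<dots> \<le> D / K" using \<open>0 < real n\<close> by (intro bound) simp
      finally show False by simp
    qed
  qed (use \<alpha> in simp)
qed simp

end

section \<open>Entropy and bounded harmonic functions\<close>

definition pmf_entropy :: "'a pmf \<Rightarrow> real" where
  "pmf_entropy p = - (\<Sum>x\<in>set_pmf p. pmf p x * ln (pmf p x))"

text \<open>From \<open>ln x \<le> x - 1\<close> at \<open>x = (\<mu> z / \<nu> z)\<^sup>1\<^sup>/\<^sup>2\<close>. With the next lemma this is a weak form of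
  Pinsker's inequality.\<close>

lemma hellinger_le_relative_entropy:
  fixes \<nu> \<mu> :: "'x \<Rightarrow> real"
  assumes "finite Z" and \<nu>: "\<And>z. z \<in> Z \<Longrightarrow> 0 \<le> \<nu> z" "(\<Sum>z\<in>Z. \<nu> z) = 1"
    and \<mu>: "\<And>z. z \<in> Z \<Longrightarrow> 0 < \<mu> z" "(\<Sum>z\<in>Z. \<mu> z) = 1"
  shows "(\<Sum>z\<in>Z. (sqrt (\<nu> z) - sqrt (\<mu> z))\<^sup>2) \<le> (\<Sum>z\<in>Z. \<nu> z * (ln (\<nu> z) - ln (\<mu> z)))"
proof -
  have "2 * \<nu> z - 2 * (sqrt (\<nu> z) * sqrt (\<mu> z)) \<le> \<nu> z * (ln (\<nu> z) - ln (\<mu> z))" if z: "z \<in> Z" for z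
  proof (cases "\<nu> z = 0")
    case False
    then have pos: "\<nu> z > 0" "\<mu> z > 0" using \<nu>(1)[OF z] \<mu>(1)[OF z] by auto
    have "ln (sqrt (\<mu> z) / sqrt (\<nu> z)) \<le> sqrt (\<mu> z) / sqrt (\<nu> z) - 1"
      using pos by (intro ln_le_minus_one) auto
    then have "(ln (\<mu> z) - ln (\<nu> z)) / 2 \<le> sqrt (\<mu> z) / sqrt (\<nu> z) - 1"
      using pos by (simp add: ln_div ln_sqrt diff_divide_distrib)
    then have "\<nu> z * ((ln (\<mu> z) - ln (\<nu> z)) / 2) \<le> \<nu> z * (sqrt (\<mu> z) / sqrt (\<nu> z) - 1)"
      using pos by (intro mult_left_mono) auto
    also have "\<dots> = (\<nu> z / sqrt (\<nu> z)) * sqrt (\<mu> z) - \<nu> z" by (simp add: right_diff_distrib)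
    also have "\<nu> z / sqrt (\<nu> z) = sqrt (\<nu> z)" using pos by (simp add: real_div_sqrt)
    finally show ?thesis by (simp add: field_simps)
  qed simp
  then have "(\<Sum>z\<in>Z. 2 * \<nu> z - 2 * (sqrt (\<nu> z) * sqrt (\<mu> z))) \<le> (\<Sum>z\<in>Z. \<nu> z * (ln (\<nu> z) - ln (\<mu> z)))"
    by (rule sum_mono)
  moreover have "(\<Sum>z\<in>Z. (sqrt (\<nu> z) - sqrt (\<mu> z))\<^sup>2) =
      (\<Sum>z\<in>Z. \<nu> z + \<mu> z - 2 * (sqrt (\<nu> z) * sqrt (\<mu> z)))"
    using \<nu>(1) \<mu>(1) by (intro sum.cong) (auto simp: power2_diff less_imp_le)
  ultimately show ?thesis
    using \<nu>(2) \<mu>(2) by (simp add: sum_subtractf sum.distrib flip: sum_distrib_left)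
qed

text \<open>Cauchy-Schwarz for \<open>\<bar>\<nu> - \<mu>\<bar> = \<bar>\<nu>\<^sup>1\<^sup>/\<^sup>2 - \<mu>\<^sup>1\<^sup>/\<^sup>2\<bar> (\<nu>\<^sup>1\<^sup>/\<^sup>2 + \<mu>\<^sup>1\<^sup>/\<^sup>2)\<close>.\<close>

lemma total_variation_le_hellinger:
  fixes \<nu> \<mu> :: "'x \<Rightarrow> real"
  assumes \<nu>: "\<And>z. z \<in> Z \<Longrightarrow> 0 \<le> \<nu> z" "(\<Sum>z\<in>Z. \<nu> z) = 1"
    and \<mu>: "\<And>z. z \<in> Z \<Longrightarrow> 0 \<le> \<mu> z" "(\<Sum>z\<in>Z. \<mu> z) = 1"
  shows "(\<Sum>z\<in>Z. \<bar>\<nu> z - \<mu> z\<bar>) \<le> 2 * sqrt (\<Sum>z\<in>Z. (sqrt (\<nu> z) - sqrt (\<mu> z))\<^sup>2)"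
proof -
  let ?h = "\<Sum>z\<in>Z. (sqrt (\<nu> z) - sqrt (\<mu> z))\<^sup>2"
  have "(\<Sum>z\<in>Z. \<bar>\<nu> z - \<mu> z\<bar>) = (\<Sum>z\<in>Z. \<bar>sqrt (\<nu> z) - sqrt (\<mu> z)\<bar> * (sqrt (\<nu> z) + sqrt (\<mu> z)))"
  proof (rule sum.cong)
    fix z assume z: "z \<in> Z"
    have "\<nu> z - \<mu> z = (sqrt (\<nu> z) - sqrt (\<mu> z)) * (sqrt (\<nu> z) + sqrt (\<mu> z))"
      using \<nu>(1)[OF z] \<mu>(1)[OF z] by (simp add: algebra_simps)
    then show "\<bar>\<nu> z - \<mu> z\<bar> = \<bar>sqrt (\<nu> z) - sqrt (\<mu> z)\<bar> * (sqrt (\<nu> z) + sqrt (\<mu> z))"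
      using \<nu>(1)[OF z] \<mu>(1)[OF z] by (simp add: abs_mult)
  qed simp
  also have "\<dots>\<^sup>2 \<le> (\<Sum>z\<in>Z. \<bar>sqrt (\<nu> z) - sqrt (\<mu> z)\<bar>\<^sup>2) * (\<Sum>z\<in>Z. (sqrt (\<nu> z) + sqrt (\<mu> z))\<^sup>2)"
    by (rule Cauchy_Schwarz_ineq_sum)
  also have "\<dots> \<le> ?h * 4"
  proof (intro mult_mono)
    have "(\<Sum>z\<in>Z. (sqrt (\<nu> z) + sqrt (\<mu> z))\<^sup>2) \<le> (\<Sum>z\<in>Z. 2 * \<nu> z + 2 * \<mu> z)"
    proof (rule sum_mono)
      fix z assume z: "z \<in> Z"
      have "(sqrt (\<nu> z) + sqrt (\<mu> z))\<^sup>2 + (sqrt (\<nu> z) - sqrt (\<mu> z))\<^sup>2 = 2 * \<nu> z + 2 * \<mu> z"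
        using \<nu>(1)[OF z] \<mu>(1)[OF z] by (simp add: power2_sum power2_diff)
      then show "(sqrt (\<nu> z) + sqrt (\<mu> z))\<^sup>2 \<le> 2 * \<nu> z + 2 * \<mu> z"
        using zero_le_power2[of "sqrt (\<nu> z) - sqrt (\<mu> z)"] by linarith
    qed
    then show "(\<Sum>z\<in>Z. (sqrt (\<nu> z) + sqrt (\<mu> z))\<^sup>2) \<le> 4"
      using \<nu>(2) \<mu>(2) by (simp add: sum.distrib flip: sum_distrib_left)
  qed (auto intro: sum_nonneg)
  finally have "(\<Sum>z\<in>Z. \<bar>\<nu> z - \<mu> z\<bar>)\<^sup>2 \<le> (2 * sqrt ?h)\<^sup>2"
    by (simp add: power_mult_distrib sum_nonneg)
  then show ?thesis by (rule power2_le_imp_le) (simp add: sum_nonneg)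
qed

context generated_group
begin

interpretation self: right_action_walk G "carrier G" "(\<otimes>)" S
  by (rule right_action_walk_self)

text \<open>Gibbs' inequality, comparing the law of the walk with a measure that gives the sphere of radius
  \<open>k\<close> mass at most \<open>2\<^sup>-\<^sup>k\<^sup>-\<^sup>1\<close>, since this sphere has at most \<open>(card S)\<^sup>k\<close> elements.\<close>

lemma entropy_le_speed:
  "pmf_entropy (lazy_walk G S n) \<le>
    ln 2 + ln (2 * card S) * mean n (\<lambda>g. real (word_length G S g))"
proof -
  define p where "p = lazy_walk G S n"
  define Z where "Z = set_pmf p"
  have fin: "finite Z" and sub: "Z \<subseteq> carrier G"
    unfolding Z_def p_def by (rule set_lazy_walk)+
  define b where "b = 2 * real (card S)"
  have b: "b \<ge> 2" using card_generators_pos by (simp add: b_def)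
  define w where "w = (\<lambda>z. 1 / (2 * b ^ word_length G S z))"
  define m where "m = (\<Sum>z\<in>Z. word_length G S z)"
  have "(\<Sum>z\<in>Z. w z) = (\<Sum>k\<le>m. \<Sum>z\<in>{z \<in> Z. word_length G S z = k}. w z)"
    using fin by (intro sum.group[symmetric]) (auto simp: m_def intro: member_le_sum)
  also have "\<dots> \<le> (\<Sum>k\<le>m. (1/2) * (1/2) ^ k)"
  proof (rule sum_mono)
    fix k
    have "(\<Sum>z\<in>{z \<in> Z. word_length G S z = k}. w z) = card {z \<in> Z. word_length G S z = k} * (1 / (2 * b ^ k))"
      by (simp add: w_def)
    also have "\<dots> \<le> real (card S) ^ k * (1 / (2 * b ^ k))"
    proof (rule mult_right_mono)
      have "{g \<in> carrier G. word_length G S g = k} \<subseteq> {g \<in> carrier G. word_length G S g \<le> k}" by auto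
      then have "finite {g \<in> carrier G. word_length G S g = k}"
        using finite_word_ball finite_subset by blast
      then have "card {z \<in> Z. word_length G S z = k} \<le> card {g \<in> carrier G. word_length G S g = k}"
        using sub by (intro card_mono) auto
      also have "\<dots> \<le> card S ^ k" by (rule card_word_sphere_le)
      finally show "real (card {z \<in> Z. word_length G S z = k}) \<le> real (card S) ^ k"
        by (simp flip: of_nat_power)
    qed (use b in simp)
    also have "\<dots> = (1/2) * (1/2) ^ k"
      using card_generators_pos by (simp add: b_def power_mult_distrib power_divide)
    finally show "(\<Sum>z\<in>{z \<in> Z. word_length G S z = k}. w z) \<le> (1/2) * (1/2) ^ k" .
  qed
  also have "\<dots> = 1 - (1/2) ^ Suc m" by (induction m) auto
  finally have w: "(\<Sum>z\<in>Z. w z) \<le> 1"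
    using zero_le_power[of "1/2::real" "Suc m"] by linarith
  have "pmf p z * (ln (w z) - ln (pmf p z)) \<le> w z - pmf p z" if z: "z \<in> Z" for z
  proof -
    have p: "pmf p z > 0" using z by (simp add: Z_def pmf_positive)
    have wz: "w z > 0" using b by (simp add: w_def)
    have "ln (w z / pmf p z) \<le> w z / pmf p z - 1" using p wz by (intro ln_le_minus_one) auto
    then have "ln (w z) - ln (pmf p z) \<le> w z / pmf p z - 1" using p wz by (simp add: ln_div)
    then have "pmf p z * (ln (w z) - ln (pmf p z)) \<le> pmf p z * (w z / pmf p z - 1)"
      using p by (intro mult_left_mono) auto
    then show ?thesis using p by (simp add: right_diff_distrib)
  qed
  then have "(\<Sum>z\<in>Z. pmf p z * (ln (w z) - ln (pmf p z))) \<le> (\<Sum>z\<in>Z. w z - pmf p z)"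
    by (rule sum_mono)
  also have "\<dots> \<le> 0"
    using w sum_pmf_eq_1[OF fin, of p] by (simp add: sum_subtractf Z_def)
  finally have "pmf_entropy p \<le> - (\<Sum>z\<in>Z. pmf p z * ln (w z))"
    by (simp add: right_diff_distrib sum_subtractf pmf_entropy_def Z_def)
  also have "\<dots> = (\<Sum>z\<in>Z. ln 2 * pmf p z + ln b * (real (word_length G S z) * pmf p z))"
    using b by (simp add: w_def ln_div ln_mult ln_realpow algebra_simps flip: sum_negf)
  also have "\<dots> = ln 2 * (\<Sum>z\<in>Z. pmf p z) + ln b * (\<Sum>z\<in>Z. real (word_length G S z) * pmf p z)"
    by (simp add: sum.distrib sum_distrib_left)
  also have "(\<Sum>z\<in>Z. pmf p z) = 1" unfolding Z_def using fin by (intro sum_pmf_eq_1) (auto simp: Z_def)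
  also have "(\<Sum>z\<in>Z. real (word_length G S z) * pmf p z) =
      measure_pmf.expectation p (\<lambda>g. real (word_length G S g))"
    using fin by (intro integral_measure_pmf_real[symmetric]) (auto simp: Z_def)
  finally show ?thesis by (simp add: p_def b_def)
qed

lemma harmonic_lazy_walk:
  assumes h: "harmonic_on_cayley G S h" and x: "x \<in> carrier G"
  shows "mean n (\<lambda>g. h (x \<otimes> g)) = h x"
proof -
  have "(walk_op S (\<otimes>) ^^ n) h x = h x"
    using x
  proof (induction n arbitrary: x)
    case (Suc n)
    have "walk_op S (\<otimes>) ((walk_op S (\<otimes>) ^^ n) h) x = walk_op S (\<otimes>) h x"
      by (rule self.walk_op_cong[OF Suc.IH Suc.prems])
    also have "\<dots> = h x"
      using h Suc.prems card_generators_pos unfolding harmonic_on_cayley_def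
      by (simp add: walk_op_def field_simps)
    finally show ?case by simp
  qed simp
  then show ?thesis using self.walk_op_funpow_eq_expectation[OF x, of n h] by simp
qed

text \<open>The law of the walk at time \<open>n + 1\<close> is the average over its first step \<open>s\<close> of the left translates
  by \<open>s\<close> of the law at time \<open>n\<close>. The average entropy of these translates relative to it is the entropy increment.
  By harmonicity, \<open>h x\<close> is the mean of \<open>h (x z)\<close> for \<open>z\<close> at time \<open>n + 1\<close>, and \<open>h (x t)\<close> is the mean for \<open>z\<close> distributed as
  the translate by \<open>t\<close>.\<close>

lemma harmonic_increment_le:
  assumes h: "harmonic_on_cayley G S h" and B: "\<And>x. x \<in> carrier G \<Longrightarrow> \<bar>h x\<bar> \<le> B"
    and x: "x \<in> carrier G" and t: "t \<in> S"
  shows "\<bar>h (x \<otimes> t) - h x\<bar> \<le>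
    B * (2 * sqrt (2 * card S * (pmf_entropy (lazy_walk G S (Suc n)) - pmf_entropy (lazy_walk G S n))))"
proof -
  define p where "p = lazy_walk G S n"
  define q where "q = lazy_walk G S (Suc n)"
  define Z where "Z = set_pmf q"
  define \<nu> where "\<nu> = (\<lambda>s z. pmf p (inv s \<otimes> z))"
  have finp: "finite (set_pmf p)" "set_pmf p \<subseteq> carrier G"
    unfolding p_def by (rule set_lazy_walk)+
  have fin: "finite Z" and sub: "Z \<subseteq> carrier G"
    unfolding Z_def q_def by (rule set_lazy_walk)+
  have first_step: "measure_pmf.expectation q f =
      measure_pmf.expectation (lazy_step G S) (\<lambda>s. measure_pmf.expectation p (\<lambda>y. f (s \<otimes> y)))"
    for f :: "'a \<Rightarrow> real"
  proof -
    have "measure_pmf.expectation q f = measure_pmf.expectation q (\<lambda>y. f (\<one> \<otimes> y))"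
      unfolding q_def by (intro expectation_lazy_walk_cong) simp
    also have "\<dots> = walk_op S (\<otimes>) ((walk_op S (\<otimes>) ^^ n) f) \<one>"
      unfolding q_def self.walk_op_funpow_eq_expectation[OF one_closed, symmetric] by simp
    also have "\<dots> = (walk_op S (\<otimes>) ^^ n) f \<one> / 2 + (\<Sum>s\<in>S. (walk_op S (\<otimes>) ^^ n) f (\<one> \<otimes> s)) / (2 * card S)"
      by (rule walk_op_def)
    also have "\<dots> = measure_pmf.expectation (lazy_step G S) (\<lambda>s. measure_pmf.expectation p (\<lambda>y. f (s \<otimes> y)))"
      unfolding expectation_lazy_step p_def
      using self.walk_op_funpow_eq_expectation[of _ n f]
      by (simp add: generators_closed cong: sum.cong)
    finally show ?thesis .
  qed
  have mix: "pmf q z = measure_pmf.expectation (lazy_step G S) (\<lambda>s. \<nu> s z)" if z: "z \<in> carrier G" for z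
  proof -
    have "measure_pmf.expectation p (\<lambda>y. indicator {z} (s \<otimes> y)) = \<nu> s z" if s: "s \<in> carrier G" for s
    proof -
      have "s \<otimes> y = z \<longleftrightarrow> y = inv s \<otimes> z" if "y \<in> carrier G" for y
        using s z that by (auto simp: m_assoc[symmetric])
      then have "measure_pmf.expectation p (\<lambda>y. indicator {z} (s \<otimes> y)) =
          measure_pmf.expectation p (indicator {inv s \<otimes> z} :: 'a \<Rightarrow> real)"
        unfolding p_def by (intro expectation_lazy_walk_cong) (simp add: indicator_def)
      then show ?thesis unfolding \<nu>_def p_def pmf_lazy_walk_eq_expectation .
    qed
    then show ?thesis
      using first_step[of "indicator {z}"] pmf_lazy_walk_eq_expectation[of "Suc n" z]
      by (simp add: q_def expectation_lazy_step generators_closed cong: sum.cong)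
  qed
  have supp: "s \<otimes> y \<in> Z" if s: "s \<in> insert \<one> S" and y: "y \<in> set_pmf p" for s y
  proof -
    have cl: "s \<in> carrier G" "y \<in> carrier G" using s y finp generators_closed by auto
    have \<nu>_pos: "\<nu> s (s \<otimes> y) > 0" using y cl by (simp add: \<nu>_def pmf_positive flip: m_assoc)
    then have sum_pos: "(\<Sum>s'\<in>S. \<nu> s' (s \<otimes> y)) > 0" if "s \<in> S"
      using that by (intro sum_pos2[OF finite_generators that]) (auto simp: \<nu>_def)
    have sum_nn: "(\<Sum>s'\<in>S. \<nu> s' (s \<otimes> y)) \<ge> 0" by (simp add: \<nu>_def sum_nonneg)
    have "\<nu> \<one> (s \<otimes> y) / 2 + (\<Sum>s'\<in>S. \<nu> s' (s \<otimes> y)) / (2 * card S) > 0"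
    proof (cases "s = \<one>")
      case True
      then show ?thesis
        using \<nu>_pos sum_nn by (intro add_pos_nonneg) auto
    next
      case False
      then show ?thesis
        using s card_generators_pos sum_pos
        by (intro add_nonneg_pos divide_pos_pos) (auto simp: \<nu>_def)
    qed
    then have "pmf q (s \<otimes> y) > 0" using mix[of "s \<otimes> y"] cl by (simp add: expectation_lazy_step)
    then show ?thesis by (simp add: Z_def set_pmf_iff)
  qed
  have reindex: "(\<Sum>z\<in>Z. f (inv s \<otimes> z)) = (\<Sum>y\<in>set_pmf p. f y)"
    if s: "s \<in> insert \<one> S" and f0: "\<And>y. y \<notin> set_pmf p \<Longrightarrow> f y = 0" for s and f :: "'a \<Rightarrow> real"
  proof -
    have s': "s \<in> carrier G" using s generators_closed by auto
    have "(\<Sum>y\<in>set_pmf p. f y) = (\<Sum>z\<in>(\<lambda>y. s \<otimes> y) ` set_pmf p. f (inv s \<otimes> z))"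
      using finp s'
      by (subst sum.reindex)
        (auto intro!: sum.cong inj_onI simp: subset_iff simp flip: m_assoc)
    also have "\<dots> = (\<Sum>z\<in>Z. f (inv s \<otimes> z))"
    proof (rule sum.mono_neutral_left[OF fin])
      show "(\<lambda>y. s \<otimes> y) ` set_pmf p \<subseteq> Z" using supp[OF s] by auto
      show "\<forall>z\<in>Z - (\<lambda>y. s \<otimes> y) ` set_pmf p. f (inv s \<otimes> z) = 0"
      proof
        fix z assume z: "z \<in> Z - (\<lambda>y. s \<otimes> y) ` set_pmf p"
        then have "z \<in> carrier G" using sub by auto
        then have "z = s \<otimes> (inv s \<otimes> z)" using s' by (simp flip: m_assoc)
        then show "f (inv s \<otimes> z) = 0" using z f0 by blast
      qed
    qed
    finally show ?thesis ..
  qed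
  have \<nu>: "0 \<le> \<nu> s z" for s z by (simp add: \<nu>_def)
  have \<nu>1: "(\<Sum>z\<in>Z. \<nu> s z) = 1" if "s \<in> insert \<one> S" for s
    using reindex[OF that, of "pmf p"] sum_pmf_eq_1[OF finp(1) order_refl] by (simp add: \<nu>_def set_pmf_iff)
  have \<mu>: "0 < pmf q z" if "z \<in> Z" for z using that by (simp add: Z_def pmf_positive)
  have \<mu>1: "(\<Sum>z\<in>Z. pmf q z) = 1" using fin by (intro sum_pmf_eq_1) (auto simp: Z_def)
  define D where "D = (\<lambda>s. \<Sum>z\<in>Z. \<nu> s z * (ln (\<nu> s z) - ln (pmf q z)))"
  define hell where "hell = (\<lambda>s. \<Sum>z\<in>Z. (sqrt (\<nu> s z) - sqrt (pmf q z))\<^sup>2)"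
  have hD: "hell s \<le> D s" if "s \<in> insert \<one> S" for s
    unfolding hell_def D_def using fin \<nu> \<nu>1[OF that] \<mu> \<mu>1 by (intro hellinger_le_relative_entropy) auto
  have hell_nonneg: "0 \<le> hell s" for s by (simp add: hell_def sum_nonneg)
  have D_eq: "D s = - pmf_entropy p - (\<Sum>z\<in>Z. \<nu> s z * ln (pmf q z))" if "s \<in> insert \<one> S" for s
    using reindex[OF that, of "\<lambda>y. pmf p y * ln (pmf p y)"]
    by (simp add: D_def \<nu>_def right_diff_distrib sum_subtractf pmf_entropy_def set_pmf_iff)
  have "pmf_entropy q - pmf_entropy p = D \<one> / 2 + (\<Sum>s\<in>S. D s) / (2 * card S)"
  proof -
    have "pmf_entropy q = - (\<Sum>z\<in>Z. measure_pmf.expectation (lazy_step G S) (\<lambda>s. \<nu> s z) * ln (pmf q z))"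
      unfolding pmf_entropy_def Z_def[symmetric] using sub mix by (simp add: subset_iff cong: sum.cong)
    also have "\<dots> = - ((\<Sum>z\<in>Z. \<nu> \<one> z * ln (pmf q z)) / 2 +
        (\<Sum>s\<in>S. \<Sum>z\<in>Z. \<nu> s z * ln (pmf q z)) / (2 * card S))"
      unfolding expectation_lazy_step sum.swap[of "\<lambda>s z. \<nu> s z * ln (pmf q z)" Z S]
      by (simp add: distrib_right sum.distrib sum_divide_distrib sum_distrib_right)
    finally show ?thesis
      using card_generators_pos
      by (simp add: D_eq sum_subtractf diff_divide_distrib cong: sum.cong)
  qed
  moreover have "0 \<le> D \<one>" using hD[of \<one>] hell_nonneg[of \<one>] by simp
  moreover have "hell t / (2 * card S) \<le> (\<Sum>s\<in>S. D s) / (2 * card S)"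
  proof (rule divide_right_mono)
    have "hell t \<le> (\<Sum>s\<in>S. hell s)" using t hell_nonneg by (intro member_le_sum finite_generators)
    also have "\<dots> \<le> (\<Sum>s\<in>S. D s)" using hD by (intro sum_mono) auto
    finally show "hell t \<le> (\<Sum>s\<in>S. D s)" .
  qed simp
  ultimately have "hell t / (2 * card S) \<le> pmf_entropy q - pmf_entropy p" by linarith
  then have hell: "hell t \<le> 2 * card S * (pmf_entropy q - pmf_entropy p)"
    using card_generators_pos by (subst (asm) pos_divide_le_eq) (simp_all add: mult.commute)
  have t': "t \<in> carrier G" using t by (rule generators_closed)
  have "h (x \<otimes> t) = (\<Sum>y\<in>set_pmf p. h (x \<otimes> t \<otimes> y) * pmf p y)"
    using harmonic_lazy_walk[OF h, of "x \<otimes> t" n] x t' integral_measure_pmf_real[OF finp(1), of p "\<lambda>y. h (x \<otimes> t \<otimes> y)"]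
    by (simp add: p_def)
  also have "\<dots> = (\<Sum>z\<in>Z. h (x \<otimes> t \<otimes> (inv t \<otimes> z)) * pmf p (inv t \<otimes> z))"
    using t by (intro reindex[symmetric]) (auto simp: set_pmf_iff)
  also have "\<dots> = (\<Sum>z\<in>Z. h (x \<otimes> z) * \<nu> t z)"
  proof (rule sum.cong)
    fix z assume "z \<in> Z"
    then have "z \<in> carrier G" using sub by auto
    then have "x \<otimes> t \<otimes> (inv t \<otimes> z) = x \<otimes> z"
      using x t' by (metis inv_closed l_one m_assoc m_closed r_inv)
    then show "h (x \<otimes> t \<otimes> (inv t \<otimes> z)) * pmf p (inv t \<otimes> z) = h (x \<otimes> z) * \<nu> t z"
      by (simp add: \<nu>_def)
  qed simp
  finally have "h (x \<otimes> t) = (\<Sum>z\<in>Z. h (x \<otimes> z) * \<nu> t z)" .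
  moreover have "h x = (\<Sum>z\<in>Z. h (x \<otimes> z) * pmf q z)"
    using harmonic_lazy_walk[OF h x, of "Suc n"] integral_measure_pmf_real[OF fin, of q "\<lambda>y. h (x \<otimes> y)"]
    by (simp add: q_def Z_def)
  ultimately have "\<bar>h (x \<otimes> t) - h x\<bar> = \<bar>\<Sum>z\<in>Z. h (x \<otimes> z) * (\<nu> t z - pmf q z)\<bar>"
    by (simp add: right_diff_distrib sum_subtractf)
  also have "\<dots> \<le> (\<Sum>z\<in>Z. B * \<bar>\<nu> t z - pmf q z\<bar>)"
    using sub x B by (intro order_trans[OF sum_abs] sum_mono) (auto simp: abs_mult intro!: mult_right_mono)
  also have "\<dots> = B * (\<Sum>z\<in>Z. \<bar>\<nu> t z - pmf q z\<bar>)" by (simp add: sum_distrib_left)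
  also have "\<dots> \<le> B * (2 * sqrt (hell t))"
    unfolding hell_def using \<nu> \<nu>1 t \<mu> \<mu>1 B[OF x]
    by (intro mult_left_mono total_variation_le_hellinger) (auto simp: less_imp_le)
  also have "\<dots> \<le> B * (2 * sqrt (2 * card S * (pmf_entropy q - pmf_entropy p)))"
    using hell B[OF x] by (intro mult_left_mono real_sqrt_le_mono) auto
  finally show ?thesis by (simp add: p_def q_def)
qed

text \<open>The entropy at time \<open>2 n\<close> is the sum of \<open>2 n\<close> increments, and it is sublinear.\<close>

lemma ex_small_entropy_increment:
  assumes speed: "\<And>n. n \<ge> 1 \<Longrightarrow>
      mean (2 * n) (\<lambda>g. real (word_length G S g)) \<le> D * real (2 * n) powr \<theta>"
    and "\<theta> < 1" "\<epsilon> > 0"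
  shows "\<exists>n. pmf_entropy (lazy_walk G S (Suc n)) - pmf_entropy (lazy_walk G S n) < \<epsilon>"
proof (rule ccontr)
  define E where "E = (\<lambda>n. pmf_entropy (lazy_walk G S n))"
  assume "\<not> ?thesis"
  then have step: "\<epsilon> \<le> E (Suc n) - E n" for n by (auto simp: E_def not_less)
  have E0: "E 0 = 0" by (simp add: E_def pmf_entropy_def lazy_walk_def)
  have lower: "real n * \<epsilon> \<le> E n" for n
  proof (induction n)
    case (Suc n)
    then show ?case using step[of n] by (simp add: algebra_simps)
  qed (simp add: E0)
  define c where "c = ln (2 * card S)"
  have c: "c \<ge> 0" using card_generators_pos unfolding c_def by (intro ln_ge_zero) auto
  have bound: "\<epsilon> \<le> ln 2 * real (2 * n) powr (- 1) + c * D * real (2 * n) powr (\<theta> - 1)" if n: "n \<ge> 1" for n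
  proof -
    have "E (2 * n) \<le> ln 2 + c * mean (2 * n) (\<lambda>g. real (word_length G S g))"
      unfolding E_def c_def by (rule entropy_le_speed)
    also have "\<dots> \<le> ln 2 + c * (D * real (2 * n) powr \<theta>)"
      using c by (intro add_left_mono mult_left_mono speed n)
    finally have "real (2 * n) * \<epsilon> \<le> ln 2 + c * (D * real (2 * n) powr \<theta>)"
      using lower[of "2 * n"] by linarith
    then have "\<epsilon> \<le> (ln 2 + c * (D * real (2 * n) powr \<theta>)) / real (2 * n)"
      using n by (subst pos_le_divide_eq) (simp_all add: mult.commute[of \<epsilon>])
    also have "\<dots> = ln 2 * real (2 * n) powr (- 1) + c * D * real (2 * n) powr (\<theta> - 1)"
      using n by (simp add: add_divide_distrib powr_diff powr_minus_divide)
    finally show ?thesis .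
  qed
  have lim: "filterlim (\<lambda>n. real (2 * n)) at_top sequentially"
    by (rule filterlim_compose[OF filterlim_real_sequentially]) (rule mult_nat_left_at_top, simp)
  have "(\<lambda>n. ln 2 * real (2 * n) powr (- 1) + c * D * real (2 * n) powr (\<theta> - 1)) \<longlonglongrightarrow>
      ln 2 * 0 + c * D * 0"
    using \<open>\<theta> < 1\<close> by (intro tendsto_add tendsto_mult_left tendsto_neg_powr lim) auto
  then have "\<forall>\<^sub>F n in sequentially. ln 2 * real (2 * n) powr (- 1) + c * D * real (2 * n) powr (\<theta> - 1) < \<epsilon>"
    using \<open>\<epsilon> > 0\<close> by (intro order_tendstoD) simp_all
  then obtain N where "\<And>n. n \<ge> N \<Longrightarrow> ln 2 * real (2 * n) powr (- 1) + c * D * real (2 * n) powr (\<theta> - 1) < \<epsilon>"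
    by (auto simp: eventually_sequentially)
  from this[of "max N 1"] bound[of "max N 1"] show False by simp
qed

lemma liouville_of_sublinear_speed:
  assumes speed: "\<And>n. n \<ge> 1 \<Longrightarrow>
      mean (2 * n) (\<lambda>g. real (word_length G S g)) \<le> D * real (2 * n) powr \<theta>"
    and "\<theta> < 1"
  shows "liouville G S"
  unfolding liouville_def
proof (intro allI impI)
  fix h assume "harmonic_on_cayley G S h \<and> bounded (h ` carrier G)"
  then have h: "harmonic_on_cayley G S h" and "bounded (h ` carrier G)" by auto
  then obtain B where B: "B > 0" "\<And>x. x \<in> carrier G \<Longrightarrow> \<bar>h x\<bar> \<le> B"
    by (auto simp: bounded_pos)
  have inv: "h (x \<otimes> t) = h x" if x: "x \<in> carrier G" and t: "t \<in> S" for x t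
  proof (rule ccontr)
    assume "h (x \<otimes> t) \<noteq> h x"
    then have d: "\<bar>h (x \<otimes> t) - h x\<bar> > 0" (is "?d > 0") by simp
    define \<epsilon> where "\<epsilon> = (?d / (2 * B))\<^sup>2 / (2 * card S)"
    have \<epsilon>: "\<epsilon> > 0" unfolding \<epsilon>_def using d B card_generators_pos by (intro divide_pos_pos zero_less_power) auto
    obtain n where n: "pmf_entropy (lazy_walk G S (Suc n)) - pmf_entropy (lazy_walk G S n) < \<epsilon>"
      using ex_small_entropy_increment[OF speed \<open>\<theta> < 1\<close> \<epsilon>] by blast
    define e where "e = 2 * card S * (pmf_entropy (lazy_walk G S (Suc n)) - pmf_entropy (lazy_walk G S n))"
    have "e < 2 * card S * \<epsilon>"
      unfolding e_def using n card_generators_pos by (intro mult_strict_left_mono) auto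
    also have "\<dots> = (?d / (2 * B))\<^sup>2" using card_generators_pos by (simp add: \<epsilon>_def)
    finally have "e < (?d / (2 * B))\<^sup>2" .
    then have "sqrt e < ?d / (2 * B)"
      using d B by (metis abs_of_pos divide_pos_pos mult_pos_pos real_sqrt_abs real_sqrt_less_iff zero_less_numeral)
    then have "B * (2 * sqrt e) < ?d" using B by (simp add: field_simps)
    moreover have "?d \<le> B * (2 * sqrt e)"
      unfolding e_def by (rule harmonic_increment_le[OF h B(2) x t])
    ultimately show False by simp
  qed
  have word: "h (x \<otimes> word_value ws) = h x" if "set ws \<subseteq> S" "x \<in> carrier G" for ws x
    using that
  proof (induction ws arbitrary: x)
    case (Cons s ws)
    then have "h (x \<otimes> (s \<otimes> word_value ws)) = h ((x \<otimes> s) \<otimes> word_value ws)"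
      by (simp add: m_assoc generators_closed word_value_closed)
    also have "\<dots> = h (x \<otimes> s)" using Cons by (simp add: generators_closed)
    also have "\<dots> = h x" using Cons by (intro inv) auto
    finally show ?case by simp
  qed simp
  have "h g = h \<one>" if g: "g \<in> carrier G" for g
  proof -
    obtain ws where ws: "set ws \<subseteq> S" "word_value ws = g" using ex_word[OF g] by blast
    then show ?thesis using word[OF ws(1) one_closed] g by simp
  qed
  then show "h constant_on carrier G" unfolding constant_on_def by blast
qed

end

section \<open>Groups quasi-isometric to a group with a Gaussian heat kernel\<close>

text \<open>Passing to other generating sets distorts both word metrics by bounded factors.\<close>

lemma ex_coarse_map:
  assumes "generated_group G S" "generated_group G T" "generated_group H S'" "generated_group H T'"
    and qi: "cayley_quasi_isometric H T' G T"
  shows "\<exists>q a b. coarse_map G S H S' q a b"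
proof -
  interpret S: generated_group G S by fact
  interpret T: generated_group G T by fact
  interpret S': generated_group H S' by fact
  interpret T': generated_group H T' by fact
  obtain q A B where q: "q \<in> carrier H \<rightarrow> carrier G" and A: "A \<ge> 1" and B: "B \<ge> 0"
    and dist: "\<And>x x'. x \<in> carrier H \<Longrightarrow> x' \<in> carrier H \<Longrightarrow>
      real (cayley_dist H T' x x') / A - B \<le> real (cayley_dist G T (q x) (q x')) \<and>
      real (cayley_dist G T (q x) (q x')) \<le> A * real (cayley_dist H T' x x') + B"
    and dense: "\<And>y. y \<in> carrier G \<Longrightarrow> \<exists>x\<in>carrier H. real (cayley_dist G T (q x) y) \<le> B"
    using qi unfolding cayley_quasi_isometric_def quasi_isometric_def by blast
  obtain c\<^sub>1 :: real where c\<^sub>1: "c\<^sub>1 \<ge> 1" "\<And>g. g \<in> carrier G \<Longrightarrow> word_length G S g \<le> c\<^sub>1 * word_length G T g"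
    using word_length_equivalent[OF assms(2,1)] by blast
  obtain c\<^sub>2 :: real where c\<^sub>2: "c\<^sub>2 \<ge> 1" "\<And>g. g \<in> carrier G \<Longrightarrow> word_length G T g \<le> c\<^sub>2 * word_length G S g"
    using word_length_equivalent[OF assms(1,2)] by blast
  obtain c\<^sub>3 :: real where c\<^sub>3: "c\<^sub>3 \<ge> 1" "\<And>g. g \<in> carrier H \<Longrightarrow> word_length H T' g \<le> c\<^sub>3 * word_length H S' g"
    using word_length_equivalent[OF assms(3,4)] by blast
  obtain c\<^sub>4 :: real where c\<^sub>4: "c\<^sub>4 \<ge> 1" "\<And>g. g \<in> carrier H \<Longrightarrow> word_length H S' g \<le> c\<^sub>4 * word_length H T' g"
    using word_length_equivalent[OF assms(4,3)] by blast
  define a where "a = max (c\<^sub>1 * A * c\<^sub>3) (c\<^sub>4 * A * c\<^sub>2)"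
  have a1: "1 \<le> c\<^sub>4 * A * c\<^sub>2"
    using mult_mono[of 1 "c\<^sub>4 * A" 1 c\<^sub>2] mult_mono[of 1 c\<^sub>4 1 A] c\<^sub>4(1) A c\<^sub>2(1) by simp
  have bB: "B \<le> c\<^sub>1 * B" using mult_right_mono[OF c\<^sub>1(1) B] by simp
  have "coarse_map G S H S' q a (c\<^sub>1 * B)"
  proof unfold_locales
    show "q h \<in> carrier G" if "h \<in> carrier H" for h using q that by auto
    show "1 \<le> a" using a1 by (simp add: a_def)
    show "0 \<le> c\<^sub>1 * B" using B bB by linarith
    fix h g assume hg: "h \<in> carrier H" "g \<in> carrier H"
    define j where "j = inv\<^bsub>G\<^esub> (q h) \<otimes>\<^bsub>G\<^esub> q (h \<otimes>\<^bsub>H\<^esub> g)"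
    have j: "j \<in> carrier G" using hg q by (auto simp: j_def Pi_iff)
    have "inv\<^bsub>H\<^esub> h \<otimes>\<^bsub>H\<^esub> (h \<otimes>\<^bsub>H\<^esub> g) = g" using hg by (simp flip: S'.m_assoc)
    with dist[of "h \<otimes>\<^bsub>H\<^esub> g" h] hg
    have d: "word_length H T' g / A - B \<le> word_length G T j" "word_length G T j \<le> A * word_length H T' g + B"
      by (simp_all add: cayley_dist_def j_def)
    have "real (word_length G S j) \<le> c\<^sub>1 * word_length G T j" using c\<^sub>1(2)[OF j] by simp
    also have "\<dots> \<le> c\<^sub>1 * (A * (c\<^sub>3 * word_length H S' g) + B)"
    proof (rule mult_left_mono)
      have "A * word_length H T' g \<le> A * (c\<^sub>3 * word_length H S' g)"
        using c\<^sub>3(2)[OF hg(2)] A by (intro mult_left_mono) auto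
      then show "word_length G T j \<le> A * (c\<^sub>3 * word_length H S' g) + B" using d(2) by linarith
    qed (use c\<^sub>1 in simp)
    also have "\<dots> = (c\<^sub>1 * A * c\<^sub>3) * word_length H S' g + c\<^sub>1 * B" by (simp add: algebra_simps)
    also have "\<dots> \<le> a * word_length H S' g + c\<^sub>1 * B"
      by (intro add_right_mono mult_right_mono) (auto simp: a_def)
    finally show "real (word_length G S (inv\<^bsub>G\<^esub> (q h) \<otimes>\<^bsub>G\<^esub> q (h \<otimes>\<^bsub>H\<^esub> g))) \<le> a * word_length H S' g + c\<^sub>1 * B"
      by (simp add: j_def)
    have "word_length H S' g / a \<le> word_length H S' g / (c\<^sub>4 * A * c\<^sub>2)"
      using a1 by (intro divide_left_mono) (auto simp: a_def intro!: mult_pos_pos)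
    also have "\<dots> \<le> c\<^sub>4 * word_length H T' g / (c\<^sub>4 * A * c\<^sub>2)"
      using c\<^sub>4(2)[OF hg(2)] a1 by (intro divide_right_mono) auto
    also have "\<dots> = (word_length H T' g / A) / c\<^sub>2" using c\<^sub>4(1) by simp
    also have "\<dots> \<le> (word_length G T j + B) / c\<^sub>2"
      using d(1) c\<^sub>2(1) by (intro divide_right_mono) auto
    also have "\<dots> \<le> (c\<^sub>2 * word_length G S j + c\<^sub>2 * B) / c\<^sub>2"
      using c\<^sub>2(2)[OF j] c\<^sub>2(1) mult_right_mono[OF c\<^sub>2(1) B] by (intro divide_right_mono) auto
    also have "\<dots> = word_length G S j + B" using c\<^sub>2(1) by (simp add: add_divide_distrib)
    finally show "word_length H S' g / a - c\<^sub>1 * B \<le> real (word_length G S (inv\<^bsub>G\<^esub> (q h) \<otimes>\<^bsub>G\<^esub> q (h \<otimes>\<^bsub>H\<^esub> g)))"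
      using bB by (simp add: j_def)
  next
    fix x assume x: "x \<in> carrier G"
    then obtain h where h: "h \<in> carrier H" "real (cayley_dist G T (q h) x) \<le> B" using dense by blast
    define z where "z = inv\<^bsub>G\<^esub> x \<otimes>\<^bsub>G\<^esub> q h"
    have qh: "q h \<in> carrier G" using h q by auto
    then have z: "z \<in> carrier G" "inv\<^bsub>G\<^esub> z = inv\<^bsub>G\<^esub> (q h) \<otimes>\<^bsub>G\<^esub> x"
      using x by (auto simp: z_def S.inv_mult_group)
    have "real (word_length G S (inv\<^bsub>G\<^esub> z)) \<le> c\<^sub>1 * word_length G T z"
      using c\<^sub>1(2)[OF z(1)] z(1) by (simp add: S.word_length_inv)
    also have "\<dots> \<le> c\<^sub>1 * B"
      using h(2) c\<^sub>1(1) by (intro mult_left_mono) (auto simp: cayley_dist_def z_def)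
    finally show "\<exists>h\<in>carrier H. real (word_length G S (inv\<^bsub>G\<^esub> (q h) \<otimes>\<^bsub>G\<^esub> x)) \<le> c\<^sub>1 * B"
      using h(1) z(2) by auto
  qed
  then show ?thesis by blast
qed

theorem theorem1p4:
  fixes G :: "('a, 'm) monoid_scheme" and S\<^sub>1 S\<^sub>2 T :: "'a set"
    and G' :: "('b, 'n) monoid_scheme" and T' :: "'b set"
    and K L M N \<gamma> :: real
  assumes "group G"
    and "fin_sym_gen_set G S\<^sub>1" and "K > 0" and "L > 0" and "0 \<le> \<gamma>" and "\<gamma> < 1"
    and "\<forall>n\<ge>1. pmf (lazy_walk G S\<^sub>1 n) \<one>\<^bsub>G\<^esub> \<ge> K * exp (- L * real n powr \<gamma>)"
    and "fin_sym_gen_set G S\<^sub>2" and "M > 0" and "N > 0"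
    and "\<forall>n\<ge>1. \<forall>g\<in>carrier G. pmf (lazy_walk G S\<^sub>2 n) g \<le>
           pmf (lazy_walk G S\<^sub>2 n) \<one>\<^bsub>G\<^esub> * N * exp (- M * (real (word_length G S\<^sub>2 g))\<^sup>2 / real n)"
    and "group G'"
    and "fin_sym_gen_set G T" and "fin_sym_gen_set G' T'" and "cayley_quasi_isometric G' T' G T"
  shows "\<forall>S'. fin_sym_gen_set G' S' \<longrightarrow>
           equivariant_compression_exponent G' S' \<ge> 1 - \<gamma> \<and>
           speed_exponent G' S' \<le> 1 / (2 * (1 - \<gamma>)) \<and>
           (\<gamma> < 1/2 \<longrightarrow> liouville G' S')"
proof (intro allI impI)
  fix S' assume S': "fin_sym_gen_set G' S'"
  have gen: "generated_group G S\<^sub>1" "generated_group G S\<^sub>2" "generated_group G T"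
      "generated_group G' S'" "generated_group G' T'"
    using assms S' by (auto simp: generated_group_def generated_group_axioms_def)
  obtain q a b where "coarse_map G S\<^sub>2 G' S' q a b"
    using ex_coarse_map[OF gen(2,3,4,5) assms(15)] by blast
  then interpret coarse_map G S\<^sub>2 G' S' q a b .
  let ?A = "carrier G' \<times> carrier G" and ?\<alpha> = "1 - \<gamma>"
  have disp: "disperses G' S' ?A product_act ?\<alpha>"
    by (rule disperses_product[OF gen(1)]) (use assms in auto)
  have A: "countable ?A" "?A \<noteq> {}"
    using G.countable_carrier H.countable_carrier by auto
  have "?\<alpha> \<le> equivariant_compression_exponent G' S'"
  proof (rule dense_le_bounded)
    show "0 < ?\<alpha>" using \<open>\<gamma> < 1\<close> by simp
    fix c assume "0 < c" "c < ?\<alpha>"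
    then show "c \<le> equivariant_compression_exponent G' S'"
      using PA.equivariant_compression_exponent_ge_of_disperses[OF disp A, of c] \<open>0 \<le> \<gamma>\<close> by simp
  qed
  moreover have "speed_exponent G' S' \<le> 1 / (2 * ?\<alpha>)"
    using PA.speed_exponent_le[OF disp] \<open>0 \<le> \<gamma>\<close> \<open>\<gamma> < 1\<close> by simp
  moreover have "liouville G' S'" if "\<gamma> < 1/2"
  proof -
    define c where "c = (1/2 + ?\<alpha>) / 2"
    have c: "1/2 < c" "c < ?\<alpha>" using that by (auto simp: c_def)
    obtain D where "\<And>n. n \<ge> 1 \<Longrightarrow>
        measure_pmf.expectation (lazy_walk G' S' (2 * n)) (\<lambda>g. real (word_length G' S' g)) \<le>
          D * real (2 * n) powr (1 / (2 * c))"
      using PA.expectation_word_length_le[OF disp c] by blast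
    moreover have "1 / (2 * c) < 1" using c by simp
    ultimately show ?thesis by (rule H.liouville_of_sublinear_speed)
  qed
  ultimately show "equivariant_compression_exponent G' S' \<ge> 1 - \<gamma> \<and>
      speed_exponent G' S' \<le> 1 / (2 * (1 - \<gamma>)) \<and> (\<gamma> < 1/2 \<longrightarrow> liouville G' S')"
    by blast
qed

end
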